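(* Let $(M^{2n},\omega,g)$, $n\ge2$, be a symplectic manifold with compatible metric, $P\to M$ a principal $G$-bundle with $G$ compact, and $A$ a connection on $P$. If $A$ is a critical solution of two of the three functionals $\|F^A\|^2$, $\|F_p^A\|^2$ and $\|\Phi^A\omega\|^2$, then it is a critical solution of all three.
   Context: $g$ is part of a compatible triple $(\omega,g,J)$, $g(u,v)=\omega(u,Jv)$, and $\mathrm{vol}_g=\omega^n/n!$. $G$ is a compact Lie group with a fixed $\mathrm{Ad}$-invariant inner product on its Lie algebra; with $g$ it induces a pointwise inner product on $\operatorname{ad}P$-valued forms, and $\|\eta\|^2=\int_M|\eta|^2\mathrm{vol}_g$. $F^A=dA+\frac12[A,A]$. With $L=\omega\wedge\cdot$ and $\Lambda$ its adjoint, $F^A=F^A_p+\Phi^A\omega$, where $\Phi^A=\frac1n\Lambda F^A\in\Omega^0(M,\operatorname{ad}P)$ and $\Lambda F_p^A=0$. $A$ is a critical solution of one of these functionals if its first variation vanishes along $A_t=A+t\eta$ for every compactly supported $\eta\in\Omega^1(M,\operatorname{ad}P)$ (on noncompact $M$, the derivative at $t=0$ is of the integral of the pointwise norm squared over a compact set containing $\operatorname{supp}\eta$). *)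

theory Defs
  imports "HOL-Analysis.Analysis" "HOL-Algebra.Group"
begin

section \<open>Smooth functions between finite-dimensional normed spaces\<close>

text \<open>Only used on open sets of finite-dimensional spaces, where the existence and continuity of all
  iterated directional derivatives is smoothness.\<close>

primrec Ck_on :: "nat \<Rightarrow> 'a::real_normed_vector set \<Rightarrow> ('a \<Rightarrow> 'b::real_normed_vector) \<Rightarrow> bool" where
  "Ck_on 0 S f \<longleftrightarrow> continuous_on S f"
| "Ck_on (Suc k) S f \<longleftrightarrow> (\<forall>x\<in>S. f differentiable (at x)) \<and>
     (\<forall>v. Ck_on k S (\<lambda>x. frechet_derivative f (at x) v))"

definition smooth_on :: "'a::real_normed_vector set \<Rightarrow> ('a \<Rightarrow> 'b::real_normed_vector) \<Rightarrow> bool" where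
  "smooth_on S f \<longleftrightarrow> (\<forall>k. Ck_on k S f)"


section \<open>Smooth manifolds\<close>

text \<open>A chart is a pair of its domain and its coordinate map (whose values off the domain are
  irrelevant).  A manifold is a type with a smooth atlas.  The model space is not required to be a
  \<open>euclidean_space\<close>, because that class excludes dimension zero, and a compact Lie group may be finite.\<close>

type_synonym ('m, 'e) chart = "'m set \<times> ('m \<Rightarrow> 'e)"
type_synonym ('m, 'e) atlas = "('m, 'e) chart set"

abbreviation cdom :: "('m, 'e) chart \<Rightarrow> 'm set" where "cdom \<equiv> fst"
abbreviation cmap :: "('m, 'e) chart \<Rightarrow> 'm \<Rightarrow> 'e" where "cmap \<equiv> snd"

definition cinv :: "('m, 'e) chart \<Rightarrow> 'e \<Rightarrow> 'm" where
  "cinv c = inv_into (cdom c) (cmap c)"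

definition smooth_manifold ::
    "('m::{t2_space,second_countable_topology}, 'e::real_normed_vector) atlas \<Rightarrow> bool" where
  "smooth_manifold C \<longleftrightarrow>
     (\<exists>B::'e set. finite B \<and> span B = UNIV) \<and>
     (\<Union>c\<in>C. cdom c) = UNIV \<and>
     (\<forall>c\<in>C. open (cdom c) \<and> open (cmap c ` cdom c) \<and>
            homeomorphism (cdom c) (cmap c ` cdom c) (cmap c) (cinv c)) \<and>
     (\<forall>c\<in>C. \<forall>c'\<in>C. smooth_on (cmap c ` (cdom c \<inter> cdom c')) (cmap c' \<circ> cinv c))"

definition prod_atlas :: "('m, 'e) atlas \<Rightarrow> ('n, 'f) atlas \<Rightarrow> ('m \<times> 'n, 'e \<times> 'f) atlas" where
  "prod_atlas C D = {(cdom c \<times> cdom d, map_prod (cmap c) (cmap d)) |c d. c \<in> C \<and> d \<in> D}"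

definition vs_atlas :: "('e, 'e) atlas" where
  "vs_atlas = {(UNIV, \<lambda>x. x)}"

definition smooth_map ::
    "('m::topological_space, 'e::real_normed_vector) atlas \<Rightarrow>
     ('n::topological_space, 'f::real_normed_vector) atlas \<Rightarrow> 'm set \<Rightarrow> ('m \<Rightarrow> 'n) \<Rightarrow> bool" where
  "smooth_map C D S f \<longleftrightarrow> continuous_on S f \<and>
     (\<forall>c\<in>C. \<forall>d\<in>D. smooth_on (cmap c ` (S \<inter> cdom c \<inter> f -` cdom d)) (cmap d \<circ> f \<circ> cinv c))"

definition diffeo ::
    "('m::topological_space, 'e::real_normed_vector) atlas \<Rightarrow>
     ('n::topological_space, 'f::real_normed_vector) atlas \<Rightarrow> 'm set \<Rightarrow> 'n set \<Rightarrow> ('m \<Rightarrow> 'n) \<Rightarrow> bool" where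
  "diffeo C D S T f \<longleftrightarrow> bij_betw f S T \<and> smooth_map C D S f \<and> smooth_map D C T (inv_into S f)"


section \<open>Tangent vectors and differential forms\<close>

text \<open>At each point a preferred chart is chosen, and the tangent space at \<open>x\<close> is identified with the
  model space through the preferred chart at \<open>x\<close>.  A tensor field is thus a function of a point and
  of vectors of the model space.  Its expression in an arbitrary chart is obtained through
  \<open>coord_vec\<close>, which depends on the chart at hand, so that smoothness has its usual meaning.\<close>

definition chart_at :: "('m, 'e) atlas \<Rightarrow> 'm \<Rightarrow> ('m, 'e) chart" where
  "chart_at C x = (SOME c. c \<in> C \<and> x \<in> cdom c)"

text \<open>The differential \<open>T\<^sub>x M \<rightarrow> T\<^bsub>f x\<^esub> N\<close>.\<close>

definition mderiv ::
    "('m, 'e::real_normed_vector) atlas \<Rightarrow> ('n, 'f::real_normed_vector) atlas \<Rightarrow>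
     ('m \<Rightarrow> 'n) \<Rightarrow> 'm \<Rightarrow> 'e \<Rightarrow> 'f" where
  "mderiv C D f x =
     frechet_derivative (cmap (chart_at D (f x)) \<circ> f \<circ> cinv (chart_at C x)) (at (cmap (chart_at C x) x))"

text \<open>\<open>coord_vec C c x u\<close> is the tangent vector at \<open>x\<close> with components \<open>u\<close> in the chart \<open>c\<close>;
  \<open>vec_coords C c x\<close> is the inverse map.\<close>

definition coord_vec :: "('m, 'e::real_normed_vector) atlas \<Rightarrow> ('m, 'e) chart \<Rightarrow> 'm \<Rightarrow> 'e \<Rightarrow> 'e" where
  "coord_vec C c x = frechet_derivative (cmap (chart_at C x) \<circ> cinv c) (at (cmap c x))"

definition vec_coords :: "('m, 'e::real_normed_vector) atlas \<Rightarrow> ('m, 'e) chart \<Rightarrow> 'm \<Rightarrow> 'e \<Rightarrow> 'e" where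
  "vec_coords C c x = frechet_derivative (cmap c \<circ> cinv (chart_at C x)) (at (cmap (chart_at C x) x))"

definition coord1 ::
    "('m, 'e::real_normed_vector) atlas \<Rightarrow> ('m, 'e) chart \<Rightarrow> ('m \<Rightarrow> 'e \<Rightarrow> 'v) \<Rightarrow> 'e \<Rightarrow> 'e \<Rightarrow> 'v" where
  "coord1 C c \<alpha> y u = \<alpha> (cinv c y) (coord_vec C c (cinv c y) u)"

definition coord2 ::
    "('m, 'e::real_normed_vector) atlas \<Rightarrow> ('m, 'e) chart \<Rightarrow> ('m \<Rightarrow> 'e \<Rightarrow> 'e \<Rightarrow> 'v) \<Rightarrow> 'e \<Rightarrow> 'e \<Rightarrow> 'e \<Rightarrow> 'v" where
  "coord2 C c \<alpha> y u v = \<alpha> (cinv c y) (coord_vec C c (cinv c y) u) (coord_vec C c (cinv c y) v)"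

definition smooth_1form ::
    "('m, 'e::real_normed_vector) atlas \<Rightarrow> ('m \<Rightarrow> 'e \<Rightarrow> 'v::real_normed_vector) \<Rightarrow> bool" where
  "smooth_1form C \<alpha> \<longleftrightarrow> (\<forall>x. linear (\<alpha> x)) \<and>
     (\<forall>c\<in>C. \<forall>u. smooth_on (cmap c ` cdom c) (\<lambda>y. coord1 C c \<alpha> y u))"

definition smooth_2tensor ::
    "('m, 'e::real_normed_vector) atlas \<Rightarrow> ('m \<Rightarrow> 'e \<Rightarrow> 'e \<Rightarrow> 'v::real_normed_vector) \<Rightarrow> bool" where
  "smooth_2tensor C \<alpha> \<longleftrightarrow>
     (\<forall>x u. linear (\<alpha> x u)) \<and> (\<forall>x v. linear (\<lambda>u. \<alpha> x u v)) \<and>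
     (\<forall>c\<in>C. \<forall>u v. smooth_on (cmap c ` cdom c) (\<lambda>y. coord2 C c \<alpha> y u v))"

definition smooth_endo ::
    "('m, 'e::real_normed_vector) atlas \<Rightarrow> ('m \<Rightarrow> 'e \<Rightarrow> 'e) \<Rightarrow> bool" where
  "smooth_endo C J \<longleftrightarrow> (\<forall>x. linear (J x)) \<and>
     (\<forall>c\<in>C. \<forall>u. smooth_on (cmap c ` cdom c)
        (\<lambda>y. vec_coords C c (cinv c y) (coord1 C c J y u)))"

text \<open>Exterior derivatives, with \<open>d\<alpha>(u,v) = u \<alpha>(v) - v \<alpha>(u) - \<alpha>([u,v])\<close> and its analogue in degree
  two, computed with coordinate vector fields in the preferred chart at the point.\<close>

definition ext_d1 ::
    "('m, 'e::real_normed_vector) atlas \<Rightarrow> ('m \<Rightarrow> 'e \<Rightarrow> 'v::real_normed_vector) \<Rightarrow> 'm \<Rightarrow> 'e \<Rightarrow> 'e \<Rightarrow> 'v" where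
  "ext_d1 C \<alpha> x u v =
     (let c = chart_at C x; D = (\<lambda>f w. frechet_derivative f (at (cmap c x)) w) in
      D (\<lambda>y. coord1 C c \<alpha> y v) u - D (\<lambda>y. coord1 C c \<alpha> y u) v)"

definition ext_d2 ::
    "('m, 'e::real_normed_vector) atlas \<Rightarrow> ('m \<Rightarrow> 'e \<Rightarrow> 'e \<Rightarrow> 'v::real_normed_vector) \<Rightarrow>
     'm \<Rightarrow> 'e \<Rightarrow> 'e \<Rightarrow> 'e \<Rightarrow> 'v" where
  "ext_d2 C \<alpha> x u v w =
     (let c = chart_at C x; D = (\<lambda>f z. frechet_derivative f (at (cmap c x)) z) in
      D (\<lambda>y. coord2 C c \<alpha> y v w) u - D (\<lambda>y. coord2 C c \<alpha> y u w) v + D (\<lambda>y. coord2 C c \<alpha> y u v) w)"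


section \<open>Symplectic manifolds with compatible metric\<close>

definition symplectic_form ::
    "('m, 'e::real_normed_vector) atlas \<Rightarrow> ('m \<Rightarrow> 'e \<Rightarrow> 'e \<Rightarrow> real) \<Rightarrow> bool" where
  "symplectic_form C \<omega> \<longleftrightarrow> smooth_2tensor C \<omega> \<and> (\<forall>x u. \<omega> x u u = 0) \<and>
     (\<forall>x u v w. ext_d2 C \<omega> x u v w = 0) \<and>
     (\<forall>x u. (\<forall>v. \<omega> x u v = 0) \<longrightarrow> u = 0)"

definition riemannian_metric ::
    "('m, 'e::real_normed_vector) atlas \<Rightarrow> ('m \<Rightarrow> 'e \<Rightarrow> 'e \<Rightarrow> real) \<Rightarrow> bool" where
  "riemannian_metric C g \<longleftrightarrow> smooth_2tensor C g \<and> (\<forall>x u v. g x u v = g x v u) \<and>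
     (\<forall>x u. u \<noteq> 0 \<longrightarrow> g x u u > 0)"

definition almost_complex ::
    "('m, 'e::real_normed_vector) atlas \<Rightarrow> ('m \<Rightarrow> 'e \<Rightarrow> 'e) \<Rightarrow> bool" where
  "almost_complex C J \<longleftrightarrow> smooth_endo C J \<and> (\<forall>x u. J x (J x u) = - u)"

definition compatible_triple ::
    "('m, 'e::real_normed_vector) atlas \<Rightarrow> ('m \<Rightarrow> 'e \<Rightarrow> 'e \<Rightarrow> real) \<Rightarrow> ('m \<Rightarrow> 'e \<Rightarrow> 'e \<Rightarrow> real) \<Rightarrow>
     ('m \<Rightarrow> 'e \<Rightarrow> 'e) \<Rightarrow> bool" where
  "compatible_triple C \<omega> g J \<longleftrightarrow> symplectic_form C \<omega> \<and> riemannian_metric C g \<and> almost_complex C J \<and>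
     (\<forall>x u v. g x u v = \<omega> x u (J x v))"

text \<open>\<open>\<omega>\<^sup>n / n!\<close> on \<open>v\<^sub>0, \<dots>, v\<^bsub>2n-1\<^esub>\<close>.  The factor \<open>1 / 2\<^sup>n\<close> comes from
  \<open>(\<alpha> \<and> \<beta>)(v\<^sub>1, \<dots>) = 1 / (p! q!) \<Sum>\<^sub>\<sigma> sgn \<sigma> \<alpha>(v\<^bsub>\<sigma> 1\<^esub>, \<dots>) \<beta>(v\<^bsub>\<sigma> (p+1)\<^esub>, \<dots>)\<close>.\<close>

definition liouville_form :: "nat \<Rightarrow> ('e \<Rightarrow> 'e \<Rightarrow> real) \<Rightarrow> (nat \<Rightarrow> 'e) \<Rightarrow> real" where
  "liouville_form n w v = (1 / (fact n * 2 ^ n)) *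
     (\<Sum>\<sigma> | \<sigma> permutes {..<2 * n}.
        of_int (sign \<sigma>) * (\<Prod>i<n. w (v (\<sigma> (2 * i))) (v (\<sigma> (2 * i + 1)))))"

text \<open>The Borel measure on the manifold, oriented by \<open>\<omega>\<^sup>n\<close>, that belongs to the volume form
  \<open>\<omega>\<^sup>n / n!\<close>: in a chart its density is the absolute value of the form on the coordinate vectors.
  This determines the measure, as countably many charts cover the manifold.\<close>

definition liouville_measure ::
    "('m::topological_space, 'e::euclidean_space) atlas \<Rightarrow> nat \<Rightarrow> ('m \<Rightarrow> 'e \<Rightarrow> 'e \<Rightarrow> real) \<Rightarrow>
     'm measure \<Rightarrow> bool" where
  "liouville_measure C n \<omega> vol \<longleftrightarrow> sets vol = sets borel \<and>
     (\<forall>c\<in>C. \<forall>b. bij_betw b {..<2 * n} Basis \<longrightarrow> (\<forall>S\<in>sets borel. S \<subseteq> cdom c \<longrightarrow>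
        emeasure vol S =
          (\<integral>\<^sup>+ y\<in>cmap c ` S. ennreal \<bar>liouville_form n (\<omega> (cinv c y)) (\<lambda>i. coord_vec C c (cinv c y) (b i))\<bar>
             \<partial>lborel)))"


section \<open>Lie groups\<close>

definition lie_group ::
    "('g::{t2_space,second_countable_topology}, 'k::real_normed_vector) atlas \<Rightarrow> 'g monoid \<Rightarrow> bool" where
  "lie_group C G \<longleftrightarrow> smooth_manifold C \<and> group G \<and> carrier G = UNIV \<and>
     smooth_map (prod_atlas C C) C UNIV (\<lambda>(a, b). a \<otimes>\<^bsub>G\<^esub> b) \<and>
     smooth_map C C UNIV (\<lambda>a. inv\<^bsub>G\<^esub> a)"

text \<open>The Lie algebra is the tangent space at the identity, i.e. the model space \<open>'k\<close>, with the bracket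
  \<open>[X, Y] = d/dt Ad (exp tX) Y\<close>.\<close>

definition Ad :: "('g, 'k::real_normed_vector) atlas \<Rightarrow> 'g monoid \<Rightarrow> 'g \<Rightarrow> 'k \<Rightarrow> 'k" where
  "Ad C G a = mderiv C C (\<lambda>b. a \<otimes>\<^bsub>G\<^esub> b \<otimes>\<^bsub>G\<^esub> inv\<^bsub>G\<^esub> a) \<one>\<^bsub>G\<^esub>"

definition lie_bracket :: "('g, 'k::real_normed_vector) atlas \<Rightarrow> 'g monoid \<Rightarrow> 'k \<Rightarrow> 'k \<Rightarrow> 'k" where
  "lie_bracket C G X Y = mderiv C vs_atlas (\<lambda>a. Ad C G a Y) \<one>\<^bsub>G\<^esub> X"

text \<open>The inner product is independent of the norm of the model space; boundedness is automatic in
  finite dimension.\<close>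

definition Ad_invariant_inner ::
    "('g, 'k::real_normed_vector) atlas \<Rightarrow> 'g monoid \<Rightarrow> ('k \<Rightarrow> 'k \<Rightarrow> real) \<Rightarrow> bool" where
  "Ad_invariant_inner C G ip \<longleftrightarrow> bounded_bilinear ip \<and> (\<forall>X Y. ip X Y = ip Y X) \<and>
     (\<forall>X. X \<noteq> 0 \<longrightarrow> ip X X > 0) \<and>
     (\<forall>a X Y. ip (Ad C G a X) (Ad C G a Y) = ip X Y)"


section \<open>Principal bundles and connections\<close>

record ('m, 'e, 'g, 'k, 'p, 'q) pbundle =
  base_atlas :: "('m, 'e) atlas"
  group_atlas :: "('g, 'k) atlas"
  group_str :: "'g monoid"
  total_atlas :: "('p, 'q) atlas"
  gact :: "'p \<Rightarrow> 'g \<Rightarrow> 'p"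
  bproj :: "'p \<Rightarrow> 'm"

definition principal_bundle ::
    "('m::{t2_space,second_countable_topology}, 'e::real_normed_vector,
      'g::{t2_space,second_countable_topology}, 'k::real_normed_vector,
      'p::{t2_space,second_countable_topology}, 'q::real_normed_vector) pbundle \<Rightarrow> bool" where
  "principal_bundle P \<longleftrightarrow>
     smooth_manifold (base_atlas P) \<and> lie_group (group_atlas P) (group_str P) \<and>
     smooth_manifold (total_atlas P) \<and>
     smooth_map (total_atlas P) (base_atlas P) UNIV (bproj P) \<and>
     smooth_map (prod_atlas (total_atlas P) (group_atlas P)) (total_atlas P) UNIV (\<lambda>(p, a). gact P p a) \<and>
     (\<forall>p. gact P p \<one>\<^bsub>group_str P\<^esub> = p) \<and>
     (\<forall>p a b. gact P (gact P p a) b = gact P p (a \<otimes>\<^bsub>group_str P\<^esub> b)) \<and>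
     (\<forall>p a. bproj P (gact P p a) = bproj P p) \<and>
     (\<forall>x. \<exists>U \<psi>. open U \<and> x \<in> U \<and>
        diffeo (total_atlas P) (prod_atlas (base_atlas P) (group_atlas P)) (bproj P -` U) (U \<times> UNIV) \<psi> \<and>
        (\<forall>p\<in>bproj P -` U. fst (\<psi> p) = bproj P p \<and>
           (\<forall>a. snd (\<psi> (gact P p a)) = snd (\<psi> p) \<otimes>\<^bsub>group_str P\<^esub> a)))"

abbreviation bAd where "bAd P \<equiv> Ad (group_atlas P) (group_str P)"

abbreviation bracket where "bracket P \<equiv> lie_bracket (group_atlas P) (group_str P)"

abbreviation dproj where "dproj P \<equiv> mderiv (total_atlas P) (base_atlas P) (bproj P)"

text \<open>Connection 1-forms: they reproduce the generators of the fundamental vector fields and satisfy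
  \<open>R\<^sub>a\<^sup>* A = Ad(a\<^sup>-\<^sup>1) A\<close>.\<close>

definition connection ::
    "('m, 'e::real_normed_vector, 'g, 'k::real_normed_vector, 'p, 'q::real_normed_vector) pbundle \<Rightarrow>
     ('p \<Rightarrow> 'q \<Rightarrow> 'k) \<Rightarrow> bool" where
  "connection P A \<longleftrightarrow> smooth_1form (total_atlas P) A \<and>
     (\<forall>p X. A p (mderiv (group_atlas P) (total_atlas P) (gact P p) \<one>\<^bsub>group_str P\<^esub> X) = X) \<and>
     (\<forall>p a w. A (gact P p a) (mderiv (total_atlas P) (total_atlas P) (\<lambda>p. gact P p a) p w) =
        bAd P (inv\<^bsub>group_str P\<^esub> a) (A p w))"

text \<open>Forms on \<open>M\<close> with values in \<open>ad P = P \<times>\<^sub>A\<^sub>d \<gg>\<close>: an element of the fibre of \<open>ad P\<close> over \<open>x\<close> is given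
  by the equivariant function on the fibre of \<open>P\<close> over \<open>x\<close> whose value at \<open>p\<close> is the \<open>X\<close> with
  \<open>[p, X]\<close> the given element.  Accordingly, a form takes as arguments a point \<open>p\<close> of \<open>P\<close> and tangent
  vectors of \<open>M\<close> at the projection of \<open>p\<close>.  Smoothness is that of the pull-back to \<open>P\<close>.\<close>

definition ad_1form ::
    "('m, 'e::real_normed_vector, 'g, 'k::real_normed_vector, 'p, 'q::real_normed_vector) pbundle \<Rightarrow>
     ('p \<Rightarrow> 'e \<Rightarrow> 'k) \<Rightarrow> bool" where
  "ad_1form P \<eta> \<longleftrightarrow> (\<forall>p. linear (\<eta> p)) \<and>
     (\<forall>p a u. \<eta> (gact P p a) u = bAd P (inv\<^bsub>group_str P\<^esub> a) (\<eta> p u)) \<and>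
     smooth_1form (total_atlas P) (\<lambda>p w. \<eta> p (dproj P p w))"

definition ad_support ::
    "('m::topological_space, 'e, 'g, 'k::real_normed_vector, 'p, 'q) pbundle \<Rightarrow> ('p \<Rightarrow> 'e \<Rightarrow> 'k) \<Rightarrow> 'm set" where
  "ad_support P \<eta> = closure (bproj P ` {p. \<exists>u. \<eta> p u \<noteq> 0})"

text \<open>\<open>A + t\<eta>\<close>.\<close>

definition shift_connection ::
    "('m, 'e::real_normed_vector, 'g, 'k::real_normed_vector, 'p, 'q::real_normed_vector) pbundle \<Rightarrow>
     ('p \<Rightarrow> 'q \<Rightarrow> 'k) \<Rightarrow> real \<Rightarrow> ('p \<Rightarrow> 'e \<Rightarrow> 'k) \<Rightarrow> 'p \<Rightarrow> 'q \<Rightarrow> 'k" where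
  "shift_connection P A t \<eta> p w = A p w + t *\<^sub>R \<eta> p (dproj P p w)"

text \<open>\<open>[\<alpha>, \<beta>]\<close> for 1-forms on \<open>P\<close> with values in the Lie algebra.\<close>

definition bracket_form ::
    "('m, 'e, 'g, 'k::real_normed_vector, 'p, 'q) pbundle \<Rightarrow>
     ('p \<Rightarrow> 'q \<Rightarrow> 'k) \<Rightarrow> ('p \<Rightarrow> 'q \<Rightarrow> 'k) \<Rightarrow> 'p \<Rightarrow> 'q \<Rightarrow> 'q \<Rightarrow> 'k" where
  "bracket_form P \<alpha> \<beta> p w z = bracket P (\<alpha> p w) (\<beta> p z) - bracket P (\<alpha> p z) (\<beta> p w)"

definition curvature_form ::
    "('m, 'e, 'g, 'k::real_normed_vector, 'p, 'q::real_normed_vector) pbundle \<Rightarrow>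
     ('p \<Rightarrow> 'q \<Rightarrow> 'k) \<Rightarrow> 'p \<Rightarrow> 'q \<Rightarrow> 'q \<Rightarrow> 'k" where
  "curvature_form P A p w z = ext_d1 (total_atlas P) A p w z + (1 / 2) *\<^sub>R bracket_form P A A p w z"

definition horizontal_lift ::
    "('m, 'e::real_normed_vector, 'g, 'k::real_normed_vector, 'p, 'q::real_normed_vector) pbundle \<Rightarrow>
     ('p \<Rightarrow> 'q \<Rightarrow> 'k) \<Rightarrow> 'p \<Rightarrow> 'e \<Rightarrow> 'q" where
  "horizontal_lift P A p u = (THE w. dproj P p w = u \<and> A p w = 0)"

text \<open>\<open>F\<^sup>A\<close> as a 2-form on \<open>M\<close> with values in \<open>ad P\<close>: the form whose pull-back to \<open>P\<close> is the (horizontal)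
  curvature form.\<close>

definition curvature ::
    "('m, 'e::real_normed_vector, 'g, 'k::real_normed_vector, 'p, 'q::real_normed_vector) pbundle \<Rightarrow>
     ('p \<Rightarrow> 'q \<Rightarrow> 'k) \<Rightarrow> 'p \<Rightarrow> 'e \<Rightarrow> 'e \<Rightarrow> 'k" where
  "curvature P A p u v = curvature_form P A p (horizontal_lift P A p u) (horizontal_lift P A p v)"


section \<open>Pointwise linear algebra of Lie algebra valued 2-forms\<close>

definition orthonormal_frame :: "('e::real_vector \<Rightarrow> 'e \<Rightarrow> real) \<Rightarrow> 'e set" where
  "orthonormal_frame h = (SOME B. finite B \<and> span B = UNIV \<and>
     (\<forall>u\<in>B. \<forall>v\<in>B. h u v = (if u = v then 1 else 0)))"

text \<open>The inner product on 2-forms for which the \<open>e\<^sub>i \<and> e\<^sub>j\<close> with \<open>i < j\<close> are orthonormal; the factor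
  \<open>1 / 2\<close> is due to the sum over all pairs.  It does not depend on the frame.\<close>

definition inner_2form ::
    "('e::real_vector \<Rightarrow> 'e \<Rightarrow> real) \<Rightarrow> ('k \<Rightarrow> 'k \<Rightarrow> real) \<Rightarrow> ('e \<Rightarrow> 'e \<Rightarrow> 'k) \<Rightarrow> ('e \<Rightarrow> 'e \<Rightarrow> 'k) \<Rightarrow> real" where
  "inner_2form h ip \<alpha> \<beta> =
     (1 / 2) * (\<Sum>u\<in>orthonormal_frame h. \<Sum>v\<in>orthonormal_frame h. ip (\<alpha> u v) (\<beta> u v))"

definition Lop :: "('e \<Rightarrow> 'e \<Rightarrow> real) \<Rightarrow> 'k::real_vector \<Rightarrow> 'e \<Rightarrow> 'e \<Rightarrow> 'k" where
  "Lop w X = (\<lambda>u v. w u v *\<^sub>R X)"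

text \<open>\<open>\<Lambda>\<close>, the adjoint of \<open>L = \<omega> \<and> _\<close> on 0-forms, where \<open>L\<close> is \<open>Lop\<close>.\<close>

definition Lambda ::
    "('e::real_vector \<Rightarrow> 'e \<Rightarrow> real) \<Rightarrow> ('k::real_vector \<Rightarrow> 'k \<Rightarrow> real) \<Rightarrow> ('e \<Rightarrow> 'e \<Rightarrow> real) \<Rightarrow>
     ('e \<Rightarrow> 'e \<Rightarrow> 'k) \<Rightarrow> 'k" where
  "Lambda h ip w \<alpha> = (THE Y. \<forall>X. ip Y X = inner_2form h ip \<alpha> (Lop w X))"


section \<open>The functionals\<close>

definition Phi ::
    "('m, 'e::real_normed_vector, 'g, 'k::real_normed_vector, 'p, 'q::real_normed_vector) pbundle \<Rightarrow> nat \<Rightarrow>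
     ('m \<Rightarrow> 'e \<Rightarrow> 'e \<Rightarrow> real) \<Rightarrow> ('m \<Rightarrow> 'e \<Rightarrow> 'e \<Rightarrow> real) \<Rightarrow> ('k \<Rightarrow> 'k \<Rightarrow> real) \<Rightarrow>
     ('p \<Rightarrow> 'q \<Rightarrow> 'k) \<Rightarrow> 'p \<Rightarrow> 'k" where
  "Phi P n \<omega> g ip A p = (1 / real n) *\<^sub>R Lambda (g (bproj P p)) ip (\<omega> (bproj P p)) (curvature P A p)"

definition Phi_omega ::
    "('m, 'e::real_normed_vector, 'g, 'k::real_normed_vector, 'p, 'q::real_normed_vector) pbundle \<Rightarrow> nat \<Rightarrow>
     ('m \<Rightarrow> 'e \<Rightarrow> 'e \<Rightarrow> real) \<Rightarrow> ('m \<Rightarrow> 'e \<Rightarrow> 'e \<Rightarrow> real) \<Rightarrow> ('k \<Rightarrow> 'k \<Rightarrow> real) \<Rightarrow>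
     ('p \<Rightarrow> 'q \<Rightarrow> 'k) \<Rightarrow> 'p \<Rightarrow> 'e \<Rightarrow> 'e \<Rightarrow> 'k" where
  "Phi_omega P n \<omega> g ip A p = Lop (\<omega> (bproj P p)) (Phi P n \<omega> g ip A p)"

definition primitive_curvature ::
    "('m, 'e::real_normed_vector, 'g, 'k::real_normed_vector, 'p, 'q::real_normed_vector) pbundle \<Rightarrow> nat \<Rightarrow>
     ('m \<Rightarrow> 'e \<Rightarrow> 'e \<Rightarrow> real) \<Rightarrow> ('m \<Rightarrow> 'e \<Rightarrow> 'e \<Rightarrow> real) \<Rightarrow> ('k \<Rightarrow> 'k \<Rightarrow> real) \<Rightarrow>
     ('p \<Rightarrow> 'q \<Rightarrow> 'k) \<Rightarrow> 'p \<Rightarrow> 'e \<Rightarrow> 'e \<Rightarrow> 'k" where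
  "primitive_curvature P n \<omega> g ip A p u v = curvature P A p u v - Phi_omega P n \<omega> g ip A p u v"

text \<open>\<open>|\<alpha>|\<^sup>2\<close> at \<open>x\<close>; by Ad-invariance of the inner product the choice of the point of the fibre is
  immaterial for equivariant \<open>\<alpha>\<close>.\<close>

definition norm_sq_2form ::
    "('m, 'e::real_vector, 'g, 'k, 'p, 'q) pbundle \<Rightarrow>
     ('m \<Rightarrow> 'e \<Rightarrow> 'e \<Rightarrow> real) \<Rightarrow> ('k \<Rightarrow> 'k \<Rightarrow> real) \<Rightarrow> ('p \<Rightarrow> 'e \<Rightarrow> 'e \<Rightarrow> 'k) \<Rightarrow> 'm \<Rightarrow> real" where
  "norm_sq_2form P g ip \<alpha> x = (let p = (SOME p. bproj P p = x) in inner_2form (g x) ip (\<alpha> p) (\<alpha> p))"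

text \<open>\<open>A\<close> is a critical solution of \<open>A \<mapsto> \<parallel>\<Psi> A\<parallel>\<^sup>2\<close>.\<close>

definition critical ::
    "('m::topological_space, 'e::real_normed_vector, 'g, 'k::real_normed_vector, 'p, 'q::real_normed_vector) pbundle \<Rightarrow>
     ('m \<Rightarrow> 'e \<Rightarrow> 'e \<Rightarrow> real) \<Rightarrow> ('k \<Rightarrow> 'k \<Rightarrow> real) \<Rightarrow> 'm measure \<Rightarrow>
     (('p \<Rightarrow> 'q \<Rightarrow> 'k) \<Rightarrow> 'p \<Rightarrow> 'e \<Rightarrow> 'e \<Rightarrow> 'k) \<Rightarrow> ('p \<Rightarrow> 'q \<Rightarrow> 'k) \<Rightarrow> bool" where
  "critical P g ip vol \<Psi> A \<longleftrightarrow>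
     (\<forall>\<eta> K. ad_1form P \<eta> \<and> compact (ad_support P \<eta>) \<and> compact K \<and> ad_support P \<eta> \<subseteq> K \<longrightarrow>
        ((\<lambda>t. LINT x:K|vol. norm_sq_2form P g ip (\<Psi> (shift_connection P A t \<eta>)) x)
           has_real_derivative 0) (at 0))"

end

theory Submission
  imports Defs
begin

text \<open>At every point, and for every connection, the decomposition \<open>F = F\<^sub>p + \<Phi> \<omega>\<close> is orthogonal.  Indeed \<open>\<Lambda>\<close> is the
adjoint of \<open>L\<close> and \<open>\<Lambda> F = n \<Phi>\<close>, so \<open>\<langle>F, \<Phi> \<omega>\<rangle> = \<langle>\<Lambda> F, \<Phi>\<rangle> = n |\<Phi>|\<^sup>2\<close>, while compatibility of \<open>\<omega>\<close> and \<open>g\<close> gives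
\<open>|\<omega>|\<^sup>2 = n\<close> and hence \<open>|\<Phi> \<omega>|\<^sup>2 = n |\<Phi>|\<^sup>2\<close> as well.  Thus \<open>|F|\<^sup>2 = |F\<^sub>p|\<^sup>2 + |\<Phi> \<omega>|\<^sup>2\<close>
(\<open>primitive_decomposition_norm\<close>).  Integrated over a compact set, for each connection \<open>A + t \<eta>\<close> of a
variation, this says that the first functional is the sum of the other two as a function of \<open>t\<close>.
If two of three functions of which one is the sum of the others have derivative zero, so has the
third.

Splitting the integral of a sum needs integrability, and this is where the work lies.  The energy
densities are integrable over compact sets because they are continuous
(\<open>norm_sq_continuous\<close>) and the Liouville measure is finite on compact sets
(\<open>liouville_measure_compact_finite\<close>).  Continuity is not visible from the definitions, because they
rest on arbitrary pointwise choices: a chart at each point, a point in each fibre of \<open>P\<close>, an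
orthonormal frame of each tangent space.  Each choice has to be shown to be immaterial.  For the
chart, the reason is that the exterior derivative commutes with pull-back
(\<open>flat_d_pullback\<close>), which in turn is the symmetry of second derivatives; for the point of the fibre,
it is the equivariance of the curvature (\<open>curvature_equivariant\<close>), again by naturality of \<open>d\<close>, and the
Ad-invariance of the inner product; for the frame, it is the invariance of traces
(\<open>frame_double_trace_eq\<close>).  The density can then be computed near a given point in one chart, along one
smooth local section of \<open>P\<close> and with a frame that the Gram-Schmidt process makes continuous.

On horizontal vectors the term \<open>[A, A]\<close> of the curvature vanishes, so \<open>F(u, v)\<close> is \<open>dA\<close> on the horizontal
lifts of \<open>u\<close> and \<open>v\<close>.  Along a local section \<open>s\<close> the horizontal lift is explicit: it is \<open>ds(u)\<close> minus the
fundamental vector generated by \<open>A(ds(u))\<close> (\<open>horizontal_lift_section\<close>).\<close>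

section \<open>Finite-dimensional normed spaces\<close>

text \<open>Finite dimension in the form of a finite family of vectors whose coordinate functionals are
bounded.  That the coordinates are bounded is what the continuity arguments below use; for the Lie
algebra an inner product provides it, for the total space of the bundle a local trivialisation.\<close>

definition fin_dim :: "'a::real_normed_vector itself \<Rightarrow> bool" where
  "fin_dim _ \<longleftrightarrow> (\<exists>L::(('a \<Rightarrow> real) \<times> 'a) list.
     (\<forall>(\<phi>, e)\<in>set L. bounded_linear \<phi>) \<and> (\<forall>w. (\<Sum>(\<phi>, e)\<leftarrow>L. \<phi> w *\<^sub>R e) = w))"

lemma fin_dimE:
  assumes "fin_dim TYPE('a::real_normed_vector)"
  obtains m :: nat and \<phi> :: "nat \<Rightarrow> 'a::real_normed_vector \<Rightarrow> real" and e :: "nat \<Rightarrow> 'a::real_normed_vector"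
  where "\<And>i. i < m \<Longrightarrow> bounded_linear (\<phi> i)" "\<And>w. (\<Sum>i<m. \<phi> i w *\<^sub>R e i) = w"
proof -
  obtain L :: "(('a \<Rightarrow> real) \<times> 'a) list" where
    L: "\<forall>(\<phi>, e)\<in>set L. bounded_linear \<phi>" "\<And>w. (\<Sum>(\<phi>, e)\<leftarrow>L. \<phi> w *\<^sub>R e) = w"
    using assms unfolding fin_dim_def by blast
  show thesis
  proof (rule that)
    show "bounded_linear (fst (L ! i))" if "i < length L" for i
      using L(1) nth_mem[OF that] by (auto simp: case_prod_beta)
    show "(\<Sum>i<length L. fst (L ! i) w *\<^sub>R snd (L ! i)) = w" for w
      using L(2)[of w] by (simp add: sum_list_sum_nth atLeast0LessThan case_prod_beta)
  qed
qed

lemma fin_dimI: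
  assumes "finite I" "\<And>i. i \<in> I \<Longrightarrow> bounded_linear (\<phi> i)" "\<And>w. (\<Sum>i\<in>I. \<phi> i w *\<^sub>R e i) = (w::'a::real_normed_vector)"
  shows "fin_dim TYPE('a)"
proof -
  obtain xs where xs: "set xs = I" "distinct xs"
    using finite_distinct_list[OF assms(1)] by blast
  have "(\<Sum>(\<phi>, e)\<leftarrow>map (\<lambda>i. (\<phi> i, e i)) xs. \<phi> w *\<^sub>R e) = w" for w
    using assms(3)[of w] sum_list_distinct_conv_sum_set[OF xs(2), of "\<lambda>i. \<phi> i w *\<^sub>R e i"] xs(1)
    by (simp add: o_def)
  moreover have "\<forall>(\<phi>, e)\<in>set (map (\<lambda>i. (\<phi> i, e i)) xs). bounded_linear \<phi>"
    using assms(2) xs by auto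
  ultimately show ?thesis
    unfolding fin_dim_def by blast
qed

lemma fin_dim_euclidean: "fin_dim TYPE('a::euclidean_space)"
  by (rule fin_dimI[of Basis "\<lambda>b w. w \<bullet> b" "\<lambda>b. b"])
     (auto simp: euclidean_representation intro: bounded_linear_inner_left)

lemma fin_dim_prod:
  assumes "fin_dim TYPE('a::real_normed_vector)" "fin_dim TYPE('b::real_normed_vector)"
  shows "fin_dim TYPE('a \<times> 'b)"
proof -
  obtain m and \<phi> :: "nat \<Rightarrow> 'a \<Rightarrow> real" and e where
    1: "\<And>i. i < m \<Longrightarrow> bounded_linear (\<phi> i)" "\<And>w. (\<Sum>i<m. \<phi> i w *\<^sub>R e i) = w"
    by (rule fin_dimE[OF assms(1)]) (rule that)
  obtain n and \<xi> :: "nat \<Rightarrow> 'b \<Rightarrow> real" and f where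
    2: "\<And>i. i < n \<Longrightarrow> bounded_linear (\<xi> i)" "\<And>w. (\<Sum>i<n. \<xi> i w *\<^sub>R f i) = w"
    by (rule fin_dimE[OF assms(2)]) (rule that)
  define \<theta> where "\<theta> = case_sum (\<lambda>i (w::'a\<times>'b). \<phi> i (fst w)) (\<lambda>i w. \<xi> i (snd w))"
  define k where "k = case_sum (\<lambda>i. (e i, 0)) (\<lambda>i. (0, f i))"
  show ?thesis
  proof (rule fin_dimI[of "{..<m} <+> {..<n}" \<theta> k])
    show "bounded_linear (\<theta> i)" if "i \<in> {..<m} <+> {..<n}" for i
      using that bounded_linear_compose[OF 1(1) bounded_linear_fst]
        bounded_linear_compose[OF 2(1) bounded_linear_snd]
      by (auto simp: \<theta>_def)
    fix w :: "'a \<times> 'b"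
    have "(\<Sum>i\<in>{..<m} <+> {..<n}. \<theta> i w *\<^sub>R k i) =
       (\<Sum>i<m. \<phi> i (fst w) *\<^sub>R (e i, 0)) + (\<Sum>i<n. \<xi> i (snd w) *\<^sub>R (0, f i))"
      by (simp add: sum.Plus \<theta>_def k_def)
    also have "\<dots> = w"
      by (rule prod_eqI) (simp_all add: fst_sum snd_sum 1(2) 2(2))
    finally show "(\<Sum>i\<in>{..<m} <+> {..<n}. \<theta> i w *\<^sub>R k i) = w" .
  qed simp
qed

lemma fin_dim_retract:
  fixes f :: "'a::real_normed_vector \<Rightarrow> 'b::real_normed_vector"
  assumes "fin_dim TYPE('a)" "linear f" "bounded_linear g" "\<And>w. f (g w) = w"
  shows "fin_dim TYPE('b)"
proof -
  obtain m and \<phi> :: "nat \<Rightarrow> 'a \<Rightarrow> real" and e where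
    1: "\<And>i. i < m \<Longrightarrow> bounded_linear (\<phi> i)" "\<And>w. (\<Sum>i<m. \<phi> i w *\<^sub>R e i) = w"
    by (rule fin_dimE[OF assms(1)]) (rule that)
  have "(\<Sum>i<m. \<phi> i (g w) *\<^sub>R f (e i)) = w" for w
    using arg_cong[OF 1(2)[of "g w"], of f] assms(4)[of w]
    by (simp add: linear_sum[OF assms(2)] linear_scale[OF assms(2)])
  then show ?thesis
    by (intro fin_dimI[of "{..<m}" "\<lambda>i w. \<phi> i (g w)" "\<lambda>i. f (e i)"])
       (auto intro: bounded_linear_compose 1(1) assms(3))
qed

text \<open>Continuity of a family of linear maps is only ever known for each fixed vector.  Expanding a
continuously varying vector in coordinates turns this into joint continuity; likewise for
derivatives.\<close>

lemma fin_dim_continuous_on_eval: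
  fixes f :: "'b::topological_space \<Rightarrow> 'a::real_normed_vector \<Rightarrow> 'c::real_normed_vector"
  assumes fd: "fin_dim TYPE('a)" and lin: "\<And>y. y \<in> S \<Longrightarrow> linear (f y)"
    and f: "\<And>v. continuous_on S (\<lambda>y. f y v)" and w: "continuous_on S w"
  shows "continuous_on S (\<lambda>y. f y (w y))"
proof -
  obtain m and \<phi> :: "nat \<Rightarrow> 'a \<Rightarrow> real" and e where
    1: "\<And>i. i < m \<Longrightarrow> bounded_linear (\<phi> i)" "\<And>w. (\<Sum>i<m. \<phi> i w *\<^sub>R e i) = w"
    by (rule fin_dimE[OF fd]) (rule that)
  have "f y (w y) = (\<Sum>i<m. \<phi> i (w y) *\<^sub>R f y (e i))" if "y \<in> S" for y
    using arg_cong[OF 1(2)[of "w y"], of "f y"] lin[OF that]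
    by (simp add: linear_sum linear_scale)
  moreover have "continuous_on S (\<lambda>y. \<Sum>i<m. \<phi> i (w y) *\<^sub>R f y (e i))"
    by (intro continuous_intros f bounded_linear.continuous_on[OF 1(1) w]) auto
  ultimately show ?thesis
    by (simp cong: continuous_on_cong)
qed

lemma fin_dim_continuous_on_eval2:
  fixes f :: "'b::topological_space \<Rightarrow> 'a::real_normed_vector \<Rightarrow> 'a \<Rightarrow> 'c::real_normed_vector"
  assumes fd: "fin_dim TYPE('a)" and bil: "\<And>y. y \<in> S \<Longrightarrow> bilinear (f y)"
    and f: "\<And>u v. continuous_on S (\<lambda>y. f y u v)" and w: "continuous_on S w" "continuous_on S z"
  shows "continuous_on S (\<lambda>y. f y (w y) (z y))"
proof (rule fin_dim_continuous_on_eval[OF fd _ _ w(2), where f = "\<lambda>y. f y (w y)"])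
  show "linear (f y (w y))" if "y \<in> S" for y using bil[OF that] by (simp add: bilinear_def)
  show "continuous_on S (\<lambda>y. f y (w y) v)" for v
    by (rule fin_dim_continuous_on_eval[OF fd _ f w(1)]) (use bil in \<open>simp add: bilinear_def\<close>)
qed

lemma fin_dim_has_derivative_eval:
  fixes f :: "'b::real_normed_vector \<Rightarrow> 'a::real_normed_vector \<Rightarrow> 'c::real_normed_vector"
  assumes fd: "fin_dim TYPE('a)" and S: "open S" "y \<in> S" and lin: "\<And>y. y \<in> S \<Longrightarrow> linear (f y)"
    and f: "\<And>v. ((\<lambda>y. f y v) has_derivative F v) (at y)" and w: "(w has_derivative w') (at y)"
  shows "((\<lambda>y. f y (w y)) has_derivative (\<lambda>h. f y (w' h) + F (w y) h)) (at y)"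
proof -
  obtain m and \<phi> :: "nat \<Rightarrow> 'a \<Rightarrow> real" and e where
    1: "\<And>i. i < m \<Longrightarrow> bounded_linear (\<phi> i)" "\<And>w. (\<Sum>i<m. \<phi> i w *\<^sub>R e i) = w"
    by (rule fin_dimE[OF fd]) (rule that)
  have ex: "f y v = (\<Sum>i<m. \<phi> i v *\<^sub>R f y (e i))" if "y \<in> S" for y v
    using arg_cong[OF 1(2)[of v], of "f y"] lin[OF that]
    by (simp add: linear_sum linear_scale)
  have "((\<lambda>y. \<Sum>i<m. \<phi> i v *\<^sub>R f y (e i)) has_derivative (\<lambda>h. \<Sum>i<m. \<phi> i v *\<^sub>R F (e i) h)) (at y)" for v
    by (intro derivative_intros f)
  then have "((\<lambda>y. f y v) has_derivative (\<lambda>h. \<Sum>i<m. \<phi> i v *\<^sub>R F (e i) h)) (at y)" for v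
    by (rule has_derivative_transform_within_open[OF _ S]) (use ex in auto)
  then have F: "F v = (\<lambda>h. \<Sum>i<m. \<phi> i v *\<^sub>R F (e i) h)" for v
    using has_derivative_unique f by blast
  have "((\<lambda>y. \<Sum>i<m. \<phi> i (w y) *\<^sub>R f y (e i)) has_derivative
     (\<lambda>h. \<Sum>i<m. \<phi> i (w y) *\<^sub>R F (e i) h + \<phi> i (w' h) *\<^sub>R f y (e i))) (at y)"
    by (intro has_derivative_sum has_derivative_scaleR f bounded_linear.has_derivative[OF 1(1) w]) auto
  then have "((\<lambda>y. f y (w y)) has_derivative
     (\<lambda>h. \<Sum>i<m. \<phi> i (w y) *\<^sub>R F (e i) h + \<phi> i (w' h) *\<^sub>R f y (e i))) (at y)"
    by (rule has_derivative_transform_within_open[OF _ S]) (use ex in auto)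
  moreover have "(\<lambda>h. \<Sum>i<m. \<phi> i (w y) *\<^sub>R F (e i) h + \<phi> i (w' h) *\<^sub>R f y (e i)) =
      (\<lambda>h. f y (w' h) + F (w y) h)"
    by (subst F[of "w y"], subst ex[OF S(2), of "w' h" for h]) (simp add: sum.distrib add.commute)
  ultimately show ?thesis by simp
qed

section \<open>Functions of class \<open>C\<^sup>k\<close>\<close>

lemma Ck_on_cong:
  assumes "open S" "\<And>x. x \<in> S \<Longrightarrow> f x = g x"
  shows "Ck_on k S f \<longleftrightarrow> Ck_on k S g"
  using assms(2)
proof (induction k arbitrary: f g)
  case 0
  then show ?case by (simp cong: continuous_on_cong)
next
  case (Suc k)
  have d: "(f has_derivative D) (at x) \<longleftrightarrow> (g has_derivative D) (at x)" if "x \<in> S" for x D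
    using has_derivative_transform_within_open[OF _ assms(1) that, of f D UNIV g]
      has_derivative_transform_within_open[OF _ assms(1) that, of g D UNIV f] Suc.prems by auto
  have fd: "frechet_derivative f (at x) = frechet_derivative g (at x)" if "x \<in> S" for x
    unfolding frechet_derivative_def using d[OF that] by simp
  have "Ck_on k S (\<lambda>x. frechet_derivative f (at x) v) \<longleftrightarrow> Ck_on k S (\<lambda>x. frechet_derivative g (at x) v)" for v
    by (rule Suc.IH) (simp add: fd)
  then show ?case
    by (simp add: differentiable_def d)
qed

lemma Ck_on_imp_continuous: "Ck_on k S f \<Longrightarrow> continuous_on S f"
  by (cases k) (auto intro!: continuous_at_imp_continuous_on differentiable_imp_continuous_within)

lemma Ck_on_has_derivative:
  "Ck_on (Suc k) S f \<Longrightarrow> x \<in> S \<Longrightarrow> (f has_derivative frechet_derivative f (at x)) (at x)"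
  by (simp add: frechet_derivative_works)

lemma Ck_on_linear:
  assumes "open S" "Ck_on k S f" "bounded_linear L"
  shows "Ck_on k S (\<lambda>x. L (f x))"
  using assms(2)
proof (induction k arbitrary: f)
  case 0
  then show ?case by (auto intro: bounded_linear.continuous_on[OF assms(3)])
next
  case (Suc k)
  have d: "((\<lambda>x. L (f x)) has_derivative (\<lambda>h. L (frechet_derivative f (at x) h))) (at x)" if "x \<in> S" for x
    by (rule bounded_linear.has_derivative[OF assms(3) Ck_on_has_derivative[OF Suc.prems that]])
  have "Ck_on k S (\<lambda>x. frechet_derivative (\<lambda>x. L (f x)) (at x) v)" for v
    using Ck_on_cong[OF assms(1), of _ "\<lambda>x. L (frechet_derivative f (at x) v)"]
       frechet_derivative_at[OF d] Suc by simp metis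
  then show ?case using d by (auto simp: differentiable_def)
qed

lemma Ck_on_add:
  assumes "open S" "Ck_on k S f" "Ck_on k S g"
  shows "Ck_on k S (\<lambda>x. f x + g x)"
  using assms(2,3)
proof (induction k arbitrary: f g)
  case 0
  then show ?case by (simp add: continuous_on_add)
next
  case (Suc k)
  have d: "((\<lambda>x. f x + g x) has_derivative (\<lambda>h. frechet_derivative f (at x) h + frechet_derivative g (at x) h)) (at x)" if "x \<in> S" for x
    by (intro derivative_intros Ck_on_has_derivative[OF Suc.prems(1) that] Ck_on_has_derivative[OF Suc.prems(2) that])
  have "Ck_on k S (\<lambda>x. frechet_derivative (\<lambda>x. f x + g x) (at x) v)" for v
    using Ck_on_cong[OF assms(1), of "\<lambda>x. frechet_derivative (\<lambda>x. f x + g x) (at x) v"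
        "\<lambda>x. frechet_derivative f (at x) v + frechet_derivative g (at x) v" k]
       frechet_derivative_at[OF d, symmetric] Suc by simp
  then show ?case using d by (auto simp: differentiable_def)
qed

text \<open>Applied with the inclusion of a factor of a product, this restricts maps defined on a product to
its slices.\<close>

lemma Ck_on_affine:
  assumes "open S" "Ck_on k S f" and L: "bounded_linear L" and S': "open S'" "\<And>y. y \<in> S' \<Longrightarrow> c + L y \<in> S"
  shows "Ck_on k S' (\<lambda>y. f (c + L y))"
  using assms(2)
proof (induction k arbitrary: f)
  case 0
  then show ?case
    by (auto intro!: continuous_on_compose2[of S f] continuous_intros bounded_linear.continuous_on[OF L] S')
next
  case (Suc k)
  have d: "((\<lambda>y. f (c + L y)) has_derivative (\<lambda>h. frechet_derivative f (at (c + L y)) (L h))) (at y)"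
    if "y \<in> S'" for y
    by (rule has_derivative_compose[where g = f and f = "\<lambda>y. c + L y",
          OF _ Ck_on_has_derivative[OF Suc.prems S'(2)[OF that]]])
       (auto intro!: derivative_eq_intros bounded_linear.has_derivative[OF L])
  have "Ck_on k S' (\<lambda>x. frechet_derivative (\<lambda>y. f (c + L y)) (at x) v)" for v
    using Ck_on_cong[OF S'(1), of "\<lambda>x. frechet_derivative (\<lambda>y. f (c + L y)) (at x) v"
        "\<lambda>x. frechet_derivative f (at (c + L x)) (L v)" k]
       frechet_derivative_at[OF d, symmetric] Suc.IH[of "\<lambda>x. frechet_derivative f (at x) (L v)"] Suc.prems
    by simp
  then show ?case using d by (auto simp: differentiable_def)
qed

section \<open>Symmetry of second derivatives\<close>

text \<open>Two applications of the mean value inequality, first along \<open>u\<close> and then along \<open>v\<close>, bound the deviation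
of the second difference of \<open>f\<close> over a small parallelogram from \<open>s\<^sup>2\<close> times an approximate value \<open>c\<close> of the
second derivative.\<close>

lemma mixed_difference_estimate:
  fixes f :: "'a::real_normed_vector \<Rightarrow> 'b::real_normed_vector"
  assumes f: "\<And>\<sigma> t. 0 \<le> \<sigma> \<Longrightarrow> \<sigma> \<le> s \<Longrightarrow> 0 \<le> t \<Longrightarrow> t \<le> s \<Longrightarrow>
      f differentiable (at (x + \<sigma> *\<^sub>R u + t *\<^sub>R v)) \<and>
      (\<lambda>y. frechet_derivative f (at y) v) differentiable (at (x + \<sigma> *\<^sub>R u + t *\<^sub>R v)) \<and>
      norm (frechet_derivative (\<lambda>y. frechet_derivative f (at y) v) (at (x + \<sigma> *\<^sub>R u + t *\<^sub>R v)) u - c) \<le> \<epsilon>"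
    and s: "0 < s"
  shows "norm (f (x + s *\<^sub>R u + s *\<^sub>R v) - f (x + s *\<^sub>R u) - f (x + s *\<^sub>R v) + f x - (s * s) *\<^sub>R c) \<le> \<epsilon> * (s * s)"
proof -
  define Dv where "Dv = (\<lambda>y. frechet_derivative f (at y) v)"
  define DD where "DD = (\<lambda>y. frechet_derivative Dv (at y) u)"
  have Dv: "((\<lambda>t. f (x + \<sigma> *\<^sub>R u + t *\<^sub>R v)) has_vector_derivative Dv (x + \<sigma> *\<^sub>R u + t *\<^sub>R v)) (at t)"
    if "0 \<le> \<sigma>" "\<sigma> \<le> s" "0 \<le> t" "t \<le> s" for \<sigma> t
  proof -
    have "(f has_derivative frechet_derivative f (at (x + \<sigma> *\<^sub>R u + t *\<^sub>R v))) (at (x + \<sigma> *\<^sub>R u + t *\<^sub>R v))"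
      using f[OF that] frechet_derivative_works by blast
    moreover have "((\<lambda>t. x + \<sigma> *\<^sub>R u + t *\<^sub>R v) has_derivative (\<lambda>h. h *\<^sub>R v)) (at t)"
      by (auto intro!: derivative_eq_intros)
    ultimately have "((\<lambda>t. f (x + \<sigma> *\<^sub>R u + t *\<^sub>R v)) has_derivative
        (\<lambda>h. frechet_derivative f (at (x + \<sigma> *\<^sub>R u + t *\<^sub>R v)) (h *\<^sub>R v))) (at t)"
      using has_derivative_compose by blast
    then show ?thesis
      using f[OF that] by (simp add: has_vector_derivative_def Dv_def linear_scale[OF linear_frechet_derivative])
  qed
  have DD: "((\<lambda>\<sigma>. Dv (x + \<sigma> *\<^sub>R u + t *\<^sub>R v)) has_vector_derivative DD (x + \<sigma> *\<^sub>R u + t *\<^sub>R v)) (at \<sigma>)"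
    if "0 \<le> \<sigma>" "\<sigma> \<le> s" "0 \<le> t" "t \<le> s" for \<sigma> t
  proof -
    have *: "Dv differentiable (at (x + \<sigma> *\<^sub>R u + t *\<^sub>R v))"
      using f[OF that] by (simp add: Dv_def)
    have "(Dv has_derivative frechet_derivative Dv (at (x + \<sigma> *\<^sub>R u + t *\<^sub>R v))) (at (x + \<sigma> *\<^sub>R u + t *\<^sub>R v))"
      using * frechet_derivative_works by blast
    moreover have "((\<lambda>\<sigma>. x + \<sigma> *\<^sub>R u + t *\<^sub>R v) has_derivative (\<lambda>h. h *\<^sub>R u)) (at \<sigma>)"
      by (auto intro!: derivative_eq_intros)
    ultimately have "((\<lambda>\<sigma>. Dv (x + \<sigma> *\<^sub>R u + t *\<^sub>R v)) has_derivative
        (\<lambda>h. frechet_derivative Dv (at (x + \<sigma> *\<^sub>R u + t *\<^sub>R v)) (h *\<^sub>R u))) (at \<sigma>)"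
      using has_derivative_compose by blast
    then show ?thesis
      using * by (simp add: has_vector_derivative_def DD_def linear_scale[OF linear_frechet_derivative])
  qed
  have inner: "norm (Dv (x + s *\<^sub>R u + t *\<^sub>R v) - Dv (x + t *\<^sub>R v) - s *\<^sub>R c) \<le> \<epsilon> * s"
    if t: "0 \<le> t" "t \<le> s" for t
  proof -
    let ?h = "\<lambda>\<sigma>. Dv (x + \<sigma> *\<^sub>R u + t *\<^sub>R v) - \<sigma> *\<^sub>R c"
    have d: "(?h has_vector_derivative DD (x + \<sigma> *\<^sub>R u + t *\<^sub>R v) - c) (at \<sigma>)" if "0 \<le> \<sigma>" "\<sigma> \<le> s" for \<sigma>
      using DD[OF that t] by (auto intro!: derivative_eq_intros)
    have "norm (?h s - ?h 0) \<le> \<epsilon> * s - \<epsilon> * 0"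
    proof (rule differentiable_bound_general[OF s])
      show "continuous_on {0..s} ?h"
        using d by (auto intro!: continuous_at_imp_continuous_on has_vector_derivative_continuous)
      show "continuous_on {0..s} ((*) \<epsilon>)" by (intro continuous_intros)
      show "((*) \<epsilon> has_vector_derivative \<epsilon>) (at t)" for t
        by (auto intro!: derivative_eq_intros)
      show "norm (DD (x + \<sigma> *\<^sub>R u + t *\<^sub>R v) - c) \<le> \<epsilon>" if "0 < \<sigma>" "\<sigma> < s" for \<sigma>
        using f[of \<sigma> t] that t by (simp add: DD_def Dv_def)
    qed (use d in auto)
    then show ?thesis by (simp add: algebra_simps)
  qed
  let ?k = "\<lambda>t. f (x + s *\<^sub>R u + t *\<^sub>R v) - f (x + t *\<^sub>R v) - (s * t) *\<^sub>R c"
  have d: "(?k has_vector_derivative Dv (x + s *\<^sub>R u + t *\<^sub>R v) - Dv (x + t *\<^sub>R v) - s *\<^sub>R c) (at t)"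
    if "0 \<le> t" "t \<le> s" for t
    using Dv[of s t] Dv[of 0 t] s that by (auto intro!: derivative_eq_intros)
  have "norm (?k s - ?k 0) \<le> \<epsilon> * s * s - \<epsilon> * s * 0"
  proof (rule differentiable_bound_general[OF s])
    show "continuous_on {0..s} ?k"
      using d by (auto intro!: continuous_at_imp_continuous_on has_vector_derivative_continuous)
    show "continuous_on {0..s} ((*) (\<epsilon> * s))" by (intro continuous_intros)
    show "((*) (\<epsilon> * s) has_vector_derivative \<epsilon> * s) (at t)" for t
      by (auto intro!: derivative_eq_intros)
    show "(?k has_vector_derivative Dv (x + s *\<^sub>R u + t *\<^sub>R v) - Dv (x + t *\<^sub>R v) - s *\<^sub>R c) (at t)"
      "norm (Dv (x + s *\<^sub>R u + t *\<^sub>R v) - Dv (x + t *\<^sub>R v) - s *\<^sub>R c) \<le> \<epsilon> * s"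
      if "0 < t" "t < s" for t
      using that by (auto intro: d inner)
  qed
  then show ?thesis by (simp add: algebra_simps)
qed

text \<open>The second difference of \<open>f\<close> over a parallelogram is symmetric in its two sides, and by the previous
estimate it is close to \<open>s\<^sup>2\<close> times either mixed derivative.  So these agree.\<close>

lemma second_derivative_symmetric:
  fixes f :: "'a::real_normed_vector \<Rightarrow> 'b::real_normed_vector"
  assumes S: "open S" "x \<in> S" and f: "Ck_on (Suc (Suc 0)) S f"
  shows "frechet_derivative (\<lambda>y. frechet_derivative f (at y) v) (at x) u =
         frechet_derivative (\<lambda>y. frechet_derivative f (at y) u) (at x) v"
proof (rule ccontr)
  define c where "c = frechet_derivative (\<lambda>y. frechet_derivative f (at y) v) (at x) u"
  define d where "d = frechet_derivative (\<lambda>y. frechet_derivative f (at y) u) (at x) v"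
  assume "\<not> ?thesis"
  then have "c \<noteq> d" by (simp add: c_def d_def)
  define \<epsilon> where "\<epsilon> = norm (c - d) / 3"
  have \<epsilon>: "\<epsilon> > 0" using \<open>c \<noteq> d\<close> by (simp add: \<epsilon>_def)
  have df: "f differentiable (at y)" "(\<lambda>y. frechet_derivative f (at y) w) differentiable (at y)"
    if "y \<in> S" for y w using f that by auto
  have cont: "((\<lambda>y. frechet_derivative (\<lambda>y. frechet_derivative f (at y) w) (at y) z) \<longlongrightarrow>
      frechet_derivative (\<lambda>y. frechet_derivative f (at y) w) (at x) z) (nhds x)" for w z
    by (rule iffD1[OF tendsto_at_iff_tendsto_nhds])
       (use f S in \<open>auto simp: continuous_on_eq_continuous_at isCont_def\<close>)
  have "\<forall>\<^sub>F y in nhds x. y \<in> S \<and>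
      dist (frechet_derivative (\<lambda>y. frechet_derivative f (at y) v) (at y) u) c < \<epsilon> \<and>
      dist (frechet_derivative (\<lambda>y. frechet_derivative f (at y) u) (at y) v) d < \<epsilon>"
    using S \<epsilon> unfolding c_def d_def
    by (intro eventually_conj eventually_nhds_in_open tendstoD[OF cont])
  then obtain r where r: "r > 0" "\<And>y. dist y x < r \<Longrightarrow> y \<in> S \<and>
      dist (frechet_derivative (\<lambda>y. frechet_derivative f (at y) v) (at y) u) c < \<epsilon> \<and>
      dist (frechet_derivative (\<lambda>y. frechet_derivative f (at y) u) (at y) v) d < \<epsilon>"
    unfolding eventually_nhds_metric by blast
  \<comment> \<open>Small enough for the whole parallelogram with sides \<open>s u\<close> and \<open>s v\<close> to lie in the ball of radius \<open>r\<close>.\<close>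
  define s where "s = r / (2 * (norm u + norm v + 1))"
  have s: "s > 0" using r(1) by (simp add: s_def add_nonneg_pos)
  have near: "dist (x + \<sigma> *\<^sub>R u + t *\<^sub>R v) x < r" if "0 \<le> \<sigma>" "\<sigma> \<le> s" "0 \<le> t" "t \<le> s" for \<sigma> t
  proof -
    have "dist (x + \<sigma> *\<^sub>R u + t *\<^sub>R v) x = norm (\<sigma> *\<^sub>R u + t *\<^sub>R v)"
      by (simp add: dist_norm)
    also have "\<dots> \<le> \<sigma> * norm u + t * norm v"
      using that by (intro norm_triangle_le) simp
    also have "\<dots> \<le> s * norm u + s * norm v"
      using that by (intro add_mono mult_right_mono) auto
    also have "\<dots> < s * (2 * (norm u + norm v + 1))"
      using s by (simp add: algebra_simps add_strict_increasing add_nonneg_pos)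
    also have "\<dots> = r"
    proof -
      have "2 * (norm u + norm v + 1) > 0"
        by (simp add: add_nonneg_pos)
      then show ?thesis by (simp add: s_def)
    qed
    finally show ?thesis .
  qed
  have 1: "norm (f (x + s *\<^sub>R u + s *\<^sub>R v) - f (x + s *\<^sub>R u) - f (x + s *\<^sub>R v) + f x - (s * s) *\<^sub>R c) \<le> \<epsilon> * (s * s)"
    by (rule mixed_difference_estimate[OF _ s], unfold dist_norm[symmetric])
       (blast intro: df less_imp_le dest: near r(2))
  have "norm (f (x + s *\<^sub>R v + s *\<^sub>R u) - f (x + s *\<^sub>R v) - f (x + s *\<^sub>R u) + f x - (s * s) *\<^sub>R d) \<le> \<epsilon> * (s * s)"
  proof (rule mixed_difference_estimate[OF _ s])
    fix \<sigma> t assume *: "0 \<le> \<sigma>" "\<sigma> \<le> s" "0 \<le> t" "t \<le> s"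
    have **: "x + \<sigma> *\<^sub>R v + t *\<^sub>R u = x + t *\<^sub>R u + \<sigma> *\<^sub>R v" by (simp add: algebra_simps)
    show "f differentiable (at (x + \<sigma> *\<^sub>R v + t *\<^sub>R u)) \<and>
      (\<lambda>y. frechet_derivative f (at y) u) differentiable (at (x + \<sigma> *\<^sub>R v + t *\<^sub>R u)) \<and>
      norm (frechet_derivative (\<lambda>y. frechet_derivative f (at y) u) (at (x + \<sigma> *\<^sub>R v + t *\<^sub>R u)) v - d) \<le> \<epsilon>"
      unfolding ** dist_norm[symmetric] using r(2)[OF near[of t \<sigma>]] * by (blast intro: df less_imp_le)
  qed
  then have 2: "norm (f (x + s *\<^sub>R u + s *\<^sub>R v) - f (x + s *\<^sub>R u) - f (x + s *\<^sub>R v) + f x - (s * s) *\<^sub>R d) \<le> \<epsilon> * (s * s)"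
    by (simp add: algebra_simps)
  have "norm ((s * s) *\<^sub>R c - (s * s) *\<^sub>R d) \<le> \<epsilon> * (s * s) + \<epsilon> * (s * s)"
    using norm_triangle_ineq4[of "f (x + s *\<^sub>R u + s *\<^sub>R v) - f (x + s *\<^sub>R u) - f (x + s *\<^sub>R v) + f x - (s * s) *\<^sub>R d"
        "f (x + s *\<^sub>R u + s *\<^sub>R v) - f (x + s *\<^sub>R u) - f (x + s *\<^sub>R v) + f x - (s * s) *\<^sub>R c"] 1 2
    by simp
  then have "(s * s) * norm (c - d) \<le> (s * s) * (2 * \<epsilon>)"
    by (simp add: algebra_simps flip: scaleR_diff_right)
  then have "norm (c - d) \<le> 2 * \<epsilon>" using s by simp
  then show False using \<epsilon> by (simp add: \<epsilon>_def)
qed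

section \<open>The exterior derivative of a 1-form in coordinates\<close>

definition flat_d :: "('a::real_normed_vector \<Rightarrow> 'a \<Rightarrow> 'b::real_normed_vector) \<Rightarrow> 'a \<Rightarrow> 'a \<Rightarrow> 'a \<Rightarrow> 'b" where
  "flat_d \<alpha> y u v = frechet_derivative (\<lambda>y. \<alpha> y v) (at y) u - frechet_derivative (\<lambda>y. \<alpha> y u) (at y) v"

text \<open>Differentiating \<open>\<alpha>\<^sub>\<tau>\<^sub>y(D\<tau>\<^sub>y v)\<close> in the direction \<open>u\<close> produces the expected term and \<open>\<alpha>\<^sub>\<tau>\<^sub>y(D\<^sup>2\<tau>\<^sub>y(u, v))\<close>; the
latter is symmetric in \<open>u\<close> and \<open>v\<close> and cancels upon alternation.\<close>

lemma flat_d_pullback: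
  fixes \<tau> :: "'a::real_normed_vector \<Rightarrow> 'b::real_normed_vector"
  assumes fd: "fin_dim TYPE('b)"
    and S: "open S" "y \<in> S" and \<tau>: "Ck_on (Suc (Suc 0)) S \<tau>"
    and T: "open T" "\<tau> y \<in> T" and lin: "\<And>z. z \<in> T \<Longrightarrow> linear (\<alpha> z)"
    and \<alpha>: "\<And>v. (\<lambda>z. \<alpha> z v) differentiable (at (\<tau> y))"
    and \<beta>: "\<And>y u. y \<in> S \<Longrightarrow> \<tau> y \<in> T \<Longrightarrow> \<beta> y u = \<alpha> (\<tau> y) (frechet_derivative \<tau> (at y) u)"
  shows "(\<lambda>y. \<beta> y v) differentiable (at y)" and
    "flat_d \<beta> y u v = flat_d \<alpha> (\<tau> y) (frechet_derivative \<tau> (at y) u) (frechet_derivative \<tau> (at y) v)"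
proof -
  define D where "D = (\<lambda>y. frechet_derivative \<tau> (at y))"
  define S' where "S' = S \<inter> \<tau> -` T"
  have cont: "continuous_on S \<tau>" using Ck_on_imp_continuous[OF \<tau>] .
  have S': "open S'" "y \<in> S'"
    using continuous_open_preimage[OF cont S(1) T(1)] S T by (auto simp: S'_def)
  have d\<tau>: "(\<tau> has_derivative D y) (at y)"
    unfolding D_def by (rule Ck_on_has_derivative[OF \<tau> S(2)])
  have dD: "((\<lambda>y. D y v) has_derivative frechet_derivative (\<lambda>y. D y v) (at y)) (at y)" for v
    using \<tau> S by (simp add: D_def frechet_derivative_works)
  have d\<alpha>: "((\<lambda>y. \<alpha> (\<tau> y) w) has_derivative (\<lambda>h. frechet_derivative (\<lambda>z. \<alpha> z w) (at (\<tau> y)) (D y h))) (at y)" for w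
    by (rule has_derivative_compose[OF d\<tau>]) (use \<alpha> frechet_derivative_works in blast)
  have d: "((\<lambda>y. \<beta> y v) has_derivative
     (\<lambda>h. \<alpha> (\<tau> y) (frechet_derivative (\<lambda>y. D y v) (at y) h) +
       frechet_derivative (\<lambda>z. \<alpha> z (D y v)) (at (\<tau> y)) (D y h))) (at y)" for v
    by (rule has_derivative_transform_within_open[OF _ S', where f = "\<lambda>y. \<alpha> (\<tau> y) (D y v)"],
        rule fin_dim_has_derivative_eval[OF fd S' _ d\<alpha> dD])
       (use lin \<beta> in \<open>auto simp: S'_def D_def\<close>)
  then show "(\<lambda>y. \<beta> y v) differentiable (at y)"
    by (auto simp: differentiable_def)
  have "frechet_derivative (\<lambda>y. D y v) (at y) u = frechet_derivative (\<lambda>y. D y u) (at y) v"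
    unfolding D_def by (rule second_derivative_symmetric[OF S \<tau>])
  then show "flat_d \<beta> y u v = flat_d \<alpha> (\<tau> y) (frechet_derivative \<tau> (at y) u) (frechet_derivative \<tau> (at y) v)"
    by (simp add: flat_d_def frechet_derivative_at[OF d, symmetric] D_def)
qed

lemma flat_d_bounded_linear:
  assumes "bounded_linear L" "\<And>v. (\<lambda>z. \<alpha> z v) differentiable (at y)"
  shows "flat_d (\<lambda>y u. L (\<alpha> y u)) y u v = L (flat_d \<alpha> y u v)"
proof -
  have "((\<lambda>z. L (\<alpha> z v)) has_derivative (\<lambda>h. L (frechet_derivative (\<lambda>z. \<alpha> z v) (at y) h))) (at y)" for v
    using assms bounded_linear.has_derivative frechet_derivative_works by blast
  from frechet_derivative_at[OF this, symmetric] show ?thesis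
    by (simp add: flat_d_def linear_diff[OF bounded_linear.linear[OF assms(1)]])
qed

lemma flat_d_bilinear:
  assumes S: "open S" "y \<in> S" and lin: "\<And>z. z \<in> S \<Longrightarrow> linear (\<alpha> z)"
    and \<alpha>: "\<And>v. (\<lambda>z. \<alpha> z v) differentiable (at y)"
  shows "bilinear (flat_d \<alpha> y)"
proof -
  have d: "((\<lambda>z. \<alpha> z v) has_derivative frechet_derivative (\<lambda>z. \<alpha> z v) (at y)) (at y)" for v
    using \<alpha> frechet_derivative_works by blast
  have 1: "linear (frechet_derivative (\<lambda>z. \<alpha> z v) (at y))" for v
    using d has_derivative_linear by blast
  have 2: "linear (\<lambda>v. frechet_derivative (\<lambda>z. \<alpha> z v) (at y) u)" for u
  proof (rule linearI)
    fix v w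
    have "((\<lambda>z. \<alpha> z (v + w)) has_derivative
        (\<lambda>u. frechet_derivative (\<lambda>z. \<alpha> z v) (at y) u + frechet_derivative (\<lambda>z. \<alpha> z w) (at y) u)) (at y)"
      by (rule has_derivative_transform_within_open[OF has_derivative_add[OF d d] S])
         (simp add: linear_add[OF lin])
    from frechet_derivative_at[OF this]
    show "frechet_derivative (\<lambda>z. \<alpha> z (v + w)) (at y) u =
       frechet_derivative (\<lambda>z. \<alpha> z v) (at y) u + frechet_derivative (\<lambda>z. \<alpha> z w) (at y) u"
      by (simp add: fun_eq_iff)
  next
    fix r v
    have "((\<lambda>z. \<alpha> z (r *\<^sub>R v)) has_derivative
        (\<lambda>u. r *\<^sub>R frechet_derivative (\<lambda>z. \<alpha> z v) (at y) u)) (at y)"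
      by (rule has_derivative_transform_within_open[OF has_derivative_scaleR_right[OF d] S])
         (simp add: linear_scale[OF lin])
    from frechet_derivative_at[OF this]
    show "frechet_derivative (\<lambda>z. \<alpha> z (r *\<^sub>R v)) (at y) u = r *\<^sub>R frechet_derivative (\<lambda>z. \<alpha> z v) (at y) u"
      by (simp add: fun_eq_iff)
  qed
  show ?thesis
    unfolding bilinear_def flat_d_def by (auto intro!: linear_compose_sub 1 2)
qed

section \<open>Orthonormal bases of a varying inner product\<close>

definition orthonormal_basis :: "('e::real_vector \<Rightarrow> 'e \<Rightarrow> real) \<Rightarrow> 'e set \<Rightarrow> bool" where
  "orthonormal_basis h B \<longleftrightarrow> finite B \<and> span B = UNIV \<and> (\<forall>u\<in>B. \<forall>v\<in>B. h u v = (if u = v then 1 else 0))"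

lemma orthonormal_basis_orthonormal_frame:
  assumes "orthonormal_basis h B"
  shows "orthonormal_basis h (orthonormal_frame h)"
  using someI[of "\<lambda>B. finite B \<and> span B = UNIV \<and> (\<forall>u\<in>B. \<forall>v\<in>B. h u v = (if u = v then 1 else 0))" B] assms
  unfolding orthonormal_basis_def orthonormal_frame_def by blast

lemma frame_expand:
  assumes B: "orthonormal_basis h B" and lin: "bilinear h"
  shows "(\<Sum>b\<in>B. h u b *\<^sub>R b) = u"
proof -
  have fin: "finite B" and "u \<in> span B" using B by (auto simp: orthonormal_basis_def)
  then obtain c where c: "u = (\<Sum>b\<in>B. c b *\<^sub>R b)"
    by (auto simp: span_finite)
  have "h u b = c b" if "b \<in> B" for b
  proof -
    have "h u b = (\<Sum>a\<in>B. c a * h a b)"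
      using lin by (simp add: c bilinear_def linear_sum[of "\<lambda>x. h x b"] linear_scale[of "\<lambda>x. h x b"])
    also have "\<dots> = (\<Sum>a\<in>B. if a = b then c a else 0)"
      using B that by (intro sum.cong) (auto simp: orthonormal_basis_def)
    finally show ?thesis using fin that by (simp add: sum.delta)
  qed
  then show ?thesis by (simp add: c)
qed

lemma frame_parseval:
  assumes B: "orthonormal_basis h B" and lin: "bilinear h" and sym: "\<And>u v. h u v = h v u"
  shows "(\<Sum>b\<in>B. h b u * h b v) = h u v"
proof -
  have "h u v = h (\<Sum>b\<in>B. h u b *\<^sub>R b) v"
    by (simp add: frame_expand[OF B lin])
  also have "\<dots> = (\<Sum>b\<in>B. h u b * h b v)"
    using lin by (simp add: bilinear_def linear_sum[of "\<lambda>x. h x v"] linear_scale[of "\<lambda>x. h x v"])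
  finally show ?thesis by (simp add: sym)
qed

text \<open>Expanding the vectors of \<open>B\<close> in \<open>B'\<close>, Parseval's identity collapses the sum over \<open>B\<close>.\<close>

lemma frame_trace_eq:
  assumes B: "orthonormal_basis h B" and B': "orthonormal_basis h B'"
    and lin: "bilinear h" and sym: "\<And>u v. h u v = h v u"
    and f: "bilinear f"
  shows "(\<Sum>b\<in>B. f b b) = (\<Sum>b\<in>B'. f b b)"
proof -
  have fin: "finite B'" using B' by (simp add: orthonormal_basis_def)
  have f1: "linear (\<lambda>x. f x y)" and f2: "linear (f x)" for x y
    using f by (auto simp: bilinear_def)
  have "f b b = (\<Sum>p\<in>B'. \<Sum>q\<in>B'. (h b p * h b q) *\<^sub>R f p q)" for b
  proof -
    have "f b b = f (\<Sum>p\<in>B'. h b p *\<^sub>R p) (\<Sum>q\<in>B'. h b q *\<^sub>R q)"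
      by (simp add: frame_expand[OF B' lin])
    also have "\<dots> = (\<Sum>p\<in>B'. \<Sum>q\<in>B'. (h b p * h b q) *\<^sub>R f p q)"
      by (simp add: linear_sum[OF f1] linear_scale[OF f1] linear_sum[OF f2] linear_scale[OF f2] scaleR_sum_right)
        (subst sum.swap, simp add: mult.commute)
    finally show ?thesis .
  qed
  then have "(\<Sum>b\<in>B. f b b) = (\<Sum>b\<in>B. \<Sum>p\<in>B'. \<Sum>q\<in>B'. (h b p * h b q) *\<^sub>R f p q)"
    by simp
  also have "\<dots> = (\<Sum>p\<in>B'. \<Sum>q\<in>B'. \<Sum>b\<in>B. (h b p * h b q) *\<^sub>R f p q)"
    by (subst sum.swap) (intro sum.cong refl sum.swap)
  also have "\<dots> = (\<Sum>p\<in>B'. \<Sum>q\<in>B'. h p q *\<^sub>R f p q)"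
    by (simp add: frame_parseval[OF B lin sym] flip: scaleR_sum_left)
  also have "\<dots> = (\<Sum>p\<in>B'. \<Sum>q\<in>B'. if p = q then f p q else 0)"
    using B' by (intro sum.cong refl) (auto simp: orthonormal_basis_def)
  also have "\<dots> = (\<Sum>p\<in>B'. f p p)"
    using fin by (simp add: sum.delta')
  finally show ?thesis .
qed

lemma frame_double_trace_eq:
  assumes B: "orthonormal_basis h B" and B': "orthonormal_basis h B'"
    and lin: "bilinear h" and sym: "\<And>u v. h u v = h v u"
    and m: "bounded_bilinear m" and \<alpha>: "bilinear \<alpha>" and \<beta>: "bilinear \<beta>"
  shows "(\<Sum>u\<in>B. \<Sum>v\<in>B. m (\<alpha> u v) (\<beta> u v)) = (\<Sum>u\<in>B'. \<Sum>v\<in>B'. m (\<alpha> u v) (\<beta> u v))"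
proof -
  interpret m: bounded_bilinear m by (rule m)
  have m1: "linear (\<lambda>x. m (l x) y)" if "linear l" for l :: "_ \<Rightarrow> _" and y
    using that by (intro linearI) (simp_all add: linear_add linear_scale m.add_left m.scaleR_left)
  have m2: "linear (\<lambda>y. m x (l y))" if "linear l" for l :: "_ \<Rightarrow> _" and x
    using that by (intro linearI) (simp_all add: linear_add linear_scale m.add_right m.scaleR_right)
  have lins: "linear (\<alpha> u)" "linear (\<lambda>u. \<alpha> u v)" "linear (\<beta> u)" "linear (\<lambda>u. \<beta> u v)" for u v
    using \<alpha> \<beta> by (auto simp: bilinear_def)
  have "(\<Sum>u\<in>B. \<Sum>v\<in>B. m (\<alpha> u v) (\<beta> u v)) = (\<Sum>u\<in>B. \<Sum>v\<in>B'. m (\<alpha> u v) (\<beta> u v))"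
    by (intro sum.cong refl frame_trace_eq[OF B B' lin sym])
       (auto simp: bilinear_def intro: m1 m2 lins)
  also have "\<dots> = (\<Sum>u\<in>B'. \<Sum>v\<in>B'. m (\<alpha> u v) (\<beta> u v))"
    by (intro frame_trace_eq[OF B B' lin sym, where f = "\<lambda>u u'. \<Sum>v\<in>B'. m (\<alpha> u v) (\<beta> u' v)"])
       (auto simp: bilinear_def intro!: linear_compose_sum m1 m2 lins)
  finally show ?thesis .
qed

lemma card_frame:
  fixes h :: "'e::euclidean_space \<Rightarrow> 'e \<Rightarrow> real"
  assumes B: "orthonormal_basis h B" and lin: "bilinear h"
  shows "card B = DIM('e)"
proof -
  have fin: "finite B" using B by (simp add: orthonormal_basis_def)
  have "c b = 0" if c: "(\<Sum>b\<in>B. c b *\<^sub>R b) = 0" and b: "b \<in> B" for c b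
  proof -
    have "0 = h (\<Sum>b\<in>B. c b *\<^sub>R b) b"
      using lin by (simp add: c bilinear_def linear_0[of "\<lambda>x. h x b"])
    also have "\<dots> = (\<Sum>a\<in>B. c a * h a b)"
      using lin by (simp add: bilinear_def linear_sum[of "\<lambda>x. h x b"] linear_scale[of "\<lambda>x. h x b"])
    also have "\<dots> = (\<Sum>a\<in>B. if a = b then c a else 0)"
      using B b by (intro sum.cong) (auto simp: orthonormal_basis_def)
    finally show ?thesis using fin b by (simp add: sum.delta)
  qed
  then have "independent B"
    using fin by (auto simp: independent_explicit)
  then show ?thesis
    using dim_eq_card_independent[of B] B by (metis dim_UNIV dim_span orthonormal_basis_def)
qed

text \<open>The Gram-Schmidt process for an inner product that depends continuously on a parameter.  It is
stated with a hypothesis on pairs of continuous sections, rather than on fixed vectors, so that it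
also serves to construct an orthonormal basis before coordinates are known to be bounded.\<close>

lemma gram_schmidt_continuous:
  fixes h :: "'b::topological_space \<Rightarrow> 'a::real_normed_vector \<Rightarrow> 'a \<Rightarrow> real"
  assumes bil: "\<And>y. y \<in> S \<Longrightarrow> bilinear (h y)" and sym: "\<And>y u v. y \<in> S \<Longrightarrow> h y u v = h y v u"
    and pos: "\<And>y u. y \<in> S \<Longrightarrow> u \<noteq> 0 \<Longrightarrow> h y u u > 0"
    and cont: "\<And>u v. continuous_on S u \<Longrightarrow> continuous_on S v \<Longrightarrow> continuous_on S (\<lambda>y. h y (u y) (v y))"
    and B: "finite B" "independent B"
  shows "\<exists>f::nat \<Rightarrow> 'b \<Rightarrow> 'a. (\<forall>i<card B. continuous_on S (f i)) \<and>
     (\<forall>y\<in>S. (\<forall>i<card B. \<forall>j<card B. h y (f i y) (f j y) = (if i = j then 1 else 0)) \<and>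
        span ((\<lambda>i. f i y) ` {..<card B}) = span B)"
  using B
proof (induction B rule: finite_induct)
  case empty
  then show ?case by simp
next
  case (insert a B)
  let ?m = "card B"
  have ind: "independent B" "a \<notin> span B"
    using insert.prems insert.hyps by (auto simp: independent_insert)
  obtain f :: "nat \<Rightarrow> 'b \<Rightarrow> 'a" where f: "\<And>i. i < ?m \<Longrightarrow> continuous_on S (f i)"
    "\<And>y i j. y \<in> S \<Longrightarrow> i < ?m \<Longrightarrow> j < ?m \<Longrightarrow> h y (f i y) (f j y) = (if i = j then 1 else 0)"
    "\<And>y. y \<in> S \<Longrightarrow> span ((\<lambda>i. f i y) ` {..<?m}) = span B"
    using insert.IH[OF ind(1)] by blast
  have l1: "linear (\<lambda>x. h y x v)" and l2: "linear (h y v)" if "y \<in> S" for y v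
    using bil[OF that] by (auto simp: bilinear_def)
  \<comment> \<open>The orthogonal projection of \<open>a\<close> to the span of \<open>B\<close>.\<close>
  define t where "t y = (\<Sum>i<?m. h y a (f i y) *\<^sub>R f i y)" for y
  define r where "r y = a - t y" for y
  define g where "g y = (1 / sqrt (h y (r y) (r y))) *\<^sub>R r y" for y
  have t: "t y \<in> span B" if "y \<in> S" for y
    unfolding t_def f(3)[OF that, symmetric] by (intro span_sum span_scale span_base) auto
  have r0: "r y \<noteq> 0" if "y \<in> S" for y
    using t[OF that] ind(2) by (auto simp: r_def)
  have hr: "h y (r y) (r y) > 0" if "y \<in> S" for y
    using pos r0 that by blast
  have orth: "h y (r y) (f j y) = 0" if "y \<in> S" "j < ?m" for y j
  proof -
    have "h y (t y) (f j y) = (\<Sum>i<?m. h y a (f i y) * h y (f i y) (f j y))"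
      using l1[OF that(1)] by (simp add: t_def linear_sum[of "\<lambda>x. h y x (f j y)"] linear_scale[of "\<lambda>x. h y x (f j y)"])
    also have "\<dots> = (\<Sum>i<?m. if i = j then h y a (f i y) else 0)"
      using f(2) that by (intro sum.cong) auto
    also have "\<dots> = h y a (f j y)" using that by simp
    finally show ?thesis
      using l1[OF that(1)] by (simp add: r_def linear_diff[of "\<lambda>x. h y x (f j y)"])
  qed
  have cont_r: "continuous_on S r"
    unfolding r_def t_def by (intro continuous_intros cont f(1)) auto
  have cont_g: "continuous_on S g"
    unfolding g_def using hr by (intro continuous_intros cont cont_r) (auto simp: less_imp_neq[THEN not_sym])
  define f' where "f' i = (if i = ?m then g else f i)" for i
  have gg: "h y (g y) (g y) = 1" if "y \<in> S" for y
    using l1[OF that] l2[OF that] hr[OF that]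
    by (simp add: g_def linear_scale[of "\<lambda>x. h y x _"] linear_scale[of "h y _"])
  have gf: "h y (g y) (f j y) = 0" if "y \<in> S" "j < ?m" for y j
    using l1[OF that(1)] orth[OF that] by (simp add: g_def linear_scale[of "\<lambda>x. h y x _"])
  have card: "card (insert a B) = Suc ?m" using insert.hyps by simp
  have "span ((\<lambda>i. f' i y) ` {..<Suc ?m}) = span (insert a B)" if "y \<in> S" for y
  proof -
    have "(\<lambda>i. f' i y) ` {..<Suc ?m} = insert (g y) ((\<lambda>i. f i y) ` {..<?m})"
      by (auto simp: f'_def lessThan_Suc)
    then have "span ((\<lambda>i. f' i y) ` {..<Suc ?m}) = span (insert (g y) B)"
      using f(3)[OF that] by (simp add: span_insert)
    also have "\<dots> = span (insert a B)"
    proof (rule antisym)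
      have "g y \<in> span (insert a B)"
        unfolding g_def r_def using t[OF that] span_mono[of B "insert a B"]
        by (intro span_scale span_diff) (auto intro: span_base)
      then show "span (insert (g y) B) \<subseteq> span (insert a B)"
        by (intro span_minimal) (auto intro: span_base)
      have "a = sqrt (h y (r y) (r y)) *\<^sub>R g y + t y"
        using hr[OF that] by (simp add: g_def r_def)
      moreover have "sqrt (h y (r y) (r y)) *\<^sub>R g y + t y \<in> span (insert (g y) B)"
        using t[OF that] span_mono[of B "insert (g y) B"]
        by (intro span_add span_scale) (auto intro: span_base)
      ultimately have "a \<in> span (insert (g y) B)" by simp
      then show "span (insert a B) \<subseteq> span (insert (g y) B)"
        by (intro span_minimal) (auto intro: span_base)
    qed
    finally show ?thesis .
  qed
  moreover have "h y (f' i y) (f' j y) = (if i = j then 1 else 0)"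
    if "y \<in> S" "i < Suc ?m" "j < Suc ?m" for y i j
    using that f(2)[OF that(1)] gg[OF that(1)] gf[OF that(1)] sym[OF that(1)]
    by (auto simp: f'_def less_Suc_eq)
  moreover have "continuous_on S (f' i)" if "i < Suc ?m" for i
    using that f(1) cont_g by (auto simp: f'_def less_Suc_eq)
  ultimately show ?case
    unfolding card by (intro exI[of _ f']) blast
qed

lemma frame_of_family:
  assumes "\<And>i j. i < m \<Longrightarrow> j < m \<Longrightarrow> h (f i) (f j) = (if i = j then 1 else 0::real)"
    and "span (f ` {..<m}) = UNIV"
  shows "orthonormal_basis h (f ` {..<m})" "inj_on f {..<m::nat}"
proof -
  show i: "inj_on f {..<m}"
  proof (rule inj_onI)
    fix i j assume "i \<in> {..<m}" "j \<in> {..<m}" "f i = f j"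
    then show "i = j"
      using assms(1)[of i i] assms(1)[of i j] by (cases "i = j") auto
  qed
  show "orthonormal_basis h (f ` {..<m})"
    using assms i by (auto simp: orthonormal_basis_def inj_on_eq_iff)
qed

lemma frame_exists:
  fixes h :: "'a::real_normed_vector \<Rightarrow> 'a \<Rightarrow> real" and B :: "'a set"
  assumes h: "bilinear h" "\<And>u v. h u v = h v u" "\<And>u. u \<noteq> 0 \<Longrightarrow> h u u > 0"
    and B: "finite B" "span B = UNIV"
  shows "\<exists>B. orthonormal_basis h B"
proof -
  obtain B' :: "'a set" where B': "B' \<subseteq> B" "independent B'" "span B' = span B"
    using maximal_independent_subset[of B] by (metis span_minimal span_mono subspace_span subset_antisym)
  define Q where "Q f y \<longleftrightarrow> (\<forall>i<card B'. \<forall>j<card B'. h (f i y) (f j y) = (if i = j then 1 else 0)) \<and>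
        span ((\<lambda>i. f i y) ` {..<card B'}) = span B'" for f :: "nat \<Rightarrow> real \<Rightarrow> 'a" and y
  have "\<exists>f::nat \<Rightarrow> real \<Rightarrow> 'a. (\<forall>i<card B'. continuous_on {0} (f i)) \<and> (\<forall>y\<in>{0}. Q f y)"
    unfolding Q_def
    by (rule gram_schmidt_continuous) (use h B' finite_subset[OF B'(1) B(1)] in \<open>simp_all\<close>)
  then obtain f where "Q f 0" by blast
  then have f: "\<And>i j. i < card B' \<Longrightarrow> j < card B' \<Longrightarrow> h (f i 0) (f j 0) = (if i = j then 1 else 0)"
     "span ((\<lambda>i. f i 0) ` {..<card B'}) = span B'"
    unfolding Q_def by simp_all
  have "orthonormal_basis h ((\<lambda>i. f i 0) ` {..<card B'})"
    by (rule frame_of_family(1)) (simp_all add: f B B')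
  then show ?thesis by blast
qed

section \<open>The pointwise decomposition of 2-forms\<close>

definition inner_product :: "('k::real_normed_vector \<Rightarrow> 'k \<Rightarrow> real) \<Rightarrow> bool" where
  "inner_product ip \<longleftrightarrow> bounded_bilinear ip \<and> (\<forall>X Y. ip X Y = ip Y X) \<and> (\<forall>X. X \<noteq> 0 \<longrightarrow> ip X X > 0)"

text \<open>Contraction with \<open>\<omega>\<close> is adjoint to multiplication by \<open>\<omega>\<close>, and an adjoint is unique because the inner
product is definite.\<close>

lemma Lambda_eq:
  fixes ip :: "'k::real_normed_vector \<Rightarrow> 'k \<Rightarrow> real"
  assumes ip: "inner_product ip"
  shows "Lambda h ip w \<alpha> =
     (1 / 2) *\<^sub>R (\<Sum>u\<in>orthonormal_frame h. \<Sum>v\<in>orthonormal_frame h. w u v *\<^sub>R \<alpha> u v)"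
proof -
  interpret ip: bounded_bilinear ip using ip by (simp add: inner_product_def)
  define Y where "Y = (1 / 2) *\<^sub>R (\<Sum>u\<in>orthonormal_frame h. \<Sum>v\<in>orthonormal_frame h. w u v *\<^sub>R \<alpha> u v)"
  have Y: "ip Y X = inner_2form h ip \<alpha> (Lop w X)" for X
    by (simp add: Y_def inner_2form_def Lop_def ip.scaleR_left ip.scaleR_right ip.sum_left)
  show ?thesis
    unfolding Lambda_def Y_def[symmetric]
  proof (rule the_equality)
    show "\<forall>X. ip Y X = inner_2form h ip \<alpha> (Lop w X)" using Y by blast
    fix Z assume "\<forall>X. ip Z X = inner_2form h ip \<alpha> (Lop w X)"
    then have "ip (Z - Y) (Z - Y) = 0"
      unfolding ip.diff_left[of Z] Y by simp
    then show "Z = Y"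
      using ip unfolding inner_product_def
      by (metis (no_types) right_minus_eq order_less_irrefl)
  qed
qed

text \<open>Since \<open>\<omega>(u, v) = - g(u, J v)\<close>, Parseval's identity reduces the sum over \<open>u\<close> to \<open>g(J v, J v)\<close>, and \<open>J\<close> is an
isometry.\<close>

lemma compatible_form_norm:
  assumes B: "orthonormal_basis h B" and h: "bilinear h" "\<And>u v. h u v = h v u"
    and w: "bilinear w" "\<And>u. w u u = 0" and J: "\<And>u. J (J u) = - u" and hw: "\<And>u v. h u v = w u (J v)"
  shows "(\<Sum>u\<in>B. \<Sum>v\<in>B. w u v * w u v) = real (card B)"
proof -
  have w1: "linear (\<lambda>x. w x v)" and w2: "linear (w u)" for u v
    using w(1) by (auto simp: bilinear_def)
  have skew: "w u v = - w v u" for u v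
  proof -
    have "w (u + v) (u + v) = w u u + w v u + (w u v + w v v)"
      by (simp add: linear_add[OF w1] linear_add[OF w2])
    then show ?thesis by (simp add: w(2))
  qed
  have wh: "w u v = - h u (J v)" for u v
    by (simp add: hw J linear_neg[OF w2])
  have iso: "h (J v) (J v) = h v v" for v
    using skew[of "J v" v] by (simp add: hw J linear_neg[OF w2])
  have "(\<Sum>u\<in>B. \<Sum>v\<in>B. w u v * w u v) = (\<Sum>v\<in>B. \<Sum>u\<in>B. h u (J v) * h u (J v))"
    by (subst sum.swap) (simp add: wh)
  also have "\<dots> = (\<Sum>v\<in>B. h v v)"
    by (simp add: frame_parseval[OF B h] iso)
  also have "\<dots> = real (card B)"
    using B by (simp add: orthonormal_basis_def)
  finally show ?thesis .
qed

text \<open>The hypothesis on \<open>w\<close> says that \<open>|w|\<^sup>2 = n\<close>.  The mixed term \<open>\<langle>\<alpha>, w \<Phi>\<rangle> = \<langle>\<Lambda> \<alpha>, \<Phi>\<rangle> = n |\<Phi>|\<^sup>2\<close> then equals \<open>|w \<Phi>|\<^sup>2\<close>, so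
that \<open>\<alpha> - w \<Phi>\<close> is orthogonal to \<open>w \<Phi>\<close>.\<close>

lemma primitive_decomposition_norm:
  fixes ip :: "'k::real_normed_vector \<Rightarrow> 'k \<Rightarrow> real" and \<alpha> :: "'e::real_vector \<Rightarrow> 'e \<Rightarrow> 'k"
  assumes ip: "inner_product ip" and n: "n > 0"
    and w: "(\<Sum>u\<in>orthonormal_frame h. \<Sum>v\<in>orthonormal_frame h. w u v * w u v) = 2 * real n"
  defines "\<Phi> \<equiv> (1 / real n) *\<^sub>R Lambda h ip w \<alpha>"
  shows "inner_2form h ip (Lop w \<Phi>) (Lop w \<Phi>) = real n * ip \<Phi> \<Phi>"
    and "inner_2form h ip \<alpha> \<alpha> =
      inner_2form h ip (\<lambda>u v. \<alpha> u v - Lop w \<Phi> u v) (\<lambda>u v. \<alpha> u v - Lop w \<Phi> u v) +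
      inner_2form h ip (Lop w \<Phi>) (Lop w \<Phi>)"
proof -
  interpret ip: bounded_bilinear ip using ip by (simp add: inner_product_def)
  let ?B = "orthonormal_frame h"
  have "inner_2form h ip (Lop w \<Phi>) (Lop w \<Phi>) = (1 / 2) * ((\<Sum>u\<in>?B. \<Sum>v\<in>?B. w u v * w u v) * ip \<Phi> \<Phi>)"
    by (simp add: inner_2form_def Lop_def ip.scaleR_left ip.scaleR_right sum_distrib_right mult.assoc)
  then show norm: "inner_2form h ip (Lop w \<Phi>) (Lop w \<Phi>) = real n * ip \<Phi> \<Phi>"
    by (simp add: w)
  have "inner_2form h ip \<alpha> (Lop w \<Phi>) = ip (Lambda h ip w \<alpha>) \<Phi>"
    by (simp add: Lambda_eq[OF ip] inner_2form_def Lop_def ip.scaleR_left ip.scaleR_right ip.sum_left)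
  also have "Lambda h ip w \<alpha> = real n *\<^sub>R \<Phi>"
    using n by (simp add: \<Phi>_def)
  finally have cross: "inner_2form h ip \<alpha> (Lop w \<Phi>) = real n * ip \<Phi> \<Phi>"
    by (simp add: ip.scaleR_left)
  have sym: "ip X Y = ip Y X" for X Y
    using ip by (simp add: inner_product_def)
  have "ip (\<alpha> u v - Lop w \<Phi> u v) (\<alpha> u v - Lop w \<Phi> u v) =
      ip (\<alpha> u v) (\<alpha> u v) - 2 * ip (\<alpha> u v) (Lop w \<Phi> u v) + ip (Lop w \<Phi> u v) (Lop w \<Phi> u v)" for u v
    using sym[of "\<alpha> u v" "Lop w \<Phi> u v"] by (simp add: ip.diff_left ip.diff_right)
  note expand = this
  have "inner_2form h ip (\<lambda>u v. \<alpha> u v - Lop w \<Phi> u v) (\<lambda>u v. \<alpha> u v - Lop w \<Phi> u v) =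
     inner_2form h ip \<alpha> \<alpha> - 2 * inner_2form h ip \<alpha> (Lop w \<Phi>) + inner_2form h ip (Lop w \<Phi>) (Lop w \<Phi>)"
    unfolding inner_2form_def expand
    by (simp add: sum.distrib sum_subtractf algebra_simps flip: sum_distrib_left)
  then show "inner_2form h ip \<alpha> \<alpha> =
      inner_2form h ip (\<lambda>u v. \<alpha> u v - Lop w \<Phi> u v) (\<lambda>u v. \<alpha> u v - Lop w \<Phi> u v) +
      inner_2form h ip (Lop w \<Phi>) (Lop w \<Phi>)"
    using norm cross by simp
qed

lemma fin_dim_inner_product:
  fixes ip :: "'k::real_normed_vector \<Rightarrow> 'k \<Rightarrow> real" and B :: "'k set"
  assumes ip: "inner_product ip" and B: "finite B" "span B = UNIV"
  shows "fin_dim TYPE('k)"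
proof -
  interpret ip: bounded_bilinear ip using ip by (simp add: inner_product_def)
  have bil: "bilinear ip"
    by (auto simp: bilinear_def bounded_linear.linear[OF ip.bounded_linear_left]
        bounded_linear.linear[OF ip.bounded_linear_right])
  obtain E where E: "orthonormal_basis ip E"
    using frame_exists[OF bil _ _ B] ip by (auto simp: inner_product_def)
  show ?thesis
    by (rule fin_dimI[of E "\<lambda>b X. ip X b" "\<lambda>b. b"])
       (use E frame_expand[OF E bil] ip.bounded_linear_left in \<open>auto simp: orthonormal_basis_def\<close>)
qed

section \<open>Charts and differentials of maps between manifolds\<close>

abbreviation cimg :: "('m, 'e) chart \<Rightarrow> 'e set" where "cimg c \<equiv> cmap c ` cdom c"

lemma chart_at_in:
  assumes "smooth_manifold C"
  shows "chart_at C x \<in> C" "x \<in> cdom (chart_at C x)"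
proof -
  have "\<exists>c. c \<in> C \<and> x \<in> cdom c"
    using assms unfolding smooth_manifold_def by blast
  from someI_ex[OF this] show "chart_at C x \<in> C" "x \<in> cdom (chart_at C x)"
    by (auto simp: chart_at_def)
qed

lemma
  assumes "smooth_manifold C" "c \<in> C"
  shows open_cdom: "open (cdom c)" and open_cimg: "open (cimg c)"
    and continuous_on_cmap: "continuous_on (cdom c) (cmap c)"
    and continuous_on_cinv: "continuous_on (cimg c) (cinv c)"
    and cinv_cmap: "x \<in> cdom c \<Longrightarrow> cinv c (cmap c x) = x"
    and cmap_cinv: "y \<in> cimg c \<Longrightarrow> cmap c (cinv c y) = y"
    and cinv_in: "y \<in> cimg c \<Longrightarrow> cinv c y \<in> cdom c"
proof -
  have h: "open (cdom c)" "open (cimg c)" "homeomorphism (cdom c) (cimg c) (cmap c) (cinv c)"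
    using assms unfolding smooth_manifold_def by blast+
  then show "open (cdom c)" "open (cimg c)" by blast+
  show "continuous_on (cdom c) (cmap c)" "continuous_on (cimg c) (cinv c)"
    using h(3) by (blast intro: homeomorphism_cont1 homeomorphism_cont2)+
  show "x \<in> cdom c \<Longrightarrow> cinv c (cmap c x) = x" "y \<in> cimg c \<Longrightarrow> cmap c (cinv c y) = y"
    using homeomorphism_apply1[OF h(3)] homeomorphism_apply2[OF h(3)] by blast+
  show "y \<in> cimg c \<Longrightarrow> cinv c y \<in> cdom c"
    using homeomorphism_image2[OF h(3)] by blast
qed

lemma cmap_image_eq:
  assumes "smooth_manifold C" "c \<in> C" "U \<subseteq> cdom c"
  shows "cmap c ` U = cimg c \<inter> cinv c -` U"
proof (intro equalityI subsetI)
  fix y assume "y \<in> cmap c ` U"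
  then obtain x where "x \<in> U" "y = cmap c x" by blast
  then show "y \<in> cimg c \<inter> cinv c -` U"
    using assms(3) cinv_cmap[OF assms(1,2), of x] by auto
next
  fix y assume "y \<in> cimg c \<inter> cinv c -` U"
  then show "y \<in> cmap c ` U"
    using cmap_cinv[OF assms(1,2), of y] by (metis IntD1 IntD2 image_eqI vimageD)
qed

lemma open_cmap_image:
  assumes "smooth_manifold C" "c \<in> C" "U \<subseteq> cdom c" "open U"
  shows "open (cmap c ` U)"
  unfolding cmap_image_eq[OF assms(1-3)]
  by (rule continuous_open_preimage[OF continuous_on_cinv open_cimg assms(4)]) (use assms in auto)

text \<open>Transports local properties to coordinates, where derivatives are taken.\<close>

lemma eventually_nhds_chart:
  assumes "smooth_manifold C" "c \<in> C" "x \<in> cdom c" "\<forall>\<^sub>F x in nhds x. Q x"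
  shows "\<forall>\<^sub>F y in nhds (cmap c x). y \<in> cimg c \<and> Q (cinv c y)"
proof -
  obtain U where U: "open U" "x \<in> U" "\<And>x. x \<in> U \<Longrightarrow> Q x"
    using assms(4) by (auto simp: eventually_nhds)
  have "open (cmap c ` (U \<inter> cdom c))"
    by (rule open_cmap_image[OF assms(1,2)]) (use U open_cdom[OF assms(1,2)] in auto)
  then show ?thesis
    unfolding eventually_nhds
    by (rule_tac exI[of _ "cmap c ` (U \<inter> cdom c)"]) (use U assms(3) cinv_cmap[OF assms(1,2)] in auto)
qed

text \<open>The differential at \<open>x\<close> of the transition from \<open>c\<close> to \<open>c'\<close>; the identification of a tangent vector with its
components in the preferred chart is the case that \<open>c'\<close> is the preferred chart at \<open>x\<close>.\<close>

definition chart_change :: "('m, 'e::real_normed_vector) chart \<Rightarrow> ('m, 'e) chart \<Rightarrow> 'm \<Rightarrow> 'e \<Rightarrow> 'e" where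
  "chart_change c c' x = frechet_derivative (cmap c' \<circ> cinv c) (at (cmap c x))"

lemma coord_vec_eq_chart_change: "coord_vec C c x = chart_change c (chart_at C x) x"
  by (simp add: coord_vec_def chart_change_def)

lemma Ck_on_transition:
  assumes "smooth_manifold C" "c \<in> C" "c' \<in> C"
  shows "Ck_on k (cmap c ` (cdom c \<inter> cdom c')) (cmap c' \<circ> cinv c)"
  using assms unfolding smooth_manifold_def smooth_on_def by blast

lemma has_derivative_chart_change:
  assumes "smooth_manifold C" "c \<in> C" "c' \<in> C" "x \<in> cdom c" "x \<in> cdom c'"
  shows "((cmap c' \<circ> cinv c) has_derivative chart_change c c' x) (at (cmap c x))"
  unfolding chart_change_def
  by (rule Ck_on_has_derivative[OF Ck_on_transition[OF assms(1-3)]]) (use assms in auto)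

lemma linear_chart_change:
  assumes "smooth_manifold C" "c \<in> C" "c' \<in> C" "x \<in> cdom c" "x \<in> cdom c'"
  shows "bounded_linear (chart_change c c' x)" "linear (chart_change c c' x)"
  using has_derivative_chart_change[OF assms] has_derivative_bounded_linear has_derivative_linear by blast+

definition chart_rep :: "('m, 'e) chart \<Rightarrow> ('n, 'f) chart \<Rightarrow> ('m \<Rightarrow> 'n) \<Rightarrow> 'e \<Rightarrow> 'f" where
  "chart_rep c d f = cmap d \<circ> f \<circ> cinv c"

lemma has_derivative_eventually_eq:
  assumes "(f has_derivative F) (at x)" "\<forall>\<^sub>F y in nhds x. f y = g y"
  shows "(g has_derivative F) (at x)"
proof -
  obtain S where "open S" "x \<in> S" "\<And>y. y \<in> S \<Longrightarrow> f y = g y"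
    using assms(2) by (auto simp: eventually_nhds)
  then show ?thesis
    by (rule has_derivative_transform_within_open[OF assms(1)])
qed

text \<open>The chain rule for maps between manifolds.  Applied with an identity map as one factor, it also
gives the effect of a change of charts.\<close>

lemma chart_rep_compose:
  assumes C: "smooth_manifold C" "c \<in> C" "x \<in> cdom c" and D: "smooth_manifold D" "d \<in> D" "f x \<in> cdom d"
    and f: "isCont f x" "(chart_rep c d f has_derivative F) (at (cmap c x))"
    and g: "(chart_rep d e g has_derivative G) (at (cmap d (f x)))"
  shows "(chart_rep c e (g \<circ> f) has_derivative G \<circ> F) (at (cmap c x))"
proof -
  have "(chart_rep d e g has_derivative G) (at (chart_rep c d f (cmap c x)))"
    using g by (simp add: chart_rep_def cinv_cmap[OF C])
  with f(2) have 1: "((chart_rep d e g \<circ> chart_rep c d f) has_derivative G \<circ> F) (at (cmap c x))"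
    by (rule diff_chain_at)
  have "\<forall>\<^sub>F x in nhds x. f x \<in> cdom d"
    using f(1) D open_cdom[OF D(1,2)] by (metis eventually_nhds_in_open isCont_def topological_tendstoD tendsto_at_iff_tendsto_nhds)
  from eventually_nhds_chart[OF C this]
  have "\<forall>\<^sub>F y in nhds (cmap c x). (chart_rep d e g \<circ> chart_rep c d f) y = chart_rep c e (g \<circ> f) y"
    by eventually_elim (simp add: chart_rep_def cinv_cmap[OF D(1,2)])
  with 1 show ?thesis by (rule has_derivative_eventually_eq)
qed

lemma chart_rep_id: "chart_rep c c' (\<lambda>x. x) = cmap c' \<circ> cinv c"
  by (auto simp: chart_rep_def)

lemma chart_change_compose:
  assumes C: "smooth_manifold C" and "c \<in> C" "c' \<in> C" "c'' \<in> C" "x \<in> cdom c" "x \<in> cdom c'" "x \<in> cdom c''"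
  shows "chart_change c' c'' x (chart_change c c' x u) = chart_change c c'' x u"
proof -
  have "(chart_rep c c'' ((\<lambda>x. x) \<circ> (\<lambda>x. x)) has_derivative chart_change c' c'' x \<circ> chart_change c c' x) (at (cmap c x))"
    by (rule chart_rep_compose[where f = "\<lambda>x. x" and g = "\<lambda>x. x", OF C assms(2,5) C assms(3,6)], unfold chart_rep_id)
       (rule continuous_ident has_derivative_chart_change[OF C] assms)+
  moreover have "(chart_rep c c'' ((\<lambda>x. x) \<circ> (\<lambda>x. x)) has_derivative chart_change c c'' x) (at (cmap c x))"
    using has_derivative_chart_change[OF C, of c c'' x] assms by (simp add: o_def chart_rep_id[unfolded o_def])
  ultimately have "chart_change c' c'' x \<circ> chart_change c c' x = chart_change c c'' x"
    by (rule has_derivative_unique)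
  then show ?thesis by (simp add: fun_eq_iff)
qed

lemma chart_change_self:
  assumes C: "smooth_manifold C" "c \<in> C" "x \<in> cdom c"
  shows "chart_change c c x u = u"
proof -
  have "\<forall>\<^sub>F x in nhds x. True" by simp
  from eventually_nhds_chart[OF C this]
  have "\<forall>\<^sub>F y in nhds (cmap c x). y = (cmap c \<circ> cinv c) y"
    by eventually_elim (simp add: cmap_cinv[OF C(1,2)])
  then have "((cmap c \<circ> cinv c) has_derivative (\<lambda>u. u)) (at (cmap c x))"
    by (rule has_derivative_eventually_eq[OF has_derivative_ident])
  from has_derivative_unique[OF this has_derivative_chart_change[OF C(1,2,2,3,3)]] show ?thesis
    by (simp add: fun_eq_iff)
qed

lemma coord_vec_surj:
  assumes C: "smooth_manifold C" "c \<in> C" "x \<in> cdom c"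
  shows "coord_vec C c x (chart_change (chart_at C x) c x u) = u"
  unfolding coord_vec_eq_chart_change
  using chart_change_compose[OF C(1) chart_at_in(1)[OF C(1)] C(2) chart_at_in(1)[OF C(1)]
      chart_at_in(2)[OF C(1)] C(3) chart_at_in(2)[OF C(1)]] chart_change_self[OF C(1) chart_at_in[OF C(1)]]
  by simp

lemma linear_coord_vec:
  assumes C: "smooth_manifold C" "c \<in> C" "x \<in> cdom c"
  shows "linear (coord_vec C c x)"
  unfolding coord_vec_eq_chart_change using linear_chart_change[OF C(1,2) _ C(3)] chart_at_in[OF C(1)] by blast

definition mdifferentiable ::
    "('m::{t2_space,second_countable_topology}, 'e::real_normed_vector) atlas \<Rightarrow>
     ('n::{t2_space,second_countable_topology}, 'f::real_normed_vector) atlas \<Rightarrow> ('m \<Rightarrow> 'n) \<Rightarrow> 'm \<Rightarrow> bool" where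
  "mdifferentiable C D f x \<longleftrightarrow> isCont f x \<and>
     chart_rep (chart_at C x) (chart_at D (f x)) f differentiable (at (cmap (chart_at C x) x))"

lemma mdifferentiable_has_derivative:
  assumes "mdifferentiable C D f x"
  shows "(chart_rep (chart_at C x) (chart_at D (f x)) f has_derivative mderiv C D f x) (at (cmap (chart_at C x) x))"
  using assms by (simp add: mdifferentiable_def mderiv_def chart_rep_def frechet_derivative_works)

lemma linear_mderiv:
  assumes "mdifferentiable C D f x"
  shows "bounded_linear (mderiv C D f x)" "linear (mderiv C D f x)"
  using mdifferentiable_has_derivative[OF assms] has_derivative_bounded_linear has_derivative_linear by blast+

text \<open>The differential, defined through preferred charts, may be computed in any charts.\<close>

lemma mdifferentiable_chart:
  assumes C: "smooth_manifold C" "c \<in> C" "x \<in> cdom c" and D: "smooth_manifold D" "d \<in> D" "f x \<in> cdom d"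
    and f: "isCont f x" "(chart_rep c d f has_derivative F) (at (cmap c x))"
  shows "mdifferentiable C D f x" "mderiv C D f x (coord_vec C c x u) = coord_vec D d (f x) (F u)"
proof -
  let ?c = "chart_at C x" and ?d = "chart_at D (f x)"
  note cx = chart_at_in[OF C(1), of x] and dx = chart_at_in[OF D(1), of "f x"]
  have "(chart_rep ?c d (f \<circ> (\<lambda>x. x)) has_derivative F \<circ> chart_change ?c c x) (at (cmap ?c x))"
    by (rule chart_rep_compose[where f = "\<lambda>x. x" and g = f, OF C(1) cx C(1,2,3) _ _ f(2)], unfold chart_rep_id)
       (rule continuous_ident has_derivative_chart_change[OF C(1)] C cx)+
  then have "(chart_rep ?c d f has_derivative F \<circ> chart_change ?c c x) (at (cmap ?c x))"
    by (simp add: o_def)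
  then have "(chart_rep ?c ?d ((\<lambda>x. x) \<circ> f) has_derivative chart_change d ?d (f x) \<circ> (F \<circ> chart_change ?c c x)) (at (cmap ?c x))"
    by (intro chart_rep_compose[where f = f and g = "\<lambda>x. x", OF C(1) cx D f(1)], unfold chart_rep_id)
       (rule has_derivative_chart_change[OF D(1)] D dx | assumption)+
  then have 1: "(chart_rep ?c ?d f has_derivative chart_change d ?d (f x) \<circ> (F \<circ> chart_change ?c c x)) (at (cmap ?c x))"
    by (simp add: o_def)
  then show md: "mdifferentiable C D f x"
    using f by (auto simp: mdifferentiable_def differentiable_def)
  have "mderiv C D f x = chart_change d ?d (f x) \<circ> (F \<circ> chart_change ?c c x)"
    by (rule has_derivative_unique[OF mdifferentiable_has_derivative[OF md] 1])
  then show "mderiv C D f x (coord_vec C c x u) = coord_vec D d (f x) (F u)"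
    using chart_change_compose[OF C(1,2) cx(1) C(2,3) cx(2) C(3)] chart_change_self[OF C]
    by (simp add: coord_vec_eq_chart_change)
qed

lemma mdifferentiable_compose:
  assumes C: "smooth_manifold C" and D: "smooth_manifold D"
    and f: "mdifferentiable C D f x" and g: "mdifferentiable D E g (f x)"
  shows "mdifferentiable C E (g \<circ> f) x" "mderiv C E (g \<circ> f) x u = mderiv D E g (f x) (mderiv C D f x u)"
proof -
  have 1: "(chart_rep (chart_at C x) (chart_at E ((g \<circ> f) x)) (g \<circ> f) has_derivative mderiv D E g (f x) \<circ> mderiv C D f x)
      (at (cmap (chart_at C x) x))"
    by (rule chart_rep_compose[where f = f and g = g, OF C chart_at_in[OF C] D chart_at_in[OF D] _ mdifferentiable_has_derivative[OF f]])
       (use f mdifferentiable_has_derivative[OF g] in \<open>auto simp: mdifferentiable_def\<close>)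
  then show md: "mdifferentiable C E (g \<circ> f) x"
    using f g by (auto simp: mdifferentiable_def differentiable_def intro: continuous_at_compose)
  from has_derivative_unique[OF mdifferentiable_has_derivative[OF md] 1]
  show "mderiv C E (g \<circ> f) x u = mderiv D E g (f x) (mderiv C D f x u)"
    by simp
qed

lemma mderiv_cong:
  assumes C: "smooth_manifold C" and f: "mdifferentiable C D f x" and eq: "\<forall>\<^sub>F x in nhds x. f x = g x"
  shows "mdifferentiable C D g x" "mderiv C D g x = mderiv C D f x"
proof -
  have fx: "f x = g x" using eq eventually_nhds_x_imp_x by blast
  have "\<forall>\<^sub>F y in nhds (cmap (chart_at C x) x). chart_rep (chart_at C x) (chart_at D (f x)) f y = chart_rep (chart_at C x) (chart_at D (g x)) g y"
    using eventually_nhds_chart[OF C chart_at_in[OF C] eq] by eventually_elim (simp add: chart_rep_def fx)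
  from has_derivative_eventually_eq[OF mdifferentiable_has_derivative[OF f] this]
  have 1: "(chart_rep (chart_at C x) (chart_at D (g x)) g has_derivative mderiv C D f x) (at (cmap (chart_at C x) x))" .
  moreover have "isCont g x"
    using f isCont_cong[OF eq] by (simp add: mdifferentiable_def)
  ultimately show md: "mdifferentiable C D g x"
    by (auto simp: mdifferentiable_def differentiable_def)
  show "mderiv C D g x = mderiv C D f x"
    using has_derivative_unique[OF mdifferentiable_has_derivative[OF md] 1] .
qed

lemma mdifferentiable_ident:
  assumes C: "smooth_manifold C"
  shows "mdifferentiable C C (\<lambda>x. x) x" "mderiv C C (\<lambda>x. x) x u = u"
proof -
  note c = chart_at_in[OF C, of x]
  have 1: "(chart_rep (chart_at C x) (chart_at C x) (\<lambda>x. x) has_derivative chart_change (chart_at C x) (chart_at C x) x)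
      (at (cmap (chart_at C x) x))"
    unfolding chart_rep_id by (rule has_derivative_chart_change[OF C c(1,1,2,2)])
  then show md: "mdifferentiable C C (\<lambda>x. x) x"
    by (auto simp: mdifferentiable_def differentiable_def)
  show "mderiv C C (\<lambda>x. x) x u = u"
    using has_derivative_unique[OF mdifferentiable_has_derivative[OF md] 1] chart_change_self[OF C c] by simp
qed

lemma mderiv_const: "mderiv C D (\<lambda>x. k) x u = 0"
  by (simp add: mderiv_def o_def)

lemma smooth_map_chart:
  assumes C: "smooth_manifold C" and D: "smooth_manifold D" and f: "smooth_map C D S f" and S: "open S"
    and cd: "c \<in> C" "d \<in> D"
  shows "open (S \<inter> cdom c \<inter> f -` cdom d)"
    "open (cmap c ` (S \<inter> cdom c \<inter> f -` cdom d))"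
    "Ck_on k (cmap c ` (S \<inter> cdom c \<inter> f -` cdom d)) (chart_rep c d f)"
proof -
  have "open (S \<inter> f -` cdom d)"
    using f S open_cdom[OF D cd(2)] by (auto simp: smooth_map_def intro: continuous_open_preimage)
  from open_Int[OF this open_cdom[OF C cd(1)]]
  show "open (S \<inter> cdom c \<inter> f -` cdom d)"
    by (simp add: Int_ac)
  then show "open (cmap c ` (S \<inter> cdom c \<inter> f -` cdom d))"
    by (intro open_cmap_image[OF C cd(1)]) auto
  show "Ck_on k (cmap c ` (S \<inter> cdom c \<inter> f -` cdom d)) (chart_rep c d f)"
    using f cd by (auto simp: smooth_map_def smooth_on_def chart_rep_def)
qed

lemma smooth_map_mdifferentiable:
  assumes C: "smooth_manifold C" and D: "smooth_manifold D" and f: "smooth_map C D S f" and S: "open S" "x \<in> S"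
  shows "mdifferentiable C D f x"
proof -
  note c = chart_at_in[OF C, of x] and d = chart_at_in[OF D, of "f x"]
  have "(chart_rep (chart_at C x) (chart_at D (f x)) f has_derivative
      frechet_derivative (chart_rep (chart_at C x) (chart_at D (f x)) f) (at (cmap (chart_at C x) x))) (at (cmap (chart_at C x) x))"
    by (rule Ck_on_has_derivative[OF smooth_map_chart(3)[OF C D f S(1) c(1) d(1)]]) (use S c d in auto)
  moreover have "isCont f x"
    using f S by (auto simp: smooth_map_def continuous_on_eq_continuous_at)
  ultimately show ?thesis by (auto simp: mdifferentiable_def differentiable_def)
qed

section \<open>Products of manifolds\<close>

lemma cinv_prod:
  assumes C: "smooth_manifold C" "c \<in> C" and D: "smooth_manifold D" "d \<in> D" and yz: "y \<in> cimg c" "z \<in> cimg d"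
  shows "cinv (cdom c \<times> cdom d, map_prod (cmap c) (cmap d)) (y, z) = (cinv c y, cinv d z)"
  unfolding cinv_def[of "(_, _)"] fst_conv snd_conv
proof (rule inv_into_f_eq)
  show "inj_on (map_prod (cmap c) (cmap d)) (cdom c \<times> cdom d)"
    by (intro map_prod_inj_on inj_on_inverseI[where g = "cinv c"] inj_on_inverseI[where g = "cinv d"]
        cinv_cmap[OF C] cinv_cmap[OF D])
  show "(cinv c y, cinv d z) \<in> cdom c \<times> cdom d"
    using cinv_in[OF C] cinv_in[OF D] yz by simp
  show "map_prod (cmap c) (cmap d) (cinv c y, cinv d z) = (y, z)"
    using cmap_cinv[OF C] cmap_cinv[OF D] yz by simp
qed

lemma smooth_map_prod_chart:
  assumes C: "smooth_manifold C" "c \<in> C" and D: "smooth_manifold D" "d \<in> D" and E: "smooth_manifold E" "e \<in> E"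
    and f: "smooth_map (prod_atlas C D) E S f" and S: "open S"
  defines "W \<equiv> map_prod (cmap c) (cmap d) ` (S \<inter> (cdom c \<times> cdom d) \<inter> f -` cdom e)"
  shows "open W" "Ck_on k W (\<lambda>w. cmap e (f (cinv c (fst w), cinv d (snd w))))"
proof -
  have W: "W = (cimg c \<times> cimg d) \<inter> (\<lambda>w. (cinv c (fst w), cinv d (snd w))) -` (S \<inter> f -` cdom e)"
    (is "_ = ?I \<inter> ?h -` _")
  proof (intro equalityI subsetI)
    fix w assume "w \<in> W"
    then obtain x y where "(x, y) \<in> S" "x \<in> cdom c" "y \<in> cdom d" "f (x, y) \<in> cdom e" "w = (cmap c x, cmap d y)"
      unfolding W_def by auto
    then show "w \<in> ?I \<inter> ?h -` (S \<inter> f -` cdom e)"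
      using cinv_cmap[OF C, of x] cinv_cmap[OF D, of y] by simp
  next
    fix w assume w: "w \<in> ?I \<inter> ?h -` (S \<inter> f -` cdom e)"
    then have "w = map_prod (cmap c) (cmap d) (?h w)"
      using cmap_cinv[OF C, of "fst w"] cmap_cinv[OF D, of "snd w"] by (simp add: mem_Times_iff)
    moreover have "?h w \<in> S \<inter> (cdom c \<times> cdom d) \<inter> f -` cdom e"
      using w cinv_in[OF C, of "fst w"] cinv_in[OF D, of "snd w"] by (simp add: mem_Times_iff)
    ultimately show "w \<in> W"
      unfolding W_def by (rule image_eqI)
  qed
  have "open (S \<inter> f -` cdom e)"
    using f S open_cdom[OF E] by (auto simp: smooth_map_def intro: continuous_open_preimage)
  note op = this
  have cont: "continuous_on ?I ?h"
    by (intro continuous_intros continuous_on_compose2[OF continuous_on_cinv[OF C]]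
        continuous_on_compose2[OF continuous_on_cinv[OF D]]) auto
  show oW: "open W"
    unfolding W by (rule continuous_open_preimage[OF cont open_Times[OF open_cimg[OF C] open_cimg[OF D]] op])
  have "(cdom c \<times> cdom d, map_prod (cmap c) (cmap d)) \<in> prod_atlas C D"
    using C(2) D(2) unfolding prod_atlas_def by blast
  then have "Ck_on k W (cmap e \<circ> f \<circ> cinv (cdom c \<times> cdom d, map_prod (cmap c) (cmap d)))"
    using f E(2) unfolding smooth_map_def smooth_on_def W_def by fastforce
  then show "Ck_on k W (\<lambda>w. cmap e (f (cinv c (fst w), cinv d (snd w))))"
    by (rule Ck_on_cong[OF oW, THEN iffD1, rotated])
       (use cinv_prod[OF C D] W in auto)
qed

text \<open>The preferred charts of a product atlas need not be products of preferred charts.  Passing to slices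
reduces the differentiation of maps on a product to that of maps on its factors.\<close>

lemma smooth_map_slice_fst:
  assumes C: "smooth_manifold C" and D: "smooth_manifold D" and E: "smooth_manifold E"
    and f: "smooth_map (prod_atlas C D) E S f" and S: "open S"
  shows "smooth_map C E {x. (x, a) \<in> S} (\<lambda>x. f (x, a))"
  unfolding smooth_map_def smooth_on_def
proof (intro conjI ballI allI)
  have cf: "continuous_on S f" using f by (simp add: smooth_map_def)
  show cont: "continuous_on {x. (x, a) \<in> S} (\<lambda>x. f (x, a))"
    by (rule continuous_on_compose2[OF cf]) (auto intro!: continuous_intros)
  have op: "open {x. (x, a) \<in> S}"
    using open_vimage[OF S, of "\<lambda>x. (x, a)", OF continuous_on_Pair[OF continuous_on_id continuous_on_const]]
    by (simp add: vimage_def)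
  fix c e k assume c: "c \<in> C" and e: "e \<in> E"
  let ?d = "chart_at D a"
  note d = chart_at_in[OF D, of a]
  note W = smooth_map_prod_chart[OF C c D d(1) E e f S]
  let ?T = "{x. (x, a) \<in> S} \<inter> cdom c \<inter> (\<lambda>x. f (x, a)) -` cdom e"
  have opT: "open (cmap c ` ?T)"
  proof (rule open_cmap_image[OF C c])
    have "open ({x. (x, a) \<in> S} \<inter> (\<lambda>x. f (x, a)) -` cdom e)"
      by (rule continuous_open_preimage[OF cont op open_cdom[OF E e]])
    from open_Int[OF this open_cdom[OF C c]] show "open ?T" by (simp add: Int_ac)
  qed auto
  have "Ck_on k (cmap c ` ?T) (\<lambda>y. (\<lambda>w. cmap e (f (cinv c (fst w), cinv ?d (snd w)))) ((0, cmap ?d a) + (y, 0)))"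
  proof (rule Ck_on_affine[OF W _ opT])
    show "bounded_linear (\<lambda>y::'b. (y, 0::'d))"
      by (intro bounded_linear_Pair bounded_linear_ident bounded_linear_zero)
    fix y assume "y \<in> cmap c ` ?T"
    then obtain x where x: "x \<in> ?T" "y = cmap c x" by blast
    show "(0, cmap ?d a) + (y, 0) \<in> map_prod (cmap c) (cmap ?d) ` (S \<inter> (cdom c \<times> cdom ?d) \<inter> f -` cdom e)"
      by (rule image_eqI[of _ _ "(x, a)"]) (use x d in auto)
  qed
  then show "Ck_on k (cmap c ` ?T) (cmap e \<circ> (\<lambda>x. f (x, a)) \<circ> cinv c)"
    by (rule Ck_on_cong[OF opT, THEN iffD1, rotated]) (simp add: cinv_cmap[OF D d])
qed

lemma smooth_map_slice_snd:
  assumes C: "smooth_manifold C" and D: "smooth_manifold D" and E: "smooth_manifold E"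
    and f: "smooth_map (prod_atlas C D) E UNIV f"
  shows "smooth_map D E UNIV (\<lambda>y. f (a, y))"
  unfolding smooth_map_def smooth_on_def
proof (intro conjI ballI allI)
  have cf: "continuous_on UNIV f" using f by (simp add: smooth_map_def)
  show cont: "continuous_on UNIV (\<lambda>y. f (a, y))"
    by (rule continuous_on_compose2[OF cf]) (auto intro!: continuous_intros)
  fix d e k assume d: "d \<in> D" and e: "e \<in> E"
  let ?c = "chart_at C a"
  note c = chart_at_in[OF C, of a]
  note W = smooth_map_prod_chart[OF C c(1) D d E e f open_UNIV]
  let ?T = "UNIV \<inter> cdom d \<inter> (\<lambda>y. f (a, y)) -` cdom e"
  have opT: "open (cmap d ` ?T)"
  proof (rule open_cmap_image[OF D d])
    have "open (UNIV \<inter> (\<lambda>y. f (a, y)) -` cdom e)"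
      by (rule continuous_open_preimage[OF cont open_UNIV open_cdom[OF E e]])
    from open_Int[OF this open_cdom[OF D d]] show "open ?T" by (simp add: Int_ac)
  qed auto
  have "Ck_on k (cmap d ` ?T) (\<lambda>y. (\<lambda>w. cmap e (f (cinv ?c (fst w), cinv d (snd w)))) ((cmap ?c a, 0) + (0, y)))"
  proof (rule Ck_on_affine[OF W _ opT])
    show "bounded_linear (\<lambda>y::'d. (0::'b, y))"
      by (intro bounded_linear_Pair bounded_linear_ident bounded_linear_zero)
    fix y assume "y \<in> cmap d ` ?T"
    then obtain x where x: "x \<in> ?T" "y = cmap d x" by blast
    show "(cmap ?c a, 0) + (0, y) \<in> map_prod (cmap ?c) (cmap d) ` (UNIV \<inter> (cdom ?c \<times> cdom d) \<inter> f -` cdom e)"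
      by (rule image_eqI[of _ _ "(a, x)"]) (use x c in auto)
  qed
  then show "Ck_on k (cmap d ` ?T) (cmap e \<circ> (\<lambda>y. f (a, y)) \<circ> cinv d)"
    by (rule Ck_on_cong[OF opT, THEN iffD1, rotated]) (simp add: cinv_cmap[OF C c])
qed

section \<open>The exterior derivative of 1-forms on manifolds\<close>

lemma coord1_change:
  assumes C: "smooth_manifold C" "c \<in> C" "c' \<in> C" and x: "x \<in> cdom c" "x \<in> cdom c'"
  shows "coord1 C c \<beta> (cmap c x) u = coord1 C c' \<beta> (cmap c' x) (chart_change c c' x u)"
  using chart_change_compose[OF C chart_at_in(1)[OF C(1)] x chart_at_in(2)[OF C(1)]]
  by (simp add: coord1_def coord_vec_eq_chart_change cinv_cmap[OF C(1,2) x(1)] cinv_cmap[OF C(1,3) x(2)])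

lemma linear_coord1:
  assumes C: "smooth_manifold C" "c \<in> C" "y \<in> cimg c" and \<beta>: "\<And>x. linear (\<beta> x)"
  shows "linear (coord1 C c \<beta> y)"
proof -
  have "linear (\<beta> (cinv c y) \<circ> coord_vec C c (cinv c y))"
    by (rule linear_compose[OF linear_coord_vec \<beta>]) (use C cinv_in[OF C(1,2)] in auto)
  then show ?thesis by (simp add: coord1_def[abs_def] o_def)
qed

lemma coord1_differentiable:
  assumes C: "smooth_manifold C" "c \<in> C" "y \<in> cimg c" and \<beta>: "smooth_1form C \<beta>"
  shows "(\<lambda>y. coord1 C c \<beta> y u) differentiable (at y)"
proof -
  have "Ck_on (Suc 0) (cimg c) (\<lambda>y. coord1 C c \<beta> y u)"
    using C \<beta> unfolding smooth_1form_def smooth_on_def by blast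
  then show ?thesis using C(3) unfolding Ck_on.simps by blast
qed

lemma ext_d1_flat: "ext_d1 C \<alpha> x u v = flat_d (coord1 C (chart_at C x) \<alpha>) (cmap (chart_at C x) x) u v"
  by (simp add: ext_d1_def flat_d_def Let_def)

text \<open>The exterior derivative is defined in the preferred chart of each point, which jumps from point to
point.  Naturality under transition maps allows one fixed chart to be used on its whole domain.\<close>

lemma ext_d1_chart:
  fixes C :: "('m::{t2_space,second_countable_topology}, 'e::real_normed_vector) atlas"
  assumes fd: "fin_dim TYPE('e)" and C: "smooth_manifold C" "c \<in> C" "x \<in> cdom c" and \<beta>: "smooth_1form C \<beta>"
  shows "ext_d1 C \<beta> x (coord_vec C c x u) (coord_vec C c x v) = flat_d (coord1 C c \<beta>) (cmap c x) u v"
proof -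
  let ?c = "chart_at C x"
  let ?S = "cmap c ` (cdom c \<inter> cdom ?c)"
  note cx = chart_at_in[OF C(1), of x]
  note lin = linear_coord1[OF C(1) cx(1), of _ \<beta>]
  have "flat_d (coord1 C c \<beta>) (cmap c x) u v =
     flat_d (coord1 C ?c \<beta>) ((cmap ?c \<circ> cinv c) (cmap c x)) (frechet_derivative (cmap ?c \<circ> cinv c) (at (cmap c x)) u)
        (frechet_derivative (cmap ?c \<circ> cinv c) (at (cmap c x)) v)"
  proof (rule flat_d_pullback(2)[OF fd _ _ Ck_on_transition[OF C(1,2) cx(1)] open_cimg[OF C(1) cx(1)]])
    show "open ?S"
      by (rule open_cmap_image[OF C(1,2)]) (use open_cdom[OF C(1,2)] open_cdom[OF C(1) cx(1)] in auto)
    show "cmap c x \<in> ?S" using C cx by auto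
    show "(cmap ?c \<circ> cinv c) (cmap c x) \<in> cimg ?c" using C cx by (simp add: cinv_cmap)
    show "linear (coord1 C ?c \<beta> z)" if "z \<in> cimg ?c" for z
      by (rule lin[OF that]) (use \<beta> in \<open>auto simp: smooth_1form_def\<close>)
    show "(\<lambda>z. coord1 C ?c \<beta> z v) differentiable (at ((cmap ?c \<circ> cinv c) (cmap c x)))" for v
      by (rule coord1_differentiable[OF C(1) cx(1) _ \<beta>]) (use C cx in \<open>simp add: cinv_cmap\<close>)
    fix y u assume "y \<in> ?S"
    then obtain x' where x': "x' \<in> cdom c" "x' \<in> cdom ?c" "y = cmap c x'" by auto
    show "coord1 C c \<beta> y u =
       coord1 C ?c \<beta> ((cmap ?c \<circ> cinv c) y) (frechet_derivative (cmap ?c \<circ> cinv c) (at y) u)"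
      using coord1_change[OF C(1,2) cx(1) x'(1,2)] x'
      by (simp add: cinv_cmap[OF C(1,2)] chart_change_def)
  qed
  then show ?thesis
    by (simp add: ext_d1_flat coord_vec_def cinv_cmap[OF C])
qed

lemma ext_d1_pullback:
  fixes D :: "('n::{t2_space,second_countable_topology}, 'f::real_normed_vector) atlas"
  assumes fd: "fin_dim TYPE('f)" and C: "smooth_manifold C" and D: "smooth_manifold D"
    and f: "smooth_map C D UNIV f" and \<beta>: "smooth_1form D \<beta>"
    and \<alpha>: "\<And>x w. \<alpha> x w = \<beta> (f x) (mderiv C D f x w)"
  shows "ext_d1 C \<alpha> x u v = ext_d1 D \<beta> (f x) (mderiv C D f x u) (mderiv C D f x v)"
proof -
  let ?c = "chart_at C x" and ?d = "chart_at D (f x)"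
  let ?S = "cmap ?c ` (UNIV \<inter> cdom ?c \<inter> f -` cdom ?d)"
  note cx = chart_at_in[OF C, of x] and dx = chart_at_in[OF D, of "f x"]
  note S = smooth_map_chart[OF C D f open_UNIV cx(1) dx(1)]
  have fx: "chart_rep ?c ?d f (cmap ?c x) = cmap ?d (f x)"
    by (simp add: chart_rep_def cinv_cmap[OF C cx])
  have "flat_d (coord1 C ?c \<alpha>) (cmap ?c x) u v =
     flat_d (coord1 D ?d \<beta>) (chart_rep ?c ?d f (cmap ?c x)) (frechet_derivative (chart_rep ?c ?d f) (at (cmap ?c x)) u)
        (frechet_derivative (chart_rep ?c ?d f) (at (cmap ?c x)) v)"
  proof (rule flat_d_pullback(2)[OF fd S(2) _ S(3) open_cimg[OF D dx(1)]])
    show "cmap ?c x \<in> ?S" using cx dx by auto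
    show "chart_rep ?c ?d f (cmap ?c x) \<in> cimg ?d" using dx by (simp add: fx)
    show "linear (coord1 D ?d \<beta> z)" if "z \<in> cimg ?d" for z
      by (rule linear_coord1[OF D dx(1) that]) (use \<beta> in \<open>auto simp: smooth_1form_def\<close>)
    show "(\<lambda>z. coord1 D ?d \<beta> z v) differentiable (at (chart_rep ?c ?d f (cmap ?c x)))" for v
      by (rule coord1_differentiable[OF D dx(1) _ \<beta>]) (use dx in \<open>simp add: fx\<close>)
    fix y u assume y: "y \<in> ?S"
    then obtain x' where x': "x' \<in> cdom ?c" "f x' \<in> cdom ?d" "y = cmap ?c x'" by auto
    have "(chart_rep ?c ?d f has_derivative frechet_derivative (chart_rep ?c ?d f) (at (cmap ?c x'))) (at (cmap ?c x'))"
      by (rule Ck_on_has_derivative[OF S(3)]) (use y x' in auto)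
    moreover have "isCont f x'"
      using f by (auto simp: smooth_map_def continuous_on_eq_continuous_at)
    ultimately have "mderiv C D f x' (coord_vec C ?c x' u) =
        coord_vec D ?d (f x') (frechet_derivative (chart_rep ?c ?d f) (at (cmap ?c x')) u)"
      by (intro mdifferentiable_chart(2)[where f = f, OF C cx(1) x'(1) D dx(1) x'(2)])
    then show "coord1 C ?c \<alpha> y u = coord1 D ?d \<beta> (chart_rep ?c ?d f y) (frechet_derivative (chart_rep ?c ?d f) (at y) u)"
      using x' by (simp add: coord1_def \<alpha> chart_rep_def cinv_cmap[OF C cx(1)] cinv_cmap[OF D dx(1)])
  qed
  then show ?thesis
    by (simp add: ext_d1_flat fx mderiv_def flip: chart_rep_def)
qed

lemma ext_d1_bounded_linear:
  assumes C: "smooth_manifold C" and \<beta>: "smooth_1form C \<beta>" and L: "bounded_linear L"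
  shows "ext_d1 C (\<lambda>x w. L (\<beta> x w)) x u v = L (ext_d1 C \<beta> x u v)"
proof -
  have "flat_d (\<lambda>y u. L (coord1 C (chart_at C x) \<beta> y u)) (cmap (chart_at C x) x) u v =
     L (flat_d (coord1 C (chart_at C x) \<beta>) (cmap (chart_at C x) x) u v)"
    by (rule flat_d_bounded_linear[OF L coord1_differentiable[OF C _ _ \<beta>]])
       (use chart_at_in[OF C] in auto)
  moreover have "coord1 C (chart_at C x) (\<lambda>x w. L (\<beta> x w)) = (\<lambda>y u. L (coord1 C (chart_at C x) \<beta> y u))"
    by (simp add: coord1_def fun_eq_iff)
  ultimately show ?thesis by (simp add: ext_d1_flat)
qed

lemma ext_d1_bilinear:
  assumes C: "smooth_manifold C" and \<beta>: "smooth_1form C \<beta>"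
  shows "bilinear (ext_d1 C \<beta> x)"
proof -
  note c = chart_at_in[OF C, of x]
  have "bilinear (flat_d (coord1 C (chart_at C x) \<beta>) (cmap (chart_at C x) x))"
    by (rule flat_d_bilinear[OF open_cimg[OF C c(1)] _ linear_coord1[OF C c(1)] coord1_differentiable[OF C c(1) _ \<beta>]])
       (use c \<beta> in \<open>auto simp: smooth_1form_def\<close>)
  then show ?thesis
    by (simp add: ext_d1_flat[abs_def])
qed

lemma coord1_add_scale: "coord1 C c (\<lambda>x u. \<alpha> x u + t *\<^sub>R \<beta> x u) y u = coord1 C c \<alpha> y u + t *\<^sub>R coord1 C c \<beta> y u"
  by (simp add: coord1_def)

lemma smooth_1form_add_scale:
  assumes C: "smooth_manifold C" and \<alpha>: "smooth_1form C \<alpha>" and \<beta>: "smooth_1form C \<beta>"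
  shows "smooth_1form C (\<lambda>x u. \<alpha> x u + t *\<^sub>R \<beta> x u)"
  using \<alpha> \<beta> unfolding smooth_1form_def smooth_on_def coord1_add_scale
  by (auto intro!: linear_compose_add linear_compose_scale_right
      Ck_on_add[OF open_cimg[OF C]] Ck_on_linear[OF open_cimg[OF C] _ bounded_linear_scaleR_right])

section \<open>Principal bundles\<close>

locale smooth_principal_bundle =
  fixes P :: "('m::{t2_space,second_countable_topology}, 'e::euclidean_space,
               'g::{t2_space,second_countable_topology}, 'k::real_normed_vector,
               'p::{t2_space,second_countable_topology}, 'q::real_normed_vector) pbundle"
  assumes pb: "principal_bundle P"
begin

abbreviation "CM \<equiv> base_atlas P"
abbreviation "CG \<equiv> group_atlas P"
abbreviation "CP \<equiv> total_atlas P"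
abbreviation "GG \<equiv> group_str P"

lemma manifolds: "smooth_manifold CM" "smooth_manifold CG" "smooth_manifold CP"
  using pb by (auto simp: principal_bundle_def lie_group_def)

lemma group_UNIV: "group GG" "carrier GG = UNIV"
  using pb by (auto simp: principal_bundle_def lie_group_def)

lemma act: "gact P p \<one>\<^bsub>GG\<^esub> = p" "gact P (gact P p a) b = gact P p (a \<otimes>\<^bsub>GG\<^esub> b)"
    "bproj P (gact P p a) = bproj P p"
  using pb by (auto simp: principal_bundle_def)

lemma smooth_mult: "smooth_map CG CG UNIV (\<lambda>b. a \<otimes>\<^bsub>GG\<^esub> b)" "smooth_map CG CG UNIV (\<lambda>b. b \<otimes>\<^bsub>GG\<^esub> a)"
proof -
  have m: "smooth_map (prod_atlas CG CG) CG UNIV (\<lambda>(a, b). a \<otimes>\<^bsub>GG\<^esub> b)"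
    using pb by (auto simp: principal_bundle_def lie_group_def)
  show "smooth_map CG CG UNIV (\<lambda>b. a \<otimes>\<^bsub>GG\<^esub> b)"
    using smooth_map_slice_snd[OF manifolds(2,2,2) m, of a] by simp
  show "smooth_map CG CG UNIV (\<lambda>b. b \<otimes>\<^bsub>GG\<^esub> a)"
    using smooth_map_slice_fst[OF manifolds(2,2,2) m, of a] by simp
qed

lemma smooth_act: "smooth_map (prod_atlas CP CG) CP UNIV (\<lambda>(p, a). gact P p a)"
  using pb by (auto simp: principal_bundle_def)

lemma smooth_right_act: "smooth_map CP CP UNIV (\<lambda>p. gact P p a)"
  using smooth_map_slice_fst[OF manifolds(3,2,3) smooth_act, of a] by simp

lemma smooth_orbit: "smooth_map CG CP UNIV (gact P p)"
  using smooth_map_slice_snd[OF manifolds(3,2,3) smooth_act, of p] by simp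

lemma smooth_proj: "smooth_map CP CM UNIV (bproj P)"
  using pb by (auto simp: principal_bundle_def)

lemmas mdifferentiable_right_act = smooth_map_mdifferentiable[OF manifolds(3,3) smooth_right_act open_UNIV UNIV_I]
lemmas mdifferentiable_orbit = smooth_map_mdifferentiable[OF manifolds(2,3) smooth_orbit open_UNIV UNIV_I]
lemmas mdifferentiable_proj = smooth_map_mdifferentiable[OF manifolds(3,1) smooth_proj open_UNIV UNIV_I]

abbreviation vert :: "'p \<Rightarrow> 'k \<Rightarrow> 'q" where "vert p \<equiv> mderiv CG CP (gact P p) \<one>\<^bsub>GG\<^esub>"
abbreviation ract :: "'g \<Rightarrow> 'p \<Rightarrow> 'q \<Rightarrow> 'q" where "ract a p \<equiv> mderiv CP CP (\<lambda>p. gact P p a) p"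

lemma bounded_linear_bAd: "bounded_linear (bAd P a)"
proof -
  have "mdifferentiable CG CG ((\<lambda>b. b \<otimes>\<^bsub>GG\<^esub> inv\<^bsub>GG\<^esub> a) \<circ> (\<lambda>b. a \<otimes>\<^bsub>GG\<^esub> b)) \<one>\<^bsub>GG\<^esub>"
    by (intro mdifferentiable_compose(1)[OF manifolds(2,2)] smooth_map_mdifferentiable[OF manifolds(2,2) _ open_UNIV UNIV_I] smooth_mult)
  from linear_mderiv(1)[OF this] show ?thesis
    by (simp add: Ad_def o_def)
qed

lemma linear_bAd: "linear (bAd P a)"
  using bounded_linear_bAd bounded_linear.linear by blast

lemma linear_dproj: "linear (dproj P p)"
  by (rule linear_mderiv(2)[OF mdifferentiable_proj])

lemma linear_vert: "linear (vert p)"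
  by (rule linear_mderiv(2)) (metis act(1) mdifferentiable_orbit)

lemma dproj_vert: "dproj P p (vert p X) = 0"
proof -
  have "mderiv CG CM (bproj P \<circ> gact P p) \<one>\<^bsub>GG\<^esub> X = dproj P (gact P p \<one>\<^bsub>GG\<^esub>) (vert p X)"
    by (rule mdifferentiable_compose(2)[OF manifolds(2,3) mdifferentiable_orbit mdifferentiable_proj])
  moreover have "bproj P \<circ> gact P p = (\<lambda>a. bproj P p)"
    by (simp add: fun_eq_iff act)
  ultimately show ?thesis by (simp add: act mderiv_const)
qed

lemma dproj_ract: "dproj P (gact P p a) (ract a p w) = dproj P p w"
proof -
  have "mderiv CP CM (bproj P \<circ> (\<lambda>p. gact P p a)) p w = dproj P (gact P p a) (ract a p w)"
    by (rule mdifferentiable_compose(2)[OF manifolds(3,3) mdifferentiable_right_act mdifferentiable_proj])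
  moreover have "bproj P \<circ> (\<lambda>p. gact P p a) = bproj P"
    by (simp add: fun_eq_iff act)
  ultimately show ?thesis by simp
qed

lemma local_trivialisation:
  obtains U \<psi> where "open U" "x \<in> U"
    "diffeo CP (prod_atlas CM CG) (bproj P -` U) (U \<times> UNIV) \<psi>"
    "\<And>p. bproj P p \<in> U \<Longrightarrow> fst (\<psi> p) = bproj P p"
    "\<And>p a. bproj P p \<in> U \<Longrightarrow> snd (\<psi> (gact P p a)) = snd (\<psi> p) \<otimes>\<^bsub>GG\<^esub> a"
proof -
  have "\<exists>U \<psi>. open U \<and> x \<in> U \<and>
        diffeo CP (prod_atlas CM CG) (bproj P -` U) (U \<times> UNIV) \<psi> \<and>
        (\<forall>p\<in>bproj P -` U. fst (\<psi> p) = bproj P p \<and>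
           (\<forall>a. snd (\<psi> (gact P p a)) = snd (\<psi> p) \<otimes>\<^bsub>GG\<^esub> a))"
    using pb unfolding principal_bundle_def by blast
  then show thesis using that by (metis vimageI)
qed

lemma bproj_surj: "\<exists>p. bproj P p = x"
proof -
  obtain U \<psi> where U: "open U" "x \<in> U"
    "diffeo CP (prod_atlas CM CG) (bproj P -` U) (U \<times> UNIV) \<psi>"
    "\<And>p. bproj P p \<in> U \<Longrightarrow> fst (\<psi> p) = bproj P p"
    using local_trivialisation[of x] by metis
  have "bij_betw \<psi> (bproj P -` U) (U \<times> UNIV)"
    using U(3) by (simp add: diffeo_def)
  then obtain p where "p \<in> bproj P -` U" "\<psi> p = (x, undefined)"
    using U(2) unfolding bij_betw_def by (metis SigmaI UNIV_I imageE)
  then show ?thesis using U(4)[of p] by auto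
qed

lemma same_fibre:
  assumes "bproj P p = bproj P p'"
  shows "\<exists>a. p' = gact P p a"
proof -
  obtain U \<psi> where U: "open U" "bproj P p \<in> U"
    "diffeo CP (prod_atlas CM CG) (bproj P -` U) (U \<times> UNIV) \<psi>"
    "\<And>p. bproj P p \<in> U \<Longrightarrow> fst (\<psi> p) = bproj P p"
    "\<And>p a. bproj P p \<in> U \<Longrightarrow> snd (\<psi> (gact P p a)) = snd (\<psi> p) \<otimes>\<^bsub>GG\<^esub> a"
    using local_trivialisation[of "bproj P p"] by metis
  interpret G: group GG by (rule group_UNIV)
  \<comment> \<open>Right translation by \<open>a\<close> carries the group coordinate of \<open>p\<close> to that of \<open>p'\<close>.\<close>
  define a where "a = inv\<^bsub>GG\<^esub> (snd (\<psi> p)) \<otimes>\<^bsub>GG\<^esub> snd (\<psi> p')"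
  have inj: "inj_on \<psi> (bproj P -` U)"
    using U(3) by (simp add: diffeo_def bij_betw_def)
  have "snd (\<psi> (gact P p a)) = snd (\<psi> p')"
    using U(2,5) by (simp add: a_def group_UNIV(2) flip: G.m_assoc)
  moreover have "fst (\<psi> (gact P p a)) = fst (\<psi> p')"
    using U(2,4) assms by (simp add: act)
  ultimately have "\<psi> (gact P p a) = \<psi> p'" by (rule prod_eqI[rotated])
  then have "gact P p a = p'"
    using inj U(2) assms by (auto simp: inj_on_def act)
  then show ?thesis by blast
qed

text \<open>The section is \<open>\<psi>\<^sup>-\<^sup>1(x, a)\<close> for the constant \<open>a\<close> that makes it pass through \<open>p\<close>.\<close>

lemma local_section:
  obtains U s where "open U" "bproj P p \<in> U" "smooth_map CM CP U s" "s (bproj P p) = p"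
    "\<And>x. x \<in> U \<Longrightarrow> bproj P (s x) = x"
proof -
  obtain U \<psi> where U: "open U" "bproj P p \<in> U"
    "diffeo CP (prod_atlas CM CG) (bproj P -` U) (U \<times> UNIV) \<psi>"
    "\<And>p. bproj P p \<in> U \<Longrightarrow> fst (\<psi> p) = bproj P p"
    using local_trivialisation[of "bproj P p"] by metis
  let ?i = "inv_into (bproj P -` U) \<psi>"
  have bij: "bij_betw \<psi> (bproj P -` U) (U \<times> UNIV)"
    and i: "smooth_map (prod_atlas CM CG) CP (U \<times> UNIV) ?i"
    using U(3) by (auto simp: diffeo_def)
  have ii: "?i (x, a) \<in> bproj P -` U" "\<psi> (?i (x, a)) = (x, a)" if "x \<in> U" for x a
    using bij_betw_inv_into_right[OF bij] inv_into_into[of "(x, a)" \<psi> "bproj P -` U"] that bij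
    unfolding bij_betw_def by auto
  show thesis
  proof (rule that[of U "\<lambda>x. ?i (x, snd (\<psi> p))"])
    show "smooth_map CM CP U (\<lambda>x. ?i (x, snd (\<psi> p)))"
      using smooth_map_slice_fst[OF manifolds(1,2,3) i open_Times[OF U(1) open_UNIV], of "snd (\<psi> p)"] by simp
    have "(bproj P p, snd (\<psi> p)) = \<psi> p" using U(2,4) by (intro prod_eqI) auto
    then show "?i (bproj P p, snd (\<psi> p)) = p"
      using bij_betw_inv_into_left[OF bij] U(2) by simp
    show "bproj P (?i (x, snd (\<psi> p))) = x" if "x \<in> U" for x
      using ii[OF that, of "snd (\<psi> p)"] U(4)[of "?i (x, snd (\<psi> p))"] by auto
  qed (use U in auto)
qed

text \<open>The differentials of a local trivialisation and of its inverse.  The last property holds because the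
inverse, restricted to the fibre, is the orbit map of \<open>p\<close> after a left translation of the group.\<close>

lemma differential_of_trivialisation:
  obtains D :: "'q \<Rightarrow> 'e \<times> 'k" and T :: "'e \<times> 'k \<Rightarrow> 'q"
  where "bounded_linear D" "bounded_linear T" "\<And>w. T (D w) = w" "\<And>w. fst (D w) = dproj P p w"
    "\<And>X. \<exists>Y. T (0, X) = vert p Y"
proof -
  obtain U \<psi> where U: "open U" "bproj P p \<in> U"
    "diffeo CP (prod_atlas CM CG) (bproj P -` U) (U \<times> UNIV) \<psi>"
    "\<And>p. bproj P p \<in> U \<Longrightarrow> fst (\<psi> p) = bproj P p"
    "\<And>p a. bproj P p \<in> U \<Longrightarrow> snd (\<psi> (gact P p a)) = snd (\<psi> p) \<otimes>\<^bsub>GG\<^esub> a"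
    using local_trivialisation[of "bproj P p"] by metis
  interpret G: group GG by (rule group_UNIV)
  let ?V = "bproj P -` U"
  let ?i = "inv_into ?V \<psi>"
  define x a where "x = bproj P p" and "a = snd (\<psi> p)"
  let ?x = "chart_at CM x" and ?a = "chart_at CG a" and ?p = "chart_at CP p"
  note cx = chart_at_in[OF manifolds(1), of x] and ca = chart_at_in[OF manifolds(2), of a]
    and cp = chart_at_in[OF manifolds(3), of p]
  have bij: "bij_betw \<psi> ?V (U \<times> UNIV)" and \<psi>: "smooth_map CP (prod_atlas CM CG) ?V \<psi>"
    and i: "smooth_map (prod_atlas CM CG) CP (U \<times> UNIV) ?i"
    using U(3) by (auto simp: diffeo_def)
  have \<psi>p: "\<psi> p = (x, a)" using U(2,4) by (intro prod_eqI) (auto simp: x_def a_def)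
  have opV: "open ?V"
    using smooth_proj U(1) by (auto simp: smooth_map_def intro: open_vimage)
  have i\<psi>: "?i (\<psi> p') = p'" if "bproj P p' \<in> U" for p'
    using bij_betw_inv_into_left[OF bij] that by simp

  let ?S = "?V \<inter> cdom ?p \<inter> \<psi> -` (cdom ?x \<times> cdom ?a)"
  define \<Psi> where "\<Psi> = map_prod (cmap ?x) (cmap ?a) \<circ> \<psi> \<circ> cinv ?p"
  have opS: "open ?S" "p \<in> ?S"
  proof -
    have "open (?V \<inter> \<psi> -` (cdom ?x \<times> cdom ?a))"
      using \<psi> opV open_Times[OF open_cdom[OF manifolds(1) cx(1)] open_cdom[OF manifolds(2) ca(1)]]
      by (auto simp: smooth_map_def intro: continuous_open_preimage)
    from open_Int[OF this open_cdom[OF manifolds(3) cp(1)]]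
    show "open ?S" by (simp add: Int_ac)
    show "p \<in> ?S" using U(2) cp cx ca by (simp add: \<psi>p)
  qed
  have "(cdom ?x \<times> cdom ?a, map_prod (cmap ?x) (cmap ?a)) \<in> prod_atlas CM CG"
    using cx(1) ca(1) unfolding prod_atlas_def by blast
  then have "Ck_on (Suc 0) (cmap ?p ` ?S) \<Psi>"
    using \<psi> cp(1) unfolding smooth_map_def smooth_on_def \<Psi>_def by fastforce
  from Ck_on_has_derivative[OF this imageI[OF opS(2)]]
  obtain D where D: "(\<Psi> has_derivative D) (at (cmap ?p p))" by blast

  define \<Theta> where "\<Theta> w = cmap ?p (?i (cinv ?x (fst w), cinv ?a (snd w)))" for w
  have \<Psi>p: "\<Psi> (cmap ?p p) = (cmap ?x x, cmap ?a a)"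
    by (simp add: \<Psi>_def cinv_cmap[OF manifolds(3) cp] \<psi>p)
  have "Ck_on (Suc 0) (map_prod (cmap ?x) (cmap ?a) ` ((U \<times> UNIV) \<inter> (cdom ?x \<times> cdom ?a) \<inter> ?i -` cdom ?p)) \<Theta>"
    unfolding \<Theta>_def[abs_def]
    by (rule smooth_map_prod_chart(2)[OF manifolds(1) cx(1) manifolds(2) ca(1) manifolds(3) cp(1) i open_Times[OF U(1) open_UNIV]])
  moreover have "(cmap ?x x, cmap ?a a) \<in> map_prod (cmap ?x) (cmap ?a) ` ((U \<times> UNIV) \<inter> (cdom ?x \<times> cdom ?a) \<inter> ?i -` cdom ?p)"
    by (rule image_eqI[of _ _ "(x, a)"]) (use U(2) cx ca cp i\<psi>[of p] in \<open>auto simp: x_def \<psi>p\<close>)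
  ultimately have "(\<Theta> has_derivative frechet_derivative \<Theta> (at (cmap ?x x, cmap ?a a))) (at (cmap ?x x, cmap ?a a))"
    by (rule Ck_on_has_derivative)
  then obtain T where T: "(\<Theta> has_derivative T) (at (cmap ?x x, cmap ?a a))" by blast

  have nearS: "\<forall>\<^sub>F y in nhds (cmap ?p p). y \<in> cimg ?p \<and> cinv ?p y \<in> ?S"
    by (rule eventually_nhds_chart[OF manifolds(3) cp]) (rule eventually_nhds_in_open[OF opS])
  show thesis
  proof (rule that[of D T])
    show "bounded_linear D" "bounded_linear T"
      using D T has_derivative_bounded_linear by blast+
    have 1: "((\<Theta> \<circ> \<Psi>) has_derivative T \<circ> D) (at (cmap ?p p))"
      by (rule diff_chain_at[OF D]) (simp add: \<Psi>p T)
    have "\<forall>\<^sub>F y in nhds (cmap ?p p). y = (\<Theta> \<circ> \<Psi>) y"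
      using nearS
    proof eventually_elim
      case (elim y)
      then have "\<psi> (cinv ?p y) \<in> cdom ?x \<times> cdom ?a" "bproj P (cinv ?p y) \<in> U" "y \<in> cimg ?p" by auto
      then show ?case
        by (auto simp: \<Theta>_def \<Psi>_def cinv_cmap[OF manifolds(1) cx(1)] cinv_cmap[OF manifolds(2) ca(1)] mem_Times_iff
            i\<psi> cmap_cinv[OF manifolds(3) cp(1)])
    qed
    then have "((\<Theta> \<circ> \<Psi>) has_derivative (\<lambda>w. w)) (at (cmap ?p p))"
      by (rule has_derivative_eventually_eq[OF has_derivative_ident])
    from has_derivative_unique[OF 1 this] show "T (D w) = w" for w
      by (simp add: fun_eq_iff)
    have "\<forall>\<^sub>F y in nhds (cmap ?p p). fst (\<Psi> y) = chart_rep ?p ?x (bproj P) y"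
      using nearS by eventually_elim (use U(4) in \<open>simp add: \<Psi>_def chart_rep_def\<close>)
    then have "(chart_rep ?p ?x (bproj P) has_derivative (\<lambda>w. fst (D w))) (at (cmap ?p p))"
      by (rule has_derivative_eventually_eq[OF has_derivative_fst[OF D]])
    from has_derivative_unique[OF this mdifferentiable_has_derivative[OF mdifferentiable_proj[of p], folded x_def]]
    show "fst (D w) = dproj P p w" for w
      by (simp add: fun_eq_iff x_def)
    fix X
    \<comment> \<open>\<open>\<psi> p = (x, a)\<close>, so by equivariance of \<open>\<psi>\<close> the point of the fibre with group coordinate \<open>b\<close> is \<open>p a\<^sup>-\<^sup>1 b\<close>.\<close>
    let ?f = "gact P p \<circ> (\<lambda>b. inv\<^bsub>GG\<^esub> a \<otimes>\<^bsub>GG\<^esub> b)"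
    have fa: "inv\<^bsub>GG\<^esub> a \<otimes>\<^bsub>GG\<^esub> a = \<one>\<^bsub>GG\<^esub>" by (simp add: group_UNIV(2))
    have m1: "mdifferentiable CG CG (\<lambda>b. inv\<^bsub>GG\<^esub> a \<otimes>\<^bsub>GG\<^esub> b) a"
      by (rule smooth_map_mdifferentiable[OF manifolds(2,2) smooth_mult(1) open_UNIV UNIV_I])
    have md: "mdifferentiable CG CP ?f a" and mf: "mderiv CG CP ?f a X = vert p (mderiv CG CG (\<lambda>b. inv\<^bsub>GG\<^esub> a \<otimes>\<^bsub>GG\<^esub> b) a X)"
      using mdifferentiable_compose[OF manifolds(2,2) m1 mdifferentiable_orbit, of p] by (auto simp: fa)
    have fp: "?f a = p" by (simp add: fa act)
    have "?i (x, b) = ?f b" for b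
    proof (rule inv_into_f_eq)
      show "inj_on \<psi> ?V" using bij by (simp add: bij_betw_def)
      show "?f b \<in> ?V" using U(2) by (simp add: act)
      show "\<psi> (?f b) = (x, b)"
        using U(2) U(4)[of "?f b"] U(5)[of p "inv\<^bsub>GG\<^esub> a \<otimes>\<^bsub>GG\<^esub> b"]
        by (intro prod_eqI) (simp_all add: act x_def group_UNIV(2) flip: a_def G.m_assoc)
    qed
    then have eq: "(\<lambda>z. \<Theta> (cmap ?x x, z)) = chart_rep ?a (chart_at CP (?f a)) ?f"
      unfolding fp by (simp add: \<Theta>_def chart_rep_def fun_eq_iff cinv_cmap[OF manifolds(1) cx])
    have "((\<lambda>z. \<Theta> (cmap ?x x, z)) has_derivative (\<lambda>X. T (0, X))) (at (cmap ?a a))"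
      by (rule has_derivative_compose[where f = "\<lambda>z. (cmap ?x x, z)", OF _ T]) (auto intro!: derivative_eq_intros)
    from has_derivative_unique[OF this[unfolded eq] mdifferentiable_has_derivative[OF md]]
    have "T (0, X) = mderiv CG CP ?f a X" by (simp add: fun_eq_iff)
    then show "\<exists>Y. T (0, X) = vert p Y" using mf by auto
  qed
qed

text \<open>The kernel of the differential of the projection consists of the fundamental vectors.  This is what
makes horizontal lifts unique.\<close>

lemma vertical_vectors:
  assumes "dproj P p w = 0"
  shows "\<exists>X. w = vert p X"
proof -
  obtain D :: "'q \<Rightarrow> 'e \<times> 'k" and T where DT: "\<And>w. T (D w) = w" "\<And>w. fst (D w) = dproj P p w"
    "\<And>X. \<exists>Y. T (0, X) = vert p Y"
    using differential_of_trivialisation[of p] by metis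
  have "D w = (0, snd (D w))" using assms DT(2)[of w] by (simp add: prod_eq_iff)
  then show ?thesis using DT(1)[of w] DT(3)[of "snd (D w)"] by metis
qed

lemma fin_dim_total:
  assumes "fin_dim TYPE('k)"
  shows "fin_dim TYPE('q)"
proof -
  obtain D :: "'q \<Rightarrow> 'e \<times> 'k" and T where DT: "bounded_linear D" "bounded_linear T" "\<And>w. T (D w) = w"
    using differential_of_trivialisation by metis
  show ?thesis
    by (rule fin_dim_retract[OF fin_dim_prod[OF fin_dim_euclidean assms] bounded_linear.linear[OF DT(2)] DT(1,3)])
qed

text \<open>The added form vanishes on fundamental vectors, as these project to zero, and it is equivariant.\<close>

lemma connection_shift:
  assumes A: "connection P A" and \<eta>: "ad_1form P \<eta>"
  shows "connection P (shift_connection P A t \<eta>)"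
  unfolding connection_def
proof (intro conjI allI)
  have l: "linear (\<eta> p)" for p using \<eta> by (simp add: ad_1form_def)
  have "smooth_1form CP (\<lambda>p w. A p w + t *\<^sub>R \<eta> p (dproj P p w))"
    using A \<eta> by (intro smooth_1form_add_scale manifolds) (auto simp: connection_def ad_1form_def)
  then show "smooth_1form CP (shift_connection P A t \<eta>)"
    by (simp add: shift_connection_def[abs_def])
  show "shift_connection P A t \<eta> p (vert p X) = X" for p X
    using A by (simp add: shift_connection_def connection_def dproj_vert linear_0[OF l])
  show "shift_connection P A t \<eta> (gact P p a) (ract a p w) =
      bAd P (inv\<^bsub>GG\<^esub> a) (shift_connection P A t \<eta> p w)" for p a w
    using A \<eta> by (simp add: shift_connection_def connection_def dproj_ract ad_1form_def
        linear_add[OF linear_bAd] linear_scale[OF linear_bAd])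
qed

end

section \<open>Connections, horizontal lifts and curvature\<close>

locale metric_bundle = smooth_principal_bundle P
  for P :: "('m::{t2_space,second_countable_topology}, 'e::euclidean_space,
               'g::{t2_space,second_countable_topology}, 'k::real_normed_vector,
               'p::{t2_space,second_countable_topology}, 'q::real_normed_vector) pbundle" +
  fixes ip :: "'k \<Rightarrow> 'k \<Rightarrow> real"
  assumes Ad_ip: "Ad_invariant_inner (group_atlas P) (group_str P) ip"
begin

lemma ip: "inner_product ip"
  using Ad_ip by (simp add: Ad_invariant_inner_def inner_product_def)

lemma ip_bAd: "ip (bAd P a X) (bAd P a Y) = ip X Y"
  using Ad_ip by (simp add: Ad_invariant_inner_def)

lemma fin_dim_k: "fin_dim TYPE('k)"
proof -
  obtain S :: "'k set" where "finite S" "span S = UNIV"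
    using manifolds(2) unfolding smooth_manifold_def by blast
  then show ?thesis by (rule fin_dim_inner_product[OF ip])
qed

lemmas fin_dim_q = fin_dim_total[OF fin_dim_k]

definition equivariant :: "('p \<Rightarrow> 'e \<Rightarrow> 'e \<Rightarrow> 'k) \<Rightarrow> bool" where
  "equivariant \<alpha> \<longleftrightarrow> (\<forall>p a u v. \<alpha> (gact P p a) u v = bAd P (inv\<^bsub>group_str P\<^esub> a) (\<alpha> p u v))"

text \<open>The points of a fibre form one orbit, and the inner product is Ad-invariant.\<close>

lemma norm_sq_2form_at:
  assumes "equivariant \<alpha>"
  shows "norm_sq_2form P g ip \<alpha> (bproj P p) = inner_2form (g (bproj P p)) ip (\<alpha> p) (\<alpha> p)"
proof -
  let ?p = "SOME p'. bproj P p' = bproj P p"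
  have "bproj P ?p = bproj P p" by (rule someI) simp
  then obtain a where "?p = gact P p a" using same_fibre[of p ?p] by metis
  then show ?thesis
    using assms by (simp add: norm_sq_2form_def Let_def inner_2form_def equivariant_def ip_bAd)
qed

end

locale bundle_connection = metric_bundle P ip
  for P :: "('m::{t2_space,second_countable_topology}, 'e::euclidean_space,
               'g::{t2_space,second_countable_topology}, 'k::real_normed_vector,
               'p::{t2_space,second_countable_topology}, 'q::real_normed_vector) pbundle"
   and ip :: "'k \<Rightarrow> 'k \<Rightarrow> real" +
  fixes B :: "'p \<Rightarrow> 'q \<Rightarrow> 'k"
  assumes connection: "connection P B"
begin

lemma B: "smooth_1form CP B" "linear (B p)" "B p (vert p X) = X"
    "B (gact P p a) (ract a p w) = bAd P (inv\<^bsub>GG\<^esub> a) (B p w)"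
  using connection by (auto simp: connection_def smooth_1form_def)

abbreviation "hl \<equiv> horizontal_lift P B"

lemma horizontal_vector_eq_0:
  assumes "dproj P p w = 0" "B p w = 0"
  shows "w = 0"
  using vertical_vectors[OF assms(1)] assms(2) linear_0[OF linear_vert] B(3) by metis

lemma horizontal_lift_eqI:
  assumes "dproj P p w = u" "B p w = 0"
  shows "hl p u = w"
  unfolding horizontal_lift_def
proof (rule the_equality)
  fix w' assume w': "dproj P p w' = u \<and> B p w' = 0"
  have "w' - w = 0"
    by (rule horizontal_vector_eq_0[of p])
       (use assms w' in \<open>simp_all add: linear_diff[OF linear_dproj] linear_diff[OF B(2)]\<close>)
  then show "w' = w" by simp
qed (use assms in simp)

text \<open>As \<open>s\<close> is a section, \<open>ds(u)\<close> projects to \<open>u\<close>.  Subtracting the fundamental vector on which the connection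
form takes the value \<open>B(ds(u))\<close> makes it horizontal without changing the projection.\<close>

lemma horizontal_lift_section:
  assumes U: "open U" "x \<in> U" and s: "smooth_map CM CP U s" "\<And>x. x \<in> U \<Longrightarrow> bproj P (s x) = x"
  defines "w \<equiv> \<lambda>u. mderiv CM CP s x u - vert (s x) (B (s x) (mderiv CM CP s x u))"
  shows "hl (s x) u = w u" "dproj P (s x) (w u) = u" "B (s x) (w u) = 0"
proof -
  have "\<forall>\<^sub>F x in nhds x. x = (bproj P \<circ> s) x"
    using eventually_nhds_in_open[OF U] by eventually_elim (simp add: s)
  from mderiv_cong(2)[OF manifolds(1) mdifferentiable_ident(1)[OF manifolds(1)] this]
  have "mderiv CM CM (bproj P \<circ> s) x u = u"
    by (simp add: mdifferentiable_ident(2)[OF manifolds(1)] o_def)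
  moreover have "mderiv CM CM (bproj P \<circ> s) x u = dproj P (s x) (mderiv CM CP s x u)"
    by (rule mdifferentiable_compose(2)[OF manifolds(1,3) smooth_map_mdifferentiable[OF manifolds(1,3) s(1) U] mdifferentiable_proj])
  ultimately show 1: "dproj P (s x) (w u) = u"
    by (simp add: w_def linear_diff[OF linear_dproj] dproj_vert)
  show 2: "B (s x) (w u) = 0"
    by (simp add: w_def linear_diff[OF B(2)] B(3))
  show "hl (s x) u = w u"
    by (rule horizontal_lift_eqI[OF 1 2])
qed

lemma horizontal_lift: "dproj P p (hl p u) = u" "B p (hl p u) = 0"
proof -
  obtain U s where s: "open U" "bproj P p \<in> U" "smooth_map CM CP U s" "s (bproj P p) = p"
    "\<And>x. x \<in> U \<Longrightarrow> bproj P (s x) = x"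
    using local_section[of p] by metis
  show "dproj P p (hl p u) = u" "B p (hl p u) = 0"
    using horizontal_lift_section[OF s(1,2,3,5)] s(4) by simp_all
qed

lemma linear_horizontal_lift: "linear (hl p)"
  by (rule linearI; rule horizontal_lift_eqI)
     (simp_all add: linear_add[OF linear_dproj] linear_add[OF B(2)] linear_scale[OF linear_dproj]
       linear_scale[OF B(2)] horizontal_lift)

text \<open>\<open>[B, B]\<close> vanishes on horizontal vectors.\<close>

lemma curvature_eq: "curvature P B p u v = ext_d1 CP B p (hl p u) (hl p v)"
  by (simp add: curvature_def curvature_form_def bracket_form_def horizontal_lift)

lemma curvature_bilinear: "bilinear (curvature P B p)"
proof -
  have b: "bilinear (ext_d1 CP B p)" by (rule ext_d1_bilinear[OF manifolds(3) B(1)])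
  have "linear (ext_d1 CP B p (hl p u) \<circ> hl p)" for u
    using b by (intro linear_compose[OF linear_horizontal_lift]) (simp add: bilinear_def)
  moreover have "linear ((\<lambda>w. ext_d1 CP B p w (hl p v)) \<circ> hl p)" for v
    using b by (intro linear_compose[OF linear_horizontal_lift]) (simp add: bilinear_def)
  ultimately show ?thesis
    by (simp add: bilinear_def curvature_eq[abs_def] o_def)
qed

lemma horizontal_lift_right_act: "hl (gact P p a) u = ract a p (hl p u)"
  by (rule horizontal_lift_eqI) (simp_all add: dproj_ract B(4) horizontal_lift linear_0[OF linear_bAd])

text \<open>\<open>R\<^sub>a\<^sup>* B = Ad(a\<^sup>-\<^sup>1) B\<close>, and \<open>d\<close> commutes both with pull-back by \<open>R\<^sub>a\<close> and with the constant linear map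
\<open>Ad(a\<^sup>-\<^sup>1)\<close>.\<close>

lemma curvature_equivariant: "equivariant (curvature P B)"
  unfolding equivariant_def
proof (intro allI)
  fix p a u v
  let ?\<alpha> = "\<lambda>p w. bAd P (inv\<^bsub>GG\<^esub> a) (B p w)"
  have "ext_d1 CP ?\<alpha> p (hl p u) (hl p v) =
      ext_d1 CP B (gact P p a) (ract a p (hl p u)) (ract a p (hl p v))"
    by (rule ext_d1_pullback[OF fin_dim_q manifolds(3,3) smooth_right_act B(1)]) (simp add: B(4))
  moreover have "ext_d1 CP ?\<alpha> p (hl p u) (hl p v) =
      bAd P (inv\<^bsub>GG\<^esub> a) (ext_d1 CP B p (hl p u) (hl p v))"
    by (rule ext_d1_bounded_linear[OF manifolds(3) B(1) bounded_linear_bAd])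
  ultimately show "curvature P B (gact P p a) u v = bAd P (inv\<^bsub>GG\<^esub> a) (curvature P B p u v)"
    by (simp add: curvature_eq horizontal_lift_right_act)
qed

end

section \<open>Continuity of the energy densities\<close>

context bundle_connection
begin

text \<open>Along a smooth section \<open>s\<close> through \<open>p\<close>, horizontal lifts are \<open>ds(u) - vert (B(ds(u)))\<close> and the curvature is
\<open>dB\<close> on them.  Each ingredient, expressed in one chart of the base, one of the total space and one
of the group near the identity, is continuous for fixed vectors, and therefore jointly continuous.\<close>

lemma curvature_locally_continuous:
  obtains U s where "open U" "bproj P p \<in> U" "\<And>x. x \<in> U \<Longrightarrow> bproj P (s x) = x"
    "U \<subseteq> cdom (chart_at CM (bproj P p))"
    "\<And>u v. continuous_on U (\<lambda>x. curvature P B (s x)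
       (coord_vec CM (chart_at CM (bproj P p)) x u) (coord_vec CM (chart_at CM (bproj P p)) x v))"
proof -
  obtain U s where U: "open U" "bproj P p \<in> U" and s: "smooth_map CM CP U s" "s (bproj P p) = p"
    "\<And>x. x \<in> U \<Longrightarrow> bproj P (s x) = x"
    using local_section[of p] by metis
  let ?c = "chart_at CM (bproj P p)" and ?d = "chart_at CP p" and ?e = "chart_at CG \<one>\<^bsub>GG\<^esub>"
  note c = chart_at_in[OF manifolds(1), of "bproj P p"] and d = chart_at_in[OF manifolds(3), of p]
    and e = chart_at_in[OF manifolds(2), of "\<one>\<^bsub>GG\<^esub>"]
  \<comment> \<open>The part of the domain on which one chart of the base and one of the total space suffice.\<close>
  define V where "V = U \<inter> cdom ?c \<inter> s -` cdom ?d"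
  note V = smooth_map_chart[OF manifolds(1,3) s(1) U(1) c(1) d(1), folded V_def]
  have sub: "V \<subseteq> cdom ?c" by (auto simp: V_def)
  let ?S = "cmap ?c ` V"
  define \<sigma> where "\<sigma> = chart_rep ?c ?d s"
  define D\<sigma> where "D\<sigma> y u = frechet_derivative \<sigma> (at y) u" for y u
  have \<sigma>1: "Ck_on (Suc 0) ?S \<sigma>" unfolding \<sigma>_def by (rule V(3))
  have \<sigma>_x: "\<sigma> (cmap ?c x) = cmap ?d (s x)" if "x \<in> V" for x
    using cinv_cmap[OF manifolds(1) c(1), of x] that sub by (auto simp: \<sigma>_def chart_rep_def)
  have cont_\<sigma>: "continuous_on ?S \<sigma>" by (rule Ck_on_imp_continuous[OF \<sigma>1])
  have \<sigma>_img: "\<sigma> ` ?S \<subseteq> cimg ?d" using \<sigma>_x by (auto simp: V_def)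
  have cont_D\<sigma>: "continuous_on ?S (\<lambda>y. D\<sigma> y u)" for u
    using \<sigma>1 by (simp add: D\<sigma>_def)
  have dif_\<sigma>: "(\<sigma> has_derivative D\<sigma> y) (at y)" if "y \<in> ?S" for y
    unfolding D\<sigma>_def[abs_def] by (rule Ck_on_has_derivative[OF \<sigma>1 that])
  have lin_D\<sigma>: "linear (D\<sigma> y)" if "y \<in> ?S" for y
    using dif_\<sigma>[OF that] by (rule has_derivative_linear)
  have ds: "mderiv CM CP s x (coord_vec CM ?c x u) = coord_vec CP ?d (s x) (D\<sigma> (cmap ?c x) u)" if x: "x \<in> V" for x u
  proof (rule mdifferentiable_chart(2)[OF manifolds(1) c(1) _ manifolds(3) d(1)])
    show "isCont s x"
      using s(1) U(1) x by (auto simp: V_def smooth_map_def continuous_on_eq_continuous_at)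
    show "(chart_rep ?c ?d s has_derivative D\<sigma> (cmap ?c x)) (at (cmap ?c x))"
      using dif_\<sigma> x by (simp flip: \<sigma>_def)
  qed (use x in \<open>auto simp: V_def\<close>)

  define b where "b = coord1 CP ?d B"
  have b1: "Ck_on (Suc 0) (cimg ?d) (\<lambda>y. b y v)" for v
    using B(1) d(1) unfolding b_def smooth_1form_def smooth_on_def by blast
  have lin_b: "linear (b y)" if "y \<in> cimg ?d" for y
    unfolding b_def by (rule linear_coord1[OF manifolds(3) d(1) that B(2)])
  have b_x: "B q (coord_vec CP ?d q w) = b (cmap ?d q) w" if "q \<in> cdom ?d" for q w
    using cinv_cmap[OF manifolds(3) d(1) that] by (simp add: b_def coord1_def)

  \<comment> \<open>The action in coordinates.  It is differentiated in the group variable at the identity, with the point of the bundle as a parameter, which gives the fundamental vectors \<open>Ve\<close> in coordinates.\<close>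
  define \<Phi> where "\<Phi> w = cmap ?d ((\<lambda>(p, a). gact P p a) (cinv ?d (fst w), cinv ?e (snd w)))" for w
  let ?W = "map_prod (cmap ?d) (cmap ?e) ` (UNIV \<inter> (cdom ?d \<times> cdom ?e) \<inter> (\<lambda>(p, a). gact P p a) -` cdom ?d)"
  have \<Phi>1: "Ck_on (Suc 0) ?W \<Phi>"
    unfolding \<Phi>_def[abs_def] by (rule smooth_map_prod_chart(2)[OF manifolds(3) d(1) manifolds(2) e(1) manifolds(3) d(1) smooth_act open_UNIV])
  define i where "i z = (z, cmap ?e \<one>\<^bsub>GG\<^esub>)" for z :: 'q
  have i_W: "i z \<in> ?W" if z: "z \<in> cimg ?d" for z
  proof -
    obtain q where "q \<in> cdom ?d" "z = cmap ?d q" using z by blast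
    then show ?thesis
      by (intro image_eqI[of _ _ "(q, \<one>\<^bsub>GG\<^esub>)"]) (use e in \<open>auto simp: i_def act\<close>)
  qed
  define Ve where "Ve z X = frechet_derivative \<Phi> (at (i z)) (0, X)" for z X
  have cont_i: "continuous_on S i" for S
    unfolding i_def by (intro continuous_intros)
  have cont_Ve: "continuous_on (cimg ?d) (\<lambda>z. Ve z X)" for X
    unfolding Ve_def
    by (rule continuous_on_compose2[OF _ cont_i, where t = ?W and g = "\<lambda>w. frechet_derivative \<Phi> (at w) (0, X)"])
       (use \<Phi>1 i_W in auto)
  have dif_\<Phi>: "((\<lambda>y. \<Phi> (z, y)) has_derivative Ve z) (at (cmap ?e \<one>\<^bsub>GG\<^esub>))" if "z \<in> cimg ?d" for z
  proof -
    have "(\<Phi> has_derivative frechet_derivative \<Phi> (at (i z))) (at (z, cmap ?e \<one>\<^bsub>GG\<^esub>))"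
      using Ck_on_has_derivative[OF \<Phi>1 i_W[OF that]] by (simp add: i_def)
    from has_derivative_compose[OF has_derivative_Pair[OF has_derivative_const has_derivative_ident] this]
    show ?thesis
      unfolding Ve_def[abs_def] .
  qed
  have lin_Ve: "linear (Ve z)" if "z \<in> cimg ?d" for z
    using dif_\<Phi>[OF that] by (rule has_derivative_linear)
  have vert_x: "vert q X = coord_vec CP ?d q (Ve (cmap ?d q) X)" if q: "q \<in> cdom ?d" for q X
  proof -
    have "chart_rep ?e ?d (gact P q) = (\<lambda>y. \<Phi> (cmap ?d q, y))"
      using cinv_cmap[OF manifolds(3) d(1) q] by (simp add: chart_rep_def \<Phi>_def fun_eq_iff)
    then have "(chart_rep ?e ?d (gact P q) has_derivative Ve (cmap ?d q)) (at (cmap ?e \<one>\<^bsub>GG\<^esub>))"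
      using dif_\<Phi>[of "cmap ?d q"] q by simp
    from mdifferentiable_chart(2)[OF manifolds(2) e manifolds(3) d(1) _ _ this, of X]
    show ?thesis
      using q mdifferentiable_orbit[of q "\<one>\<^bsub>GG\<^esub>"]
      by (simp add: act mdifferentiable_def coord_vec_eq_chart_change chart_change_self[OF manifolds(2) e])
  qed

  \<comment> \<open>The horizontal lift of the coordinate vector \<open>u\<close>, in coordinates.\<close>
  define H where "H y u = D\<sigma> y u - Ve (\<sigma> y) (b (\<sigma> y) (D\<sigma> y u))" for y u
  have lin_H: "linear (H y)" if y: "y \<in> ?S" for y
  proof -
    have *: "\<sigma> y \<in> cimg ?d" using \<sigma>_img y by blast
    have "linear (Ve (\<sigma> y) \<circ> (b (\<sigma> y) \<circ> D\<sigma> y))"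
      by (intro linear_compose lin_D\<sigma> lin_b lin_Ve y *)
    from linear_compose_sub[OF lin_D\<sigma>[OF y] this] show ?thesis
      by (simp add: H_def[abs_def] o_def)
  qed
  have cont_H: "continuous_on ?S (\<lambda>y. H y u)" for u
    unfolding H_def
  proof (intro continuous_on_diff cont_D\<sigma>)
    show "continuous_on ?S (\<lambda>y. Ve (\<sigma> y) (b (\<sigma> y) (D\<sigma> y u)))"
    proof (rule fin_dim_continuous_on_eval[OF fin_dim_k])
      show "linear (Ve (\<sigma> y))" if "y \<in> ?S" for y using \<sigma>_img that by (intro lin_Ve) blast
      show "continuous_on ?S (\<lambda>y. Ve (\<sigma> y) X)" for X
        by (rule continuous_on_compose2[OF cont_Ve cont_\<sigma> \<sigma>_img])
      show "continuous_on ?S (\<lambda>y. b (\<sigma> y) (D\<sigma> y u))"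
      proof (rule fin_dim_continuous_on_eval[OF fin_dim_q _ _ cont_D\<sigma>])
        show "linear (b (\<sigma> y))" if "y \<in> ?S" for y using \<sigma>_img that by (intro lin_b) blast
        show "continuous_on ?S (\<lambda>y. b (\<sigma> y) v)" for v
          by (rule continuous_on_compose2[OF Ck_on_imp_continuous[OF b1] cont_\<sigma> \<sigma>_img])
      qed
    qed
  qed
  have hl_x: "hl (s x) (coord_vec CM ?c x u) = coord_vec CP ?d (s x) (H (cmap ?c x) u)" if x: "x \<in> V" for x u
  proof -
    have xU: "x \<in> U" "s x \<in> cdom ?d" using x by (auto simp: V_def)
    show ?thesis
      by (simp add: horizontal_lift_section(1)[OF U(1) xU(1) s(1,3)] ds[OF x] b_x[OF xU(2)] vert_x[OF xU(2)]
          H_def \<sigma>_x[OF x] linear_diff[OF linear_coord_vec[OF manifolds(3) d(1) xU(2)]])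
  qed

  have bil_d: "bilinear (flat_d b y)" if "y \<in> cimg ?d" for y
    by (rule flat_d_bilinear[OF open_cimg[OF manifolds(3) d(1)] that lin_b]) (use b1 that in auto)
  have cont_d: "continuous_on (cimg ?d) (\<lambda>y. flat_d b y u v)" for u v
    unfolding flat_d_def using b1 by (intro continuous_on_diff) auto
  have K: "curvature P B (s x) (coord_vec CM ?c x u) (coord_vec CM ?c x v) =
      flat_d b (\<sigma> (cmap ?c x)) (H (cmap ?c x) u) (H (cmap ?c x) v)" if x: "x \<in> V" for x u v
  proof -
    have "s x \<in> cdom ?d" using x by (auto simp: V_def)
    from ext_d1_chart[OF fin_dim_q manifolds(3) d(1) this B(1)] show ?thesis
      by (simp add: curvature_eq hl_x[OF x] \<sigma>_x[OF x] b_def)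
  qed
  have "continuous_on ?S (\<lambda>y. flat_d b (\<sigma> y) (H y u) (H y v))" for u v
  proof (rule fin_dim_continuous_on_eval2[OF fin_dim_q _ _ cont_H cont_H])
    show "bilinear (flat_d b (\<sigma> y))" if "y \<in> ?S" for y
      using \<sigma>_img that by (intro bil_d) blast
    show "continuous_on ?S (\<lambda>y. flat_d b (\<sigma> y) u v)" for u v
      by (rule continuous_on_compose2[OF cont_d cont_\<sigma> \<sigma>_img])
  qed
  from continuous_on_compose2[OF this continuous_on_subset[OF continuous_on_cmap[OF manifolds(1) c(1)] sub]]
  have "continuous_on V (\<lambda>x. flat_d b (\<sigma> (cmap ?c x)) (H (cmap ?c x) u) (H (cmap ?c x) v))" for u v
    by blast
  then have "continuous_on V (\<lambda>x. curvature P B (s x) (coord_vec CM ?c x u) (coord_vec CM ?c x v))" for u v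
    by (rule continuous_on_cong[THEN iffD1, rotated 2]) (simp_all add: K)
  then show thesis
    using that[of V s] V(1) U(2) c d s sub by (auto simp: V_def)
qed

end

lemma smooth_2tensor_continuous:
  assumes C: "smooth_manifold C" "c \<in> C" and g: "smooth_2tensor C g"
  shows "continuous_on (cdom c) (\<lambda>x. g x (coord_vec C c x u) (coord_vec C c x v))"
proof -
  have "Ck_on 0 (cimg c) (\<lambda>y. coord2 C c g y u v)"
    using C(2) g unfolding smooth_2tensor_def smooth_on_def by blast
  then have "continuous_on (cdom c) (\<lambda>x. coord2 C c g (cmap c x) u v)"
    by (intro continuous_on_compose2[OF _ continuous_on_cmap[OF C]]) auto
  then show ?thesis
    by (rule continuous_on_cong[THEN iffD1, rotated 2]) (simp_all add: coord2_def cinv_cmap[OF C])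
qed

lemma smooth_2tensor_bilinear:
  assumes "smooth_2tensor C g"
  shows "bilinear (g x)"
  using assms by (auto simp: smooth_2tensor_def bilinear_def)

lemma bilinear_coord_vec:
  assumes C: "smooth_manifold C" "c \<in> C" "x \<in> cdom c" and f: "bilinear f"
  shows "bilinear (\<lambda>u v. f (coord_vec C c x u) (coord_vec C c x v))"
proof -
  note l = linear_coord_vec[OF C]
  have 1: "linear (f u)" "linear (\<lambda>u. f u v)" for u v using f by (auto simp: bilinear_def)
  show ?thesis
    unfolding bilinear_def
    using linear_compose[OF l 1(1)] linear_compose[OF l 1(2)] by (simp add: o_def)
qed

text \<open>The Gram-Schmidt process applied to the coordinate vector fields of a chart.\<close>

lemma local_orthonormal_frame:
  fixes C :: "('m::{t2_space,second_countable_topology}, 'e::euclidean_space) atlas"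
  assumes C: "smooth_manifold C" "c \<in> C" and g: "riemannian_metric C g"
  obtains f :: "nat \<Rightarrow> 'm \<Rightarrow> 'e" where
    "\<And>i. i < DIM('e) \<Longrightarrow> continuous_on (cdom c) (f i)"
    "\<And>x. x \<in> cdom c \<Longrightarrow> orthonormal_basis (g x) ((\<lambda>i. coord_vec C c x (f i x)) ` {..<DIM('e)})"
    "\<And>x. x \<in> cdom c \<Longrightarrow> inj_on (\<lambda>i. coord_vec C c x (f i x)) {..<DIM('e)}"
proof -
  have g2: "smooth_2tensor C g" and sym: "g x u v = g x v u" and pos: "u \<noteq> 0 \<Longrightarrow> g x u u > 0" for x u v
    using g by (auto simp: riemannian_metric_def)
  let ?h = "\<lambda>x u v. g x (coord_vec C c x u) (coord_vec C c x v)"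
  have inj: "coord_vec C c x u \<noteq> 0" if x: "x \<in> cdom c" and u: "u \<noteq> 0" for x u
  proof
    assume 0: "coord_vec C c x u = 0"
    note cx = chart_at_in[OF C(1), of x]
    have "u = chart_change (chart_at C x) c x (coord_vec C c x u)"
      using chart_change_compose[OF C cx(1) C(2) x cx(2) x] chart_change_self[OF C x]
      by (simp add: coord_vec_eq_chart_change)
    then show False
      using u 0 linear_0[OF linear_chart_change(2)[OF C(1) cx(1) C(2) cx(2) x]] by simp
  qed
  have bil: "bilinear (?h x)" if "x \<in> cdom c" for x
    by (rule bilinear_coord_vec[OF C that smooth_2tensor_bilinear[OF g2]])
  define Q where "Q f x \<longleftrightarrow> (\<forall>i<card (Basis::'e set). \<forall>j<card (Basis::'e set). ?h x (f i x) (f j x) = (if i = j then 1 else 0)) \<and>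
        span ((\<lambda>i. f i x) ` {..<card (Basis::'e set)}) = span Basis" for f :: "nat \<Rightarrow> 'm \<Rightarrow> 'e" and x
  have "\<exists>f::nat \<Rightarrow> 'm \<Rightarrow> 'e. (\<forall>i<card (Basis::'e set). continuous_on (cdom c) (f i)) \<and> (\<forall>x\<in>cdom c. Q f x)"
    unfolding Q_def
  proof (rule gram_schmidt_continuous)
    show "continuous_on (cdom c) (\<lambda>x. ?h x (u x) (v x))"
      if "continuous_on (cdom c) u" "continuous_on (cdom c) v" for u v
      by (rule fin_dim_continuous_on_eval2[OF fin_dim_euclidean bil smooth_2tensor_continuous[OF C g2] that])
    show "?h x u u > 0" if "x \<in> cdom c" "u \<noteq> 0" for x u
      by (rule pos[OF inj[OF that]])
    show "independent (Basis :: 'e set)" by (rule independent_Basis)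
  qed (auto intro: bil sym)
  then obtain f :: "nat \<Rightarrow> 'm \<Rightarrow> 'e" where f: "\<forall>i<card (Basis::'e set). continuous_on (cdom c) (f i)" "\<forall>x\<in>cdom c. Q f x"
    by blast
  have "orthonormal_basis (g x) ((\<lambda>i. coord_vec C c x (f i x)) ` {..<DIM('e)}) \<and>
      inj_on (\<lambda>i. coord_vec C c x (f i x)) {..<DIM('e)}" if x: "x \<in> cdom c" for x
  proof -
    have Q: "Q f x" using f(2) x by blast
    have "span ((\<lambda>i. coord_vec C c x (f i x)) ` {..<DIM('e)}) = coord_vec C c x ` span ((\<lambda>i. f i x) ` {..<DIM('e)})"
      using span_linear_image[OF linear_coord_vec[OF C x], of "(\<lambda>i. f i x) ` {..<DIM('e)}"]
      by (simp add: image_image)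
    also have "\<dots> = UNIV"
      using Q surjI[of "coord_vec C c x" "chart_change (chart_at C x) c x", OF coord_vec_surj[OF C x]] by (simp add: Q_def)
    finally have sp: "span ((\<lambda>i. coord_vec C c x (f i x)) ` {..<DIM('e)}) = UNIV" .
    show ?thesis
      using frame_of_family[of "DIM('e)" "g x" "\<lambda>i. coord_vec C c x (f i x)", OF _ sp] Q by (simp add: Q_def)
  qed
  then show thesis using that[of f] f(1) by simp
qed

locale symplectic_bundle = metric_bundle P ip
  for P :: "('m::{t2_space,second_countable_topology}, 'e::euclidean_space,
               'g::{t2_space,second_countable_topology}, 'k::real_normed_vector,
               'p::{t2_space,second_countable_topology}, 'q::real_normed_vector) pbundle"
   and ip :: "'k \<Rightarrow> 'k \<Rightarrow> real" +
  fixes n :: nat and \<omega> g :: "'m \<Rightarrow> 'e \<Rightarrow> 'e \<Rightarrow> real" and J :: "'m \<Rightarrow> 'e \<Rightarrow> 'e"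
  assumes n: "n > 0" "DIM('e) = 2 * n" and compat: "compatible_triple (base_atlas P) \<omega> g J"
begin

lemma metric: "riemannian_metric CM g" "smooth_2tensor CM g" "bilinear (g x)" "g x u v = g x v u"
  using compat by (auto simp: compatible_triple_def riemannian_metric_def smooth_2tensor_bilinear)

lemma form: "smooth_2tensor CM \<omega>" "bilinear (\<omega> x)" "\<omega> x u u = 0"
  using compat by (auto simp: compatible_triple_def symplectic_form_def smooth_2tensor_bilinear)

lemma frame: "orthonormal_basis (g x) (orthonormal_frame (g x))"
proof -
  obtain f where "orthonormal_basis (g x) ((\<lambda>i. coord_vec CM (chart_at CM x) x (f i x)) ` {..<DIM('e)})"
    using local_orthonormal_frame[OF manifolds(1) chart_at_in(1)[OF manifolds(1)] metric(1)]
      chart_at_in(2)[OF manifolds(1)] by metis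
  then show ?thesis by (rule orthonormal_basis_orthonormal_frame)
qed

lemma form_norm: "(\<Sum>u\<in>orthonormal_frame (g x). \<Sum>v\<in>orthonormal_frame (g x). \<omega> x u v * \<omega> x u v) = 2 * real n"
proof -
  have J: "J x (J x u) = - u" "g x u v = \<omega> x u (J x v)" for u v
    using compat by (auto simp: compatible_triple_def almost_complex_def)
  show ?thesis
    using compatible_form_norm[OF frame metric(3,4) form(2,3) J] card_frame[OF frame metric(3)] n(2) by simp
qed

text \<open>All three norms are evaluated at the same point of the fibre over \<open>x\<close>, so that this is linear algebra
at that point.\<close>

lemma norm_sq_decomposition:
  "norm_sq_2form P g ip (curvature P B) x =
   norm_sq_2form P g ip (primitive_curvature P n \<omega> g ip B) x + norm_sq_2form P g ip (Phi_omega P n \<omega> g ip B) x"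
proof -
  define p where "p = (SOME p. bproj P p = x)"
  have p: "bproj P p = x" unfolding p_def using bproj_surj by (rule someI_ex)
  show ?thesis
    using primitive_decomposition_norm(2)[OF ip n(1) form_norm, of x "curvature P B p"]
    by (simp add: norm_sq_2form_def Let_def p primitive_curvature_def[abs_def] Phi_omega_def Phi_def flip: p_def)
qed

lemma Phi_eq:
  "Phi P n \<omega> g ip B p = (1 / real n) *\<^sub>R (1 / 2) *\<^sub>R
     (\<Sum>u\<in>orthonormal_frame (g (bproj P p)). \<Sum>v\<in>orthonormal_frame (g (bproj P p)).
        \<omega> (bproj P p) u v *\<^sub>R curvature P B p u v)"
  by (simp add: Phi_def Lambda_eq[OF ip])

lemma Phi_omega_equivariant:
  assumes "equivariant (curvature P B)"
  shows "equivariant (Phi_omega P n \<omega> g ip B)"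
proof -
  have "Phi P n \<omega> g ip B (gact P p a) = bAd P (inv\<^bsub>GG\<^esub> a) (Phi P n \<omega> g ip B p)" for p a
    using assms by (simp add: Phi_eq act equivariant_def linear_scale[OF linear_bAd] linear_sum[OF linear_bAd])
  then show ?thesis
    by (simp add: equivariant_def Phi_omega_def Lop_def act linear_scale[OF linear_bAd])
qed

text \<open>Near a given point, equivariance moves the computation to a local section of the bundle, and the
invariance of traces moves it to a continuous orthonormal frame \<open>E\<close>.  What remains is a finite sum of
continuous functions.\<close>

lemma norm_sq_continuous:
  assumes "connection P B"
  shows "continuous_on UNIV (norm_sq_2form P g ip (curvature P B))"
    and "continuous_on UNIV (norm_sq_2form P g ip (Phi_omega P n \<omega> g ip B))"
proof -
  interpret bundle_connection P ip B by unfold_locales (rule assms)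
  interpret ip: bounded_bilinear ip using ip by (simp add: inner_product_def)
  let ?F = "norm_sq_2form P g ip (curvature P B)"
  let ?Q = "norm_sq_2form P g ip (Phi_omega P n \<omega> g ip B)"
  have "isCont ?F x0 \<and> isCont ?Q x0" for x0
  proof -
    obtain p0 where p0: "bproj P p0 = x0" using bproj_surj by blast
    let ?c = "chart_at CM x0"
    note c = chart_at_in[OF manifolds(1), of x0]
    obtain U s where U: "open U" "x0 \<in> U" "\<And>x. x \<in> U \<Longrightarrow> bproj P (s x) = x" "U \<subseteq> cdom ?c"
      and K: "\<And>u v. continuous_on U (\<lambda>x. curvature P B (s x) (coord_vec CM ?c x u) (coord_vec CM ?c x v))"
      by (rule curvature_locally_continuous[of p0, unfolded p0]) (rule that)
    obtain f :: "nat \<Rightarrow> 'm \<Rightarrow> 'e" where f: "\<And>i. i < DIM('e) \<Longrightarrow> continuous_on (cdom ?c) (f i)"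
      "\<And>x. x \<in> cdom ?c \<Longrightarrow> orthonormal_basis (g x) ((\<lambda>i. coord_vec CM ?c x (f i x)) ` {..<DIM('e)})"
      "\<And>x. x \<in> cdom ?c \<Longrightarrow> inj_on (\<lambda>i. coord_vec CM ?c x (f i x)) {..<DIM('e)}"
      by (rule local_orthonormal_frame[OF manifolds(1) c(1) metric(1)]) (rule that)
    let ?E = "\<lambda>i x. coord_vec CM ?c x (f i x)"
    let ?I = "{..<DIM('e)}"
    have fU: "continuous_on U (f i)" if "i < DIM('e)" for i
      using continuous_on_subset[OF f(1)[OF that] U(4)] .
    have contK: "continuous_on U (\<lambda>x. curvature P B (s x) (?E i x) (?E j x))" if "i < DIM('e)" "j < DIM('e)" for i j
      by (rule fin_dim_continuous_on_eval2[OF fin_dim_euclidean bilinear_coord_vec[OF manifolds(1) c(1) _ curvature_bilinear] K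
            fU[OF that(1)] fU[OF that(2)]]) (use U(4) in blast)
    have cont\<omega>: "continuous_on U (\<lambda>x. \<omega> x (?E i x) (?E j x))" if "i < DIM('e)" "j < DIM('e)" for i j
      by (rule fin_dim_continuous_on_eval2[OF fin_dim_euclidean bilinear_coord_vec[OF manifolds(1) c(1) _ form(2)]
            continuous_on_subset[OF smooth_2tensor_continuous[OF manifolds(1) c(1) form(1)] U(4)]
            fU[OF that(1)] fU[OF that(2)]]) (use U(4) in blast)
    have tr: "(\<Sum>u\<in>orthonormal_frame (g x). \<Sum>v\<in>orthonormal_frame (g x). ip (\<alpha> u v) (\<beta> u v)) =
        (\<Sum>i\<in>?I. \<Sum>j\<in>?I. ip (\<alpha> (?E i x) (?E j x)) (\<beta> (?E i x) (?E j x)))"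
      "(\<Sum>u\<in>orthonormal_frame (g x). \<Sum>v\<in>orthonormal_frame (g x). \<omega> x u v *\<^sub>R \<beta> u v) =
        (\<Sum>i\<in>?I. \<Sum>j\<in>?I. \<omega> x (?E i x) (?E j x) *\<^sub>R \<beta> (?E i x) (?E j x))"
      if x: "x \<in> U" and ab: "bilinear \<alpha>" "bilinear \<beta>"
      for x and \<alpha> \<beta> :: "'e \<Rightarrow> 'e \<Rightarrow> 'k"
    proof -
      have xc: "x \<in> cdom ?c" using x U(4) by blast
      note eq = frame_double_trace_eq[OF frame f(2)[OF xc] metric(3,4)]
      show "(\<Sum>u\<in>orthonormal_frame (g x). \<Sum>v\<in>orthonormal_frame (g x). ip (\<alpha> u v) (\<beta> u v)) =
        (\<Sum>i\<in>?I. \<Sum>j\<in>?I. ip (\<alpha> (?E i x) (?E j x)) (\<beta> (?E i x) (?E j x)))"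
        by (simp add: eq[OF ip.bounded_bilinear_axioms ab] sum.reindex[OF f(3)[OF xc]])
      show "(\<Sum>u\<in>orthonormal_frame (g x). \<Sum>v\<in>orthonormal_frame (g x). \<omega> x u v *\<^sub>R \<beta> u v) =
        (\<Sum>i\<in>?I. \<Sum>j\<in>?I. \<omega> x (?E i x) (?E j x) *\<^sub>R \<beta> (?E i x) (?E j x))"
        by (simp add: eq[OF bounded_bilinear_scaleR form(2) ab(2)] sum.reindex[OF f(3)[OF xc]])
    qed
    \<comment> \<open>\<open>\<Phi>\<close> along the section, as \<open>1 / n\<close> times the contraction of the curvature with \<open>\<omega>\<close> in the frame.\<close>
    define \<phi> where "\<phi> x = (1 / real n) *\<^sub>R (1 / 2) *\<^sub>R
        (\<Sum>i\<in>?I. \<Sum>j\<in>?I. \<omega> x (?E i x) (?E j x) *\<^sub>R curvature P B (s x) (?E i x) (?E j x))" for x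
    have F: "?F x = (1 / 2) * (\<Sum>i\<in>?I. \<Sum>j\<in>?I. ip (curvature P B (s x) (?E i x) (?E j x)) (curvature P B (s x) (?E i x) (?E j x)))"
      if x: "x \<in> U" for x
      using norm_sq_2form_at[OF curvature_equivariant, of g "s x"] U(3)[OF x]
        tr(1)[OF x curvature_bilinear[of "s x"] curvature_bilinear[of "s x"]]
      by (simp add: inner_2form_def)
    have Q: "?Q x = real n * ip (\<phi> x) (\<phi> x)" if x: "x \<in> U" for x
    proof -
      have "Phi P n \<omega> g ip B (s x) = \<phi> x"
        using tr(2)[OF x curvature_bilinear[of "s x"] curvature_bilinear[of "s x"]] U(3)[OF x]
        by (simp add: Phi_eq \<phi>_def)
      then show ?thesis
        using norm_sq_2form_at[OF Phi_omega_equivariant[OF curvature_equivariant], of g "s x"] U(3)[OF x]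
          primitive_decomposition_norm(1)[OF ip n(1) form_norm, of x "curvature P B (s x)"]
        by (simp add: Phi_omega_def Phi_def)
    qed
    have cont\<phi>: "continuous_on U \<phi>"
      unfolding \<phi>_def by (intro continuous_intros cont\<omega> contK) auto
    have "continuous_on U ?F"
      by (rule continuous_on_cong[THEN iffD2, OF refl F]) (auto intro!: continuous_intros ip.continuous_on contK)
    moreover have "continuous_on U ?Q"
      by (rule continuous_on_cong[THEN iffD2, OF refl Q]) (auto intro!: continuous_intros ip.continuous_on cont\<phi>)
    ultimately show ?thesis
      using U(1,2) by (simp add: continuous_on_eq_continuous_at)
  qed
  then show "continuous_on UNIV ?F" "continuous_on UNIV ?Q"
    by (simp_all add: continuous_on_eq_continuous_at)
qed

end

section \<open>Integration over compact sets\<close>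

lemma liouville_density_continuous:
  fixes C :: "('m::{t2_space,second_countable_topology}, 'e::euclidean_space) atlas"
  assumes C: "smooth_manifold C" "c \<in> C" and \<omega>: "smooth_2tensor C \<omega>"
  shows "continuous_on (cimg c) (\<lambda>y. liouville_form n (\<omega> (cinv c y)) (\<lambda>i. coord_vec C c (cinv c y) (b i)))"
proof -
  have "Ck_on 0 (cimg c) (\<lambda>y. coord2 C c \<omega> y u v)" for u v
    using C(2) \<omega> unfolding smooth_2tensor_def smooth_on_def by blast
  then have "continuous_on (cimg c) (\<lambda>y. \<omega> (cinv c y) (coord_vec C c (cinv c y) u) (coord_vec C c (cinv c y) v))" for u v
    by (simp add: coord2_def)
  then show ?thesis
    unfolding liouville_form_def by (intro continuous_intros)
qed

text \<open>The density of the measure in a chart is continuous, hence bounded on closed balls, and finitely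
many such balls cover a compact set.\<close>

lemma liouville_measure_compact_finite:
  fixes C :: "('m::{t2_space,second_countable_topology}, 'e::euclidean_space) atlas"
  assumes C: "smooth_manifold C" and \<omega>: "smooth_2tensor C \<omega>" and n: "DIM('e) = 2 * n"
    and vol: "liouville_measure C n \<omega> vol" and K: "compact K"
  shows "emeasure vol K < \<infinity>"
proof -
  have sets: "sets vol = sets borel" using vol by (simp add: liouville_measure_def)
  have vol_chart: "emeasure vol S = (\<integral>\<^sup>+ y\<in>cmap c ` S.
       ennreal \<bar>liouville_form n (\<omega> (cinv c y)) (\<lambda>i. coord_vec C c (cinv c y) (b i))\<bar> \<partial>lborel)"
    if "c \<in> C" "bij_betw b {..<2 * n} Basis" "S \<in> sets borel" "S \<subseteq> cdom c" for c b S
    using vol that unfolding liouville_measure_def by blast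
  obtain b :: "nat \<Rightarrow> 'e" where b: "bij_betw b {..<2 * n} Basis"
    using ex_bij_betw_nat_finite[OF finite_Basis[where 'a = 'e]] n by (auto simp: atLeast0LessThan)
  have "\<exists>V S. open V \<and> x \<in> V \<and> V \<subseteq> S \<and> S \<in> sets borel \<and> emeasure vol S < \<infinity>" for x
  proof -
    let ?c = "chart_at C x"
    note c = chart_at_in[OF C, of x]
    obtain r where r: "r > 0" "cball (cmap ?c x) r \<subseteq> cimg ?c"
      using open_contains_cball[THEN iffD1, OF open_cimg[OF C c(1)]] c(2) by blast
    let ?K = "cball (cmap ?c x) r"
    let ?S = "cinv ?c ` ?K"
    let ?\<rho> = "\<lambda>y. liouville_form n (\<omega> (cinv ?c y)) (\<lambda>i. coord_vec C ?c (cinv ?c y) (b i))"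
    have "compact ?S"
      by (rule compact_continuous_image[OF continuous_on_subset[OF continuous_on_cinv[OF C c(1)] r(2)] compact_cball])
    then have S: "?S \<in> sets borel" by (intro borel_closed compact_imp_closed)
    have Sc: "?S \<subseteq> cdom ?c" using cinv_in[OF C c(1)] r(2) by blast
    have img: "cmap ?c ` ?S = ?K"
      using cmap_cinv[OF C c(1)] r(2) by (force simp: image_image)
    have "compact (?\<rho> ` ?K)"
      by (rule compact_continuous_image[OF continuous_on_subset[OF liouville_density_continuous[OF C c(1) \<omega>] r(2)] compact_cball])
    then obtain M where M: "\<And>y. y \<in> ?K \<Longrightarrow> \<bar>?\<rho> y\<bar> \<le> M"
      using compact_imp_bounded[THEN bounded_iff[THEN iffD1]] by fastforce
    have "emeasure vol ?S = (\<integral>\<^sup>+ y\<in>?K. ennreal \<bar>?\<rho> y\<bar> \<partial>lborel)"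
      using vol_chart[OF c(1) b S Sc] unfolding img .
    also have "\<dots> \<le> (\<integral>\<^sup>+ y. ennreal M * indicator ?K y \<partial>lborel)"
      by (intro nn_integral_mono) (simp add: indicator_def ennreal_leI[OF M] del: mem_cball)
    also have "\<dots> = ennreal M * emeasure lborel ?K"
      by (subst nn_integral_cmult_indicator) auto
    also have "\<dots> < \<infinity>"
      using emeasure_bounded_finite[OF bounded_cball, of "cmap ?c x" r]
      by (auto simp: ennreal_mult_less_top)
    finally have fin: "emeasure vol ?S < \<infinity>" .
    let ?V = "cdom ?c \<inter> cmap ?c -` ball (cmap ?c x) r"
    have "open ?V"
      by (rule continuous_open_preimage[OF continuous_on_cmap[OF C c(1)] open_cdom[OF C c(1)] open_ball])
    moreover have "x \<in> ?V" using c r by simp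
    moreover have "?V \<subseteq> ?S"
    proof
      fix z assume z: "z \<in> ?V"
      then have "z = cinv ?c (cmap ?c z)" using cinv_cmap[OF C c(1)] by simp
      then show "z \<in> ?S" using z by (intro image_eqI[of _ _ "cmap ?c z"]) auto
    qed
    ultimately show ?thesis using S fin by blast
  qed
  then obtain V S where VS: "\<And>x. open (V x)" "\<And>x. x \<in> V x" "\<And>x. V x \<subseteq> S x" "\<And>x. S x \<in> sets borel"
      "\<And>x. emeasure vol (S x) < \<infinity>"
    by metis
  obtain T where T: "T \<subseteq> K" "finite T" "K \<subseteq> (\<Union>x\<in>T. V x)"
    using compactE_image[OF K, of K V] VS(1,2) by blast
  have "emeasure vol K \<le> emeasure vol (\<Union>x\<in>T. S x)"
  proof (rule emeasure_mono)
    show "K \<subseteq> (\<Union>x\<in>T. S x)" using T(3) VS(3) by blast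
    show "(\<Union>x\<in>T. S x) \<in> sets vol" using T(2) VS(4) sets by (intro sets.finite_UN) auto
  qed
  also have "\<dots> \<le> (\<Sum>x\<in>T. emeasure vol (S x))"
    using T(2) VS(4) sets by (intro emeasure_subadditive_finite) auto
  also have "\<dots> < \<infinity>"
    using T(2) VS(5) by simp
  finally show ?thesis .
qed

lemma continuous_set_integrable_compact:
  fixes f :: "'m::{t2_space,second_countable_topology} \<Rightarrow> real"
  assumes f: "continuous_on UNIV f" and K: "compact K" and M: "sets M = sets borel" "emeasure M K < \<infinity>"
  shows "set_integrable M K f"
proof -
  have "compact (f ` K)" by (rule compact_continuous_image[OF continuous_on_subset[OF f] K]) simp
  then obtain b where b: "\<And>x. x \<in> K \<Longrightarrow> norm (f x) \<le> b"
    using compact_imp_bounded[THEN bounded_iff[THEN iffD1]] by fastforce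
  have "K \<in> sets M" using K M(1) by (simp add: compact_imp_closed)
  moreover have "f \<in> borel_measurable M"
    using borel_measurable_continuous_onI[OF f] measurable_cong_sets[OF M(1) refl] by blast
  ultimately show ?thesis
    unfolding set_integrable_def by (intro integrableI_bounded_set_indicator[where B = b]) (use M(2) b in auto)
qed

section \<open>The three functionals\<close>

context symplectic_bundle
begin

text \<open>The first and the last integrand are continuous; the density of the primitive part is their
difference.\<close>

lemma functional_decomposition:
  assumes vol: "liouville_measure CM n \<omega> vol" and B: "connection P B" and K: "compact K"
  shows "(LINT x:K|vol. norm_sq_2form P g ip (curvature P B) x) =
    (LINT x:K|vol. norm_sq_2form P g ip (primitive_curvature P n \<omega> g ip B) x) +
    (LINT x:K|vol. norm_sq_2form P g ip (Phi_omega P n \<omega> g ip B) x)"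
proof -
  let ?F = "norm_sq_2form P g ip (curvature P B)" and ?Q = "norm_sq_2form P g ip (Phi_omega P n \<omega> g ip B)"
    and ?R = "norm_sq_2form P g ip (primitive_curvature P n \<omega> g ip B)"
  have sets: "sets vol = sets borel" using vol by (simp add: liouville_measure_def)
  note fin = liouville_measure_compact_finite[OF manifolds(1) form(1) n(2) vol K]
  have int: "set_integrable vol K ?F" "set_integrable vol K ?Q"
    by (rule continuous_set_integrable_compact[OF _ K sets fin], rule norm_sq_continuous[OF B])+
  have "(LINT x:K|vol. ?R x) = (LINT x:K|vol. ?F x - ?Q x)"
    by (simp add: norm_sq_decomposition)
  also have "\<dots> = (LINT x:K|vol. ?F x) - (LINT x:K|vol. ?Q x)"
    by (rule set_integral_diff(2)[OF int])
  finally show ?thesis by simp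
qed

lemma critical_two_of_three:
  assumes vol: "liouville_measure CM n \<omega> vol" and A: "connection P A"
  defines "cF \<equiv> critical P g ip vol (curvature P) A"
    and "cR \<equiv> critical P g ip vol (primitive_curvature P n \<omega> g ip) A"
    and "cQ \<equiv> critical P g ip vol (Phi_omega P n \<omega> g ip) A"
  shows "cR \<Longrightarrow> cQ \<Longrightarrow> cF" "cF \<Longrightarrow> cQ \<Longrightarrow> cR" "cF \<Longrightarrow> cR \<Longrightarrow> cQ"
proof -
  let ?I = "\<lambda>\<Psi> \<eta> K t. LINT x:K|vol. norm_sq_2form P g ip (\<Psi> (shift_connection P A t \<eta>)) x"
  let ?F = "?I (curvature P)" and ?R = "?I (primitive_curvature P n \<omega> g ip)" and ?Q = "?I (Phi_omega P n \<omega> g ip)"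
  have sum: "?F \<eta> K t = ?R \<eta> K t + ?Q \<eta> K t" if "ad_1form P \<eta>" "compact K" for \<eta> K t
    by (rule functional_decomposition[OF vol connection_shift[OF A that(1)] that(2)])
  show cF if "cR" "cQ"
    unfolding cF_def critical_def
  proof (intro allI impI)
    fix \<eta> K assume *: "ad_1form P \<eta> \<and> compact (ad_support P \<eta>) \<and> compact K \<and> ad_support P \<eta> \<subseteq> K"
    then have "(?R \<eta> K has_real_derivative 0) (at 0)" "(?Q \<eta> K has_real_derivative 0) (at 0)"
      using that unfolding cR_def cQ_def critical_def by blast+
    from DERIV_add[OF this] show "(?F \<eta> K has_real_derivative 0) (at 0)"
      using * by (simp add: sum)
  qed
  show cR if "cF" "cQ"
    unfolding cR_def critical_def
  proof (intro allI impI)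
    fix \<eta> K assume *: "ad_1form P \<eta> \<and> compact (ad_support P \<eta>) \<and> compact K \<and> ad_support P \<eta> \<subseteq> K"
    then have "(?F \<eta> K has_real_derivative 0) (at 0)" "(?Q \<eta> K has_real_derivative 0) (at 0)"
      using that unfolding cF_def cQ_def critical_def by blast+
    from DERIV_diff[OF this] show "(?R \<eta> K has_real_derivative 0) (at 0)"
      using * by (simp add: sum)
  qed
  show cQ if "cF" "cR"
    unfolding cQ_def critical_def
  proof (intro allI impI)
    fix \<eta> K assume *: "ad_1form P \<eta> \<and> compact (ad_support P \<eta>) \<and> compact K \<and> ad_support P \<eta> \<subseteq> K"
    then have "(?F \<eta> K has_real_derivative 0) (at 0)" "(?R \<eta> K has_real_derivative 0) (at 0)"
      using that unfolding cF_def cR_def critical_def by blast+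
    from DERIV_diff[OF this] show "(?Q \<eta> K has_real_derivative 0) (at 0)"
      using * by (simp add: sum)
  qed
qed

end

theorem corollary3p7:
  fixes P :: "('m::{t2_space,second_countable_topology}, 'e::euclidean_space,
               'g::{t2_space,second_countable_topology}, 'k::real_normed_vector,
               'p::{t2_space,second_countable_topology}, 'q::real_normed_vector) pbundle"
    and n :: nat
    and \<omega> g :: "'m \<Rightarrow> 'e \<Rightarrow> 'e \<Rightarrow> real"
    and J :: "'m \<Rightarrow> 'e \<Rightarrow> 'e"
    and ip :: "'k \<Rightarrow> 'k \<Rightarrow> real"
    and vol :: "'m measure"
    and A :: "'p \<Rightarrow> 'q \<Rightarrow> 'k"
  assumes "n \<ge> 2" and "DIM('e) = 2 * n"
    and "principal_bundle P"
    and "compact (UNIV :: 'g set)"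
    and "Ad_invariant_inner (group_atlas P) (group_str P) ip"
    and "compatible_triple (base_atlas P) \<omega> g J"
    and "liouville_measure (base_atlas P) n \<omega> vol"
    and "connection P A"
    and "(critical P g ip vol (curvature P) A \<and>
          critical P g ip vol (primitive_curvature P n \<omega> g ip) A) \<or>
         (critical P g ip vol (curvature P) A \<and>
          critical P g ip vol (Phi_omega P n \<omega> g ip) A) \<or>
         (critical P g ip vol (primitive_curvature P n \<omega> g ip) A \<and>
          critical P g ip vol (Phi_omega P n \<omega> g ip) A)"
  shows "critical P g ip vol (curvature P) A \<and>
         critical P g ip vol (primitive_curvature P n \<omega> g ip) A \<and>
         critical P g ip vol (Phi_omega P n \<omega> g ip) A"
proof -
  interpret symplectic_bundle P ip n \<omega> g J
    by unfold_locales (use assms in auto)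
  show ?thesis
    using critical_two_of_three[OF assms(7,8)] assms(9) by blast
qed

end
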